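(* For every $\beta\in\mathbb R$, $t,k\in\mathbb N$ and $a\in\mathbb N_0$ there exists $C=C_{a,t,k,\beta}>0$ such that $$\mathbb E\left[\left(\sqrt N^{\,|\alpha|+\mathcal C_\alpha(p)}\,\partial_\alpha m^{(k)}_p\right)^{2t}\right]\le C$$ for all $N\in\mathbb N$, all multiindices $\alpha\in\mathbb N_0^{\mathfrak p_N}$ with $|\alpha|=a$, all $p\le N$ and all $h\in\mathbb R$, where $\mathcal C_\alpha(p)$ denotes the number of connected components of the multigraph $\alpha$ that do not contain $p$.
   Context: Setup. For each $N\in\mathbb{N}$ let $\{g_{ij}\}_{1\le i<j\le N}$ be independent standard Gaussians, $g_{ji}:=g_{ij}$, $g_{ii}:=0$. For a smooth function $F$ of these variables, $\mathfrak d_{ij}F:=dF/dg_{ij}$ (derivative with respect to the single variable $g_{ij}=g_{ji}$), and $\mathfrak d_{ii}:=0$. For each $N$ a starting value $\mathbf m^{(1)}\in[-1,1]^N$ is given, deterministic or independent of the $g_{ij}$; $\mathbb E$ denotes expectation with respect to the $g_{ij}$, with $\mathbf m^{(1)}$ held fixed, and constants do not depend on $\mathbf m^{(1)}$. For $k\ge1$ define $$m^{(k+1)}_i:=\tanh(h+Y^{(k)}_i),\qquad Y^{(k)}_i:=\frac{\beta}{\sqrt N}\sum_{j=1}^N g_{ij}m^{(k)}_j-\mathrm{On}^{(k)}_i,$$ where $\mathrm{On}^{(k)}_i$ is (consistently for all $k$) one of the following: (I) $\mathrm{On}^{(k)}_i:=\beta^2(1-q^{(k)}_N)m^{(k-1)}_i$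 with $\mathbf m^{(0)}:=0$ and $q^{(k)}_N:=\frac1N\sum_{i=1}^N (m^{(k)}_i)^2$; (II) $\mathrm{On}^{(k)}_i:=\frac{\beta}{\sqrt N}\sum_{j=1}^N\mathfrak d_{ij}m^{(k)}_j$. The result holds for both choices. Multiindices. $\mathfrak p_N:=\{\{i,j\}:1\le i<j\le N\}$. For $\alpha\in\mathbb N_0^{\mathfrak p_N}$: $|\alpha|:=\sum_{x\in\mathfrak p_N}\alpha_x$ and $\partial_\alpha:=\prod_{x\in\mathfrak p_N}(\mathfrak d_x)^{\alpha_x}$. To $\alpha$ one associates the undirected multigraph with vertex set $\{i:\exists j,\ \alpha_{\{i,j\}}>0\}$ and $\alpha_{\{i,j\}}$ edges between $i$ and $j$ (so there are no isolated vertices). *)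

theory Defs
  imports "HOL-Probability.Probability"
begin

definition pairs :: "nat \<Rightarrow> nat set set" where
  "pairs N = {{i, j} | i j. 1 \<le> i \<and> i < j \<and> j \<le> N}"

text \<open>A disorder configuration is a function on unordered pairs of vertices, so the symmetry
  of the couplings is built in.\<close>

type_synonym disorder = "nat set \<Rightarrow> real"

definition coupling :: "disorder \<Rightarrow> nat \<Rightarrow> nat \<Rightarrow> real" where
  "coupling g i j = (if i = j then 0 else g {i, j})"

text \<open>Only the coordinates in \<open>pairs N\<close> of the random configuration are constrained; the
  iteration below, for system size \<open>N\<close>, does not depend on the others.\<close>

definition gaussian_disorder :: "nat \<Rightarrow> 'w measure \<Rightarrow> (nat set \<Rightarrow> 'w \<Rightarrow> real) \<Rightarrow> bool" where
  "gaussian_disorder N M X \<longleftrightarrow>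
     prob_space M \<and>
     prob_space.indep_vars M (\<lambda>_. borel) X (pairs N) \<and>
     (\<forall>x\<in>pairs N. distributed M lborel (X x) std_normal_density)"

definition dpair :: "nat set \<Rightarrow> (disorder \<Rightarrow> real) \<Rightarrow> disorder \<Rightarrow> real" where
  "dpair x F = (\<lambda>g. deriv (\<lambda>s. F (g(x := s))) (g x))"

definition dd :: "nat \<Rightarrow> nat \<Rightarrow> (disorder \<Rightarrow> real) \<Rightarrow> disorder \<Rightarrow> real" where
  "dd i j F = (if i = j then (\<lambda>_. 0) else dpair {i, j} F)"

datatype onsager = Memory | Derivative

text \<open>The arguments \<open>m\<close> and \<open>m'\<close> are the current and the previous iterate.\<close>

fun onsager_term :: "onsager \<Rightarrow> nat \<Rightarrow> real \<Rightarrow> (nat \<Rightarrow> disorder \<Rightarrow> real) \<Rightarrow>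
    (nat \<Rightarrow> disorder \<Rightarrow> real) \<Rightarrow> nat \<Rightarrow> disorder \<Rightarrow> real" where
  "onsager_term Memory N \<beta> m m' i g =
     \<beta>\<^sup>2 * (1 - (1 / real N) * (\<Sum>j=1..N. (m j g)\<^sup>2)) * m' i g"
| "onsager_term Derivative N \<beta> m m' i g =
     \<beta> / sqrt (real N) * (\<Sum>j=1..N. dd i j (m j) g)"

text \<open>\<open>mag v N \<beta> h m1 k i\<close> is the \<open>i\<close>-th component of the \<open>k\<close>-th iterate started at
  \<open>m1\<close>, as a function of the disorder.\<close>

fun mag :: "onsager \<Rightarrow> nat \<Rightarrow> real \<Rightarrow> real \<Rightarrow> (nat \<Rightarrow> real) \<Rightarrow> nat \<Rightarrow> nat \<Rightarrow> disorder \<Rightarrow> real" where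
  "mag v N \<beta> h m1 0 = (\<lambda>i g. 0)"
| "mag v N \<beta> h m1 (Suc 0) = (\<lambda>i g. m1 i)"
| "mag v N \<beta> h m1 (Suc (Suc k)) = (\<lambda>i g. tanh (h +
     (\<beta> / sqrt (real N) * (\<Sum>j=1..N. coupling g i j * mag v N \<beta> h m1 (Suc k) j g)
      - onsager_term v N \<beta> (mag v N \<beta> h m1 (Suc k)) (mag v N \<beta> h m1 k) i g)))"

definition multiindex :: "nat \<Rightarrow> (nat set \<Rightarrow> nat) \<Rightarrow> bool" where
  "multiindex N \<alpha> \<longleftrightarrow> (\<forall>x. x \<notin> pairs N \<longrightarrow> \<alpha> x = 0)"

definition mi_order :: "nat \<Rightarrow> (nat set \<Rightarrow> nat) \<Rightarrow> nat" where
  "mi_order N \<alpha> = (\<Sum>x\<in>pairs N. \<alpha> x)"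

text \<open>The composition of the operators \<open>dpair x\<close> is taken along an enumeration of \<open>pairs N\<close>;
  on smooth functions these operators commute, so the choice of enumeration is immaterial.\<close>

definition pair_list :: "nat \<Rightarrow> nat set list" where
  "pair_list N = [{i, j}. i \<leftarrow> [1..<Suc N], j \<leftarrow> [Suc i..<Suc N]]"

lemma set_pair_list: "set (pair_list N) = pairs N"
  unfolding pair_list_def pairs_def
  by (fastforce simp: Suc_le_eq less_Suc_eq_le simp del: upt_Suc)

lemma distinct_pair_list: "distinct (pair_list N)"
proof -
  have "distinct (concat (map (\<lambda>i. map (\<lambda>j. {i, j}) [Suc i..<Suc N]) is))"
    if "distinct is" for "is" :: "nat list"
    using that
  proof (induction "is")
    case (Cons i js)
    have "inj_on (\<lambda>j. {i, j}) A" for A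
      by (auto simp: inj_on_def doubleton_eq_iff)
    with Cons show ?case
      by (auto simp: distinct_map doubleton_eq_iff simp del: upt_Suc)
  qed simp
  then show ?thesis unfolding pair_list_def by simp
qed

definition mi_deriv :: "nat \<Rightarrow> (nat set \<Rightarrow> nat) \<Rightarrow> (disorder \<Rightarrow> real) \<Rightarrow> disorder \<Rightarrow> real" where
  "mi_deriv N \<alpha> F = foldr (\<lambda>x. dpair x ^^ \<alpha> x) (pair_list N) F"

text \<open>The multigraph of \<open>\<alpha>\<close> has \<open>\<alpha> {i, j}\<close> edges between \<open>i\<close> and \<open>j\<close>. Its components
  are given by their vertex sets.\<close>

definition mg_verts :: "(nat set \<Rightarrow> nat) \<Rightarrow> nat set" where
  "mg_verts \<alpha> = {i. \<exists>j. \<alpha> {i, j} > 0}"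

definition mg_adj :: "(nat set \<Rightarrow> nat) \<Rightarrow> nat rel" where
  "mg_adj \<alpha> = {(i, j). \<alpha> {i, j} > 0}"

definition mg_components :: "(nat set \<Rightarrow> nat) \<Rightarrow> nat set set" where
  "mg_components \<alpha> = mg_verts \<alpha> // (mg_adj \<alpha>)\<^sup>*"

definition comps_avoiding :: "(nat set \<Rightarrow> nat) \<Rightarrow> nat \<Rightarrow> nat" where
  "comps_avoiding \<alpha> p = card {K \<in> mg_components \<alpha>. p \<notin> K}"

end

theory Submission
  imports Defs
begin

text \<open>
  Induction on \<open>k\<close>: the chain rule, the Leibniz rule and the Onsager terms preserve the scaling
  \<open>sqrt N ^ (a + number of components avoiding the root)\<close>, because this number is subadditive in
  the graph and drops by at most one when the root is moved to another vertex of the graph.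
  The only term that needs cancellation is \<open>S = N\<^sup>-\<^sup>1\<^sup>/\<^sup>2 (\<Sum>j. g {p, j} * G j)\<close>,
  where \<open>G j\<close> is a rescaled derivative of the current iterate along a graph avoiding \<open>p\<close> and \<open>j\<close>.
  A single Gaussian integration by parts gives \<open>E S\<^sup>2\<^sup>t = E (A S\<^sup>2\<^sup>t\<^sup>-\<^sup>1) + (2t-1) E (B S\<^sup>2\<^sup>t\<^sup>-\<^sup>2)\<close> with
  \<open>A\<close> and \<open>B\<close> bounded in all moments by the induction hypothesis (for one more derivative), and
  Young's inequality absorbs the powers of \<open>S\<close>. No cancellation by the Onsager term is needed.

  All functions in question are generated from coordinates and constants by sums, products and
  \<open>tanh\<close>; differentiability, polynomial growth and measurability follow by induction over this class.
\<close>

text \<open>Heuristically, a derivative costs \<open>sqrt N\<close> because couplings enter as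
  \<open>g / sqrt N\<close>, and a component away from the root must be linked to it by a further
  coupling, which costs another \<open>sqrt N\<close>. The obstacle is that the normalised sum over
  \<open>j\<close> has about \<open>N\<close> summands of order one, so the triangle inequality
  misses by \<open>sqrt N\<close>, while the \<open>G j\<close> need be neither centred nor
  independent of the couplings multiplying them. Integration by parts turns this dependence into one
  further derivative. Hence order \<open>a\<close> for the next iterate rests on order
  \<open>a + 1\<close> for the present one, and the induction hypothesis must cover all orders at
  once; it must cover all moments too, since products double the exponent. Constants are never
  tracked: a bound is a statement about a family indexed by everything it has to be uniform in
  (size, field, starting value, site, derivatives), and a sum over sites merely enlarges the index
  set. Subtracting half a moment of \<open>S\<close> is legitimate because polynomial growth makes
  that moment finite.\<close>

section \<open>Calculus of elementary functions of the couplings\<close>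

inductive_set elementary :: "nat \<Rightarrow> (disorder \<Rightarrow> real) set" for N :: nat where
  const: "(\<lambda>_. c) \<in> elementary N"
| coord: "x \<in> pairs N \<Longrightarrow> (\<lambda>g. g x) \<in> elementary N"
| add: "F \<in> elementary N \<Longrightarrow> G \<in> elementary N \<Longrightarrow> (\<lambda>g. F g + G g) \<in> elementary N"
| mult: "F \<in> elementary N \<Longrightarrow> G \<in> elementary N \<Longrightarrow> (\<lambda>g. F g * G g) \<in> elementary N"
| tanh: "F \<in> elementary N \<Longrightarrow> (\<lambda>g. tanh (F g)) \<in> elementary N"

named_theorems elementary_intros

lemmas [elementary_intros] = elementary.intros

lemma elementary_uminus [elementary_intros]: "F \<in> elementary N \<Longrightarrow> (\<lambda>g. - F g) \<in> elementary N"
  using elementary.mult[OF elementary.const[of "-1"]] by simp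

lemma elementary_diff [elementary_intros]:
  "F \<in> elementary N \<Longrightarrow> G \<in> elementary N \<Longrightarrow> (\<lambda>g. F g - G g) \<in> elementary N"
  using elementary.add[OF _ elementary_uminus] by simp

lemma elementary_divide [elementary_intros]: "F \<in> elementary N \<Longrightarrow> (\<lambda>g. F g / c) \<in> elementary N"
  using elementary.mult[OF _ elementary.const[of "1 / c"]] by simp

lemma elementary_power [elementary_intros]: "F \<in> elementary N \<Longrightarrow> (\<lambda>g. F g ^ n) \<in> elementary N"
  by (induction n) (auto intro: elementary.intros)

lemma elementary_sum [elementary_intros]:
  "(\<And>j. j \<in> J \<Longrightarrow> F j \<in> elementary N) \<Longrightarrow> (\<lambda>g. \<Sum>j\<in>J. F j g) \<in> elementary N"
  by (induction J rule: infinite_finite_induct) (auto intro: elementary.intros)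

lemma has_real_derivative_tanh:
  fixes f :: "real \<Rightarrow> real"
  assumes "(f has_real_derivative D) (at x)"
  shows "((\<lambda>x. tanh (f x)) has_real_derivative (1 - (tanh (f x))\<^sup>2) * D) (at x)"
  using has_field_derivative_tanh[OF _ assms] by simp

text \<open>Closure under differentiation rests on the derivative \<open>1 - tanh^2\<close> of
  \<open>tanh\<close>, which stays in the class. The derivative is asserted only at the current
  value \<open>g x\<close>; as \<open>g\<close> is arbitrary, updating it at \<open>x\<close> covers
  the whole line.\<close>

lemma elementary_derivative_exists:
  assumes "F \<in> elementary N"
  shows "\<exists>F'\<in>elementary N. \<forall>g. ((\<lambda>s. F (g(x := s))) has_real_derivative F' g) (at (g x))"
  using assms
proof (induction rule: elementary.induct)
  case (const c)
  show ?case by (rule bexI[of _ "\<lambda>_. 0"]) (auto intro: elementary_intros)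
next
  case (coord y)
  show ?case
    by (rule bexI[of _ "\<lambda>_. if y = x then 1 else 0"]) (auto intro: elementary_intros)
next
  case (add F G)
  then obtain F' G' where *: "F' \<in> elementary N" "G' \<in> elementary N"
    and "\<And>g. ((\<lambda>s. F (g(x := s))) has_real_derivative F' g) (at (g x))"
    "\<And>g. ((\<lambda>s. G (g(x := s))) has_real_derivative G' g) (at (g x))" by blast
  then show ?case
    by (intro bexI[of _ "\<lambda>g. F' g + G' g"] allI DERIV_add elementary.add) blast+
next
  case (mult F G)
  then obtain F' G' where *: "F' \<in> elementary N" "G' \<in> elementary N"
    and "\<And>g. ((\<lambda>s. F (g(x := s))) has_real_derivative F' g) (at (g x))"
    "\<And>g. ((\<lambda>s. G (g(x := s))) has_real_derivative G' g) (at (g x))" by blast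
  note d = this(3,4)
  have "((\<lambda>s. F (g(x := s)) * G (g(x := s))) has_real_derivative F' g * G g + G' g * F g) (at (g x))"
    for g using DERIV_mult[OF d[of g]] by simp
  moreover have "(\<lambda>g. F' g * G g + G' g * F g) \<in> elementary N"
    by (intro elementary_intros * mult.hyps)
  ultimately show ?case by (intro bexI[rotated] allI)
next
  case (tanh F)
  then obtain F' where *: "F' \<in> elementary N"
    and "\<And>g. ((\<lambda>s. F (g(x := s))) has_real_derivative F' g) (at (g x))" by blast
  note d = this(2)
  have "((\<lambda>s. tanh (F (g(x := s)))) has_real_derivative (1 - (tanh (F g))\<^sup>2) * F' g) (at (g x))"
    for g using has_real_derivative_tanh[OF d[of g]] by simp
  moreover have "(\<lambda>g. (1 - (tanh (F g))\<^sup>2) * F' g) \<in> elementary N"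
    by (intro elementary_intros * tanh.hyps)
  ultimately show ?case by (intro bexI[rotated] allI)
qed

text \<open>\<open>deriv\<close> is informative only for differentiable functions. An exact
  derivative known at every \<open>g\<close> forces \<open>dpair x F\<close> to coincide with it, so
  \<open>dpair x F\<close> inherits membership in the class.\<close>

lemma
  assumes "F \<in> elementary N"
  shows elementary_dpair [elementary_intros]: "dpair x F \<in> elementary N"
    and has_derivative_dpair:
      "((\<lambda>s. F (g(x := s))) has_real_derivative dpair x F (g(x := s))) (at s)"
proof -
  obtain F' where F': "F' \<in> elementary N"
    "\<And>g. ((\<lambda>s. F (g(x := s))) has_real_derivative F' g) (at (g x))"
    using elementary_derivative_exists[OF assms] by blast
  have "dpair x F = F'"
    unfolding dpair_def using DERIV_imp_deriv[OF F'(2)] by blast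
  then show "dpair x F \<in> elementary N"
    "((\<lambda>s. F (g(x := s))) has_real_derivative dpair x F (g(x := s))) (at s)"
    using F' F'(2)[of "g(x := s)"] by auto
qed

lemma dpair_eqI:
  "(\<And>g. ((\<lambda>s. F (g(x := s))) has_real_derivative F' g) (at (g x))) \<Longrightarrow> dpair x F = F'"
  unfolding dpair_def using DERIV_imp_deriv by blast

lemmas has_derivative_dpair' = has_derivative_dpair[of _ _ g x "g x" for g x, simplified]

lemma dpair_const [simp]: "dpair x (\<lambda>_. c) = (\<lambda>_. 0)"
  by (rule dpair_eqI) auto

lemma dpair_coord [simp]: "dpair x (\<lambda>g. g y) = (\<lambda>_. if x = y then 1 else 0)"
  by (rule dpair_eqI) auto

lemma dpair_add:
  "F \<in> elementary N \<Longrightarrow> G \<in> elementary N \<Longrightarrow>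
    dpair x (\<lambda>g. F g + G g) = (\<lambda>g. dpair x F g + dpair x G g)"
  by (rule dpair_eqI, rule DERIV_add) (rule has_derivative_dpair', assumption)+

lemma dpair_mult:
  assumes "F \<in> elementary N" "G \<in> elementary N"
  shows "dpair x (\<lambda>g. F g * G g) = (\<lambda>g. dpair x F g * G g + F g * dpair x G g)"
proof (rule dpair_eqI)
  fix g
  show "((\<lambda>s. F (g(x := s)) * G (g(x := s))) has_real_derivative
      dpair x F g * G g + F g * dpair x G g) (at (g x))"
    using DERIV_mult[OF assms[THEN has_derivative_dpair', of g x]] by (simp add: mult_ac)
qed

lemma dpair_cmult:
  "F \<in> elementary N \<Longrightarrow> dpair x (\<lambda>g. c * F g) = (\<lambda>g. c * dpair x F g)"
  by (subst dpair_mult[of _ N]) (auto intro: elementary_intros)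

lemma dpair_sum:
  "(\<And>j. j \<in> J \<Longrightarrow> F j \<in> elementary N) \<Longrightarrow>
    dpair x (\<lambda>g. \<Sum>j\<in>J. F j g) = (\<lambda>g. \<Sum>j\<in>J. dpair x (F j) g)"
proof (induction J rule: infinite_finite_induct)
  case (insert j J)
  then show ?case by (simp add: dpair_add[of _ N] elementary_sum)
qed auto

lemma dpair_power:
  assumes "F \<in> elementary N"
  shows "dpair x (\<lambda>g. F g ^ n) = (\<lambda>g. real n * F g ^ (n - 1) * dpair x F g)"
proof (rule dpair_eqI)
  fix g
  show "((\<lambda>s. F (g(x := s)) ^ n) has_real_derivative
      real n * F g ^ (n - 1) * dpair x F g) (at (g x))"
    using DERIV_power[OF assms[THEN has_derivative_dpair', of g x], of n] by (simp add: mult_ac)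
qed

lemma dpair_tanh:
  assumes "F \<in> elementary N"
  shows "dpair x (\<lambda>g. tanh (F g)) = (\<lambda>g. (1 - tanh (F g) * tanh (F g)) * dpair x F g)"
proof (rule dpair_eqI)
  fix g
  show "((\<lambda>s. tanh (F (g(x := s)))) has_real_derivative
      (1 - tanh (F g) * tanh (F g)) * dpair x F g) (at (g x))"
    using has_real_derivative_tanh[OF assms[THEN has_derivative_dpair', of g x]]
    by (simp add: power2_eq_square)
qed

lemma finite_pairs [simp]: "finite (pairs N)"
  using set_pair_list[of N] by (metis finite_set)

text \<open>Bridges two carriers: a random configuration is arbitrary outside
  \<open>pairs N\<close>, whereas points of the product space are restricted to
  \<open>pairs N\<close>.\<close>

lemma elementary_local:
  "F \<in> elementary N \<Longrightarrow> (\<And>x. x \<in> pairs N \<Longrightarrow> g x = g' x) \<Longrightarrow> F g = F g'"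
  by (induction rule: elementary.induct) auto

text \<open>The product shape of the bound fits the product measure: integrability factors into
  one-dimensional moments, and freezing all coordinates but one leaves polynomial growth in that
  one.\<close>

lemma elementary_growth:
  assumes "F \<in> elementary N"
  shows "\<exists>C n. C \<ge> 0 \<and> (\<forall>g. \<bar>F g\<bar> \<le> C * (\<Prod>x\<in>pairs N. (1 + \<bar>g x\<bar>) ^ n))"
  using assms
proof (induction rule: elementary.induct)
  case (const c)
  show ?case by (rule exI[of _ "\<bar>c\<bar>"], rule exI[of _ 0]) auto
next
  case (coord x)
  have "\<bar>g x\<bar> \<le> (\<Prod>x\<in>pairs N. (1 + \<bar>g x\<bar>) ^ 1)" for g :: disorder
  proof -
    have "1 * (1 + \<bar>g x\<bar>) \<le> (\<Prod>y\<in>pairs N - {x}. 1 + \<bar>g y\<bar>) * (1 + \<bar>g x\<bar>)"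
      by (intro mult_right_mono prod_ge_1) auto
    also have "\<dots> = (\<Prod>y\<in>pairs N. 1 + \<bar>g y\<bar>)"
      using prod.remove[OF finite_pairs coord, of "\<lambda>y. 1 + \<bar>g y\<bar>"] by (simp add: mult.commute)
    finally show ?thesis by simp
  qed
  then show ?case by (intro exI[of _ 1]) auto
next
  case (add F G)
  then obtain C n D m where *: "C \<ge> 0" "D \<ge> 0"
    "\<And>g. \<bar>F g\<bar> \<le> C * (\<Prod>x\<in>pairs N. (1 + \<bar>g x\<bar>) ^ n)"
    "\<And>g. \<bar>G g\<bar> \<le> D * (\<Prod>x\<in>pairs N. (1 + \<bar>g x\<bar>) ^ m)" by blast
  have P: "(\<Prod>x\<in>pairs N. (1 + \<bar>g x\<bar>) ^ k) \<le> (\<Prod>x\<in>pairs N. (1 + \<bar>g x\<bar>) ^ (n + m))"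
    if "k \<le> n + m" for k and g :: disorder
    by (intro prod_mono conjI power_increasing that) auto
  have "\<bar>F g + G g\<bar> \<le> (C + D) * (\<Prod>x\<in>pairs N. (1 + \<bar>g x\<bar>) ^ (n + m))" for g
  proof -
    have "\<bar>F g\<bar> \<le> C * (\<Prod>x\<in>pairs N. (1 + \<bar>g x\<bar>) ^ (n + m))"
      using *(3)[of g] mult_left_mono[OF P[of n g] *(1)] by linarith
    moreover have "\<bar>G g\<bar> \<le> D * (\<Prod>x\<in>pairs N. (1 + \<bar>g x\<bar>) ^ (n + m))"
      using *(4)[of g] mult_left_mono[OF P[of m g] *(2)] by linarith
    ultimately show ?thesis by (simp add: distrib_right)
  qed
  then show ?case using * by (intro exI[of _ "C + D"] exI[of _ "n + m"]) auto
next
  case (mult F G)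
  then obtain C n D m where *: "C \<ge> 0" "D \<ge> 0"
    "\<And>g. \<bar>F g\<bar> \<le> C * (\<Prod>x\<in>pairs N. (1 + \<bar>g x\<bar>) ^ n)"
    "\<And>g. \<bar>G g\<bar> \<le> D * (\<Prod>x\<in>pairs N. (1 + \<bar>g x\<bar>) ^ m)" by blast
  have "\<bar>F g * G g\<bar> \<le> (C * D) * (\<Prod>x\<in>pairs N. (1 + \<bar>g x\<bar>) ^ (n + m))" for g
    using mult_mono[OF *(3)[of g] *(4)[of g]] *(1,2)
    by (simp add: abs_mult power_add prod.distrib mult_ac prod_nonneg)
  then show ?case using * by (intro exI[of _ "C * D"] exI[of _ "n + m"]) auto
next
  case (tanh F)
  have "\<bar>tanh (F g)\<bar> \<le> 1" for g
    using tanh_real_bounds[of "F g"] by (auto simp: abs_if)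
  then show ?case by (intro exI[of _ 1] exI[of _ 0]) auto
qed

lemma elementary_measurable:
  "F \<in> elementary N \<Longrightarrow> F \<in> borel_measurable (Pi\<^sub>M (pairs N) (\<lambda>_. borel))"
proof (induction rule: elementary.induct)
  case (tanh F)
  then show ?case
    by (intro borel_measurable_continuous_on[OF _ tanh.IH]) (auto intro!: continuous_intros)
qed auto

section \<open>Gaussian product measure and integration by parts\<close>

definition std_gauss :: "real measure" where
  "std_gauss = density lborel (\<lambda>x. ennreal (std_normal_density x))"

definition gauss :: "nat \<Rightarrow> disorder measure" where
  "gauss N = Pi\<^sub>M (pairs N) (\<lambda>_. std_gauss)"

abbreviation gexp :: "nat \<Rightarrow> (disorder \<Rightarrow> real) \<Rightarrow> real" where
  "gexp N F \<equiv> integral\<^sup>L (gauss N) F"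

lemma sets_std_gauss [measurable_cong, simp]: "sets std_gauss = sets borel"
  by (simp add: std_gauss_def)

lemma prob_space_std_gauss: "prob_space std_gauss"
  unfolding std_gauss_def by (rule prob_space_normal_density) simp

interpretation std_gauss: product_sigma_finite "\<lambda>_::nat set. std_gauss"
  by (simp add: product_sigma_finite_def prob_space_std_gauss prob_space_imp_sigma_finite)

lemma prob_space_gauss: "prob_space (gauss N)"
  unfolding gauss_def by (intro prob_space_PiM prob_space_std_gauss)

lemma integrable_std_gauss_poly: "integrable std_gauss (\<lambda>y. (1 + \<bar>y\<bar>) ^ n)"
proof -
  have "integrable lborel (\<lambda>y. \<Sum>k\<le>n. real (n choose k) * (std_normal_density y * \<bar>y\<bar> ^ k))"
    by (intro Bochner_Integration.integrable_sum integrable_mult_right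
        integrable_std_normal_moment_abs)
  also have "(\<lambda>y. \<Sum>k\<le>n. real (n choose k) * (std_normal_density y * \<bar>y\<bar> ^ k)) =
      (\<lambda>y. std_normal_density y * (1 + \<bar>y\<bar>) ^ n)"
  proof
    fix y :: real
    have "(1 + \<bar>y\<bar>) ^ n = (\<Sum>k\<le>n. real (n choose k) * \<bar>y\<bar> ^ k)"
      using binomial_ring[of "\<bar>y\<bar>" 1 n] by (simp add: add.commute)
    then show "(\<Sum>k\<le>n. real (n choose k) * (std_normal_density y * \<bar>y\<bar> ^ k)) =
        std_normal_density y * (1 + \<bar>y\<bar>) ^ n"
      by (simp only: sum_distrib_left) (simp add: mult_ac)
  qed
  finally show ?thesis
    unfolding std_gauss_def by (subst integrable_real_density) auto
qed

lemma elementary_measurable_gauss: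
  "F \<in> elementary N \<Longrightarrow> F \<in> borel_measurable (gauss N)"
  using elementary_measurable[of F N] unfolding gauss_def
  by (subst measurable_cong_sets[OF sets_PiM_cong[OF refl] refl]) auto

lemma integrable_elementary:
  assumes "F \<in> elementary N"
  shows "integrable (gauss N) F"
proof -
  obtain C n where C: "\<And>g. \<bar>F g\<bar> \<le> C * (\<Prod>x\<in>pairs N. (1 + \<bar>g x\<bar>) ^ n)"
    using elementary_growth[OF assms] by blast
  have "integrable (gauss N) (\<lambda>g. \<Prod>x\<in>pairs N. (1 + \<bar>g x\<bar>) ^ n)"
    unfolding gauss_def
    by (rule std_gauss.product_integrable_prod) (auto intro: integrable_std_gauss_poly)
  then have "integrable (gauss N) (\<lambda>g. C * (\<Prod>x\<in>pairs N. (1 + \<bar>g x\<bar>) ^ n))"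
    by simp
  then show ?thesis
    by (rule Bochner_Integration.integrable_bound)
      (use C assms in \<open>auto intro!: AE_I2 elementary_measurable_gauss order_trans[OF C]\<close>)
qed

text \<open>The fundamental theorem of calculus on the whole line for \<open>f\<close> times the
  normal density, whose derivative is \<open>- y\<close> times itself. Polynomial growth makes both
  integrals converge and removes the boundary terms.\<close>

lemma std_gauss_by_parts:
  fixes f f' :: "real \<Rightarrow> real"
  assumes d: "\<And>y. (f has_real_derivative f' y) (at y)" and c: "\<And>y. isCont f' y"
    and f: "\<And>y. \<bar>f y\<bar> \<le> C * (1 + \<bar>y\<bar>) ^ n" and f': "\<And>y. \<bar>f' y\<bar> \<le> C' * (1 + \<bar>y\<bar>) ^ n'"
  shows "(\<integral>y. y * f y \<partial>std_gauss) = (\<integral>y. f' y \<partial>std_gauss)"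
proof -
  define \<phi> where "\<phi> = (\<lambda>y::real. std_normal_density y)"
  have d\<phi>: "(\<phi> has_real_derivative - y * \<phi> y) (at y)" for y
    unfolding \<phi>_def std_normal_density_def
    by (auto intro!: derivative_eq_intros simp: field_simps)
  have cf: "isCont f y" for y using d[of y] by (rule DERIV_isCont)
  have [measurable]: "f \<in> borel_measurable borel" "f' \<in> borel_measurable borel"
    using cf c by (auto intro!: borel_measurable_continuous_onI continuous_at_imp_continuous_on)
  have C: "C \<ge> 0" using f[of 0] by auto
  have i1: "integrable std_gauss (\<lambda>y. y * f y)"
  proof (rule Bochner_Integration.integrable_bound[of _ "\<lambda>y. C * (1 + \<bar>y\<bar>) ^ Suc n"])
    show "integrable std_gauss (\<lambda>y. C * (1 + \<bar>y\<bar>) ^ Suc n)"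
      using integrable_std_gauss_poly[of "Suc n"] by (intro integrable_mult_right)
    have "\<bar>y\<bar> * \<bar>f y\<bar> \<le> (1 + \<bar>y\<bar>) * (C * (1 + \<bar>y\<bar>) ^ n)" for y
      by (intro mult_mono f) auto
    then show "AE y in std_gauss. norm (y * f y) \<le> norm (C * (1 + \<bar>y\<bar>) ^ Suc n)"
      using C by (auto simp: abs_mult mult_ac)
  qed auto
  have i2: "integrable std_gauss f'"
    by (rule Bochner_Integration.integrable_bound[of _ "\<lambda>y. C' * (1 + \<bar>y\<bar>) ^ n'"])
      (use integrable_std_gauss_poly in \<open>auto intro!: AE_I2 order_trans[OF f']\<close>)
  have i1': "integrable lborel (\<lambda>y. \<phi> y * (y * f y))"
    and i2': "integrable lborel (\<lambda>y. \<phi> y * f' y)"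
    using i1 i2 unfolding std_gauss_def \<phi>_def
    by (simp_all add: integrable_real_density)
  have lim: "((\<lambda>y. C * ((1 + \<bar>y\<bar>) ^ n * \<phi> y)) \<longlongrightarrow> 0) F" if "F = at_top \<or> F = at_bot" for F
  proof -
    define \<psi> where "\<psi> = (\<lambda>y. (1 + \<bar>y\<bar>) ^ n * \<phi> y)"
    have "\<psi> y \<le> exp (3/2) * ((1 + y) ^ n / exp (1 + y))" if "y \<ge> 0" for y
    proof -
      \<comment> \<open>Expanding the square bounds the Gaussian by
        \<open>exp (3/2) / exp (1 + y)\<close>, so that the decay of \<open>z ^ n / exp z\<close>
        can be used with \<open>z = 1 + y\<close>.\<close>
      have "0 \<le> (y - 1)\<^sup>2 / 2" by simp
      then have "- y\<^sup>2 / 2 \<le> 3 / 2 - (1 + y)"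
        by (simp add: power2_eq_square field_simps)
      then have "exp (- y\<^sup>2 / 2) \<le> exp (3/2) / exp (1 + y)"
        by (metis exp_diff exp_le_cancel_iff)
      moreover have "1 / sqrt (2 * pi) \<le> 1"
        using pi_ge_two by simp
      then have "1 / sqrt (2 * pi) * exp (- y\<^sup>2 / 2) \<le> 1 * exp (- y\<^sup>2 / 2)"
        by (intro mult_right_mono) auto
      ultimately have "\<phi> y \<le> exp (3/2) / exp (1 + y)"
        unfolding \<phi>_def std_normal_density_def by linarith
      then have "(1 + y) ^ n * \<phi> y \<le> (1 + y) ^ n * (exp (3/2) / exp (1 + y))"
        using that by (intro mult_left_mono) auto
      then show ?thesis using that by (simp add: \<psi>_def mult_ac)
    qed
    moreover have "filterlim (\<lambda>y::real. 1 + y) at_top at_top"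
      by (rule filterlim_tendsto_add_at_top[OF tendsto_const filterlim_ident])
    then have "((\<lambda>y::real. exp (3/2) * ((1 + y) ^ n / exp (1 + y))) \<longlongrightarrow> 0) at_top"
      by (intro tendsto_mult_right_zero filterlim_compose[OF tendsto_power_div_exp_0])
    moreover have "\<psi> y \<ge> 0" for y by (simp add: \<psi>_def \<phi>_def)
    ultimately have "(\<psi> \<longlongrightarrow> 0) at_top"
      by (elim Lim_null_comparison[rotated])
        (auto intro!: eventually_mono[OF eventually_ge_at_top[of "0::real"]])
    \<comment> \<open>Evenness transfers the limit to minus infinity.\<close>
    moreover have "\<psi> (- y) = \<psi> y" for y
      by (simp add: \<psi>_def \<phi>_def std_normal_density_def)
    ultimately have "(\<psi> \<longlongrightarrow> 0) F"
      using that by (auto simp: filterlim_at_bot_mirror)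
    then show ?thesis unfolding \<psi>_def by (rule tendsto_mult_right_zero)
  qed
  have z: "((\<lambda>y. f y * \<phi> y) \<longlongrightarrow> 0) F" if "F = at_top \<or> F = at_bot" for F
    proof (rule Lim_null_comparison[OF _ lim[OF that]])
    have "norm (f y * \<phi> y) \<le> C * ((1 + \<bar>y\<bar>) ^ n * \<phi> y)" for y
      using mult_right_mono[OF f[of y], of "\<phi> y"] by (simp add: abs_mult \<phi>_def mult_ac)
    then show "\<forall>\<^sub>F y in F. norm (f y * \<phi> y) \<le> C * ((1 + \<bar>y\<bar>) ^ n * \<phi> y)" by simp
  qed
  have "(LBINT y=-\<infinity>..\<infinity>. f' y * \<phi> y - y * f y * \<phi> y) = 0 - 0"
  proof (rule interval_integral_FTC_integrable[where F = "\<lambda>y. f y * \<phi> y"])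
    show "((\<lambda>y. f y * \<phi> y) has_vector_derivative f' y * \<phi> y - y * f y * \<phi> y) (at y)" for y
      by (subst has_real_derivative_iff_has_vector_derivative[symmetric])
        (auto intro!: derivative_eq_intros d d\<phi> simp: algebra_simps)
    show "isCont (\<lambda>y. f' y * \<phi> y - y * f y * \<phi> y) y" for y
      by (intro continuous_intros cf c DERIV_isCont[OF d\<phi>])
    show "set_integrable lborel (einterval (- \<infinity>) \<infinity>) (\<lambda>y. f' y * \<phi> y - y * f y * \<phi> y)"
      using Bochner_Integration.integrable_diff[OF i2' i1']
      by (simp add: set_integrable_def mult_ac einterval_def)
    show "(((\<lambda>y. f y * \<phi> y) \<circ> real_of_ereal) \<longlongrightarrow> 0) (at_right (- \<infinity>))"
      using z[of at_bot] by (simp add: ereal_tendsto_simps)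
    show "(((\<lambda>y. f y * \<phi> y) \<circ> real_of_ereal) \<longlongrightarrow> 0) (at_left \<infinity>)"
      using z[of at_top] by (simp add: ereal_tendsto_simps)
  qed simp
  then have "(\<integral>y. \<phi> y * f' y - \<phi> y * (y * f y) \<partial>lborel) = 0"
    by (simp add: interval_lebesgue_integral_def set_lebesgue_integral_def mult_ac einterval_def)
  then have "(\<integral>y. \<phi> y * f' y \<partial>lborel) = (\<integral>y. \<phi> y * (y * f y) \<partial>lborel)"
    using Bochner_Integration.integral_diff[OF i2' i1'] by simp
  then show ?thesis
    unfolding std_gauss_def \<phi>_def by (subst (1 2) integral_real_density) auto
qed

lemma gauss_by_parts:
  assumes F: "F \<in> elementary N" and x: "x \<in> pairs N"
  shows "gexp N (\<lambda>g. g x * F g) = gexp N (dpair x F)"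
proof -
  let ?I = "pairs N - {x}"
  have I: "pairs N = insert x ?I" using x by auto
  have split: "gexp N G = (\<integral>g. (\<integral>y. G (g(x := y)) \<partial>std_gauss) \<partial>Pi\<^sub>M ?I (\<lambda>_. std_gauss))"
    if "G \<in> elementary N" for G
  proof -
    have "integrable (Pi\<^sub>M (insert x ?I) (\<lambda>_. std_gauss)) G"
      using integrable_elementary[OF that] I unfolding gauss_def by simp
    then show ?thesis
      unfolding gauss_def
      by (subst I, intro std_gauss.product_integral_insert) auto
  qed
  have growth: "\<exists>C n. \<forall>y. \<bar>G (g(x := y))\<bar> \<le> C * (1 + \<bar>y\<bar>) ^ n"
    if "G \<in> elementary N" for G g
  proof -
    obtain C n where C: "\<And>g. \<bar>G g\<bar> \<le> C * (\<Prod>x\<in>pairs N. (1 + \<bar>g x\<bar>) ^ n)"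
      using elementary_growth[OF \<open>G \<in> elementary N\<close>] by blast
    have "(\<Prod>z\<in>pairs N. (1 + \<bar>(g(x := y)) z\<bar>) ^ n) =
        (1 + \<bar>y\<bar>) ^ n * (\<Prod>z\<in>?I. (1 + \<bar>g z\<bar>) ^ n)" for y
      by (subst prod.remove[OF finite_pairs x]) auto
    then have "\<bar>G (g(x := y))\<bar> \<le> C * (\<Prod>z\<in>?I. (1 + \<bar>g z\<bar>) ^ n) * (1 + \<bar>y\<bar>) ^ n" for y
      using C[of "g(x := y)"] by (simp add: mult_ac)
    then show ?thesis by blast
  qed
  have "(\<integral>y. y * F (g(x := y)) \<partial>std_gauss) = (\<integral>y. dpair x F (g(x := y)) \<partial>std_gauss)" for g
  proof -
    obtain C n C' n' where "\<And>y. \<bar>F (g(x := y))\<bar> \<le> C * (1 + \<bar>y\<bar>) ^ n"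
      "\<And>y. \<bar>dpair x F (g(x := y))\<bar> \<le> C' * (1 + \<bar>y\<bar>) ^ n'"
      using growth[OF F, where g = g] growth[OF elementary_dpair[OF F], where g = g] by blast
    then show ?thesis
      using has_derivative_dpair[OF F] DERIV_isCont[OF has_derivative_dpair[OF elementary_dpair[OF F]]]
      by (rule std_gauss_by_parts[rotated 2])
  qed
  then show ?thesis
    using split[of "\<lambda>g. g x * F g"] split[of "dpair x F"] F x by (simp add: elementary_intros)
qed

section \<open>Components of the graph avoiding a root set\<close>

definition edge_adj :: "nat set set \<Rightarrow> nat rel" where
  "edge_adj E = {(i, j). {i, j} \<in> E}"

definition edge_comps :: "nat set set \<Rightarrow> nat set set" where
  "edge_comps E = \<Union>E // (edge_adj E)\<^sup>*"

text \<open>Multiplicities do not affect components, so an edge set replaces the multigraph. A set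
  of roots is allowed because the factors of a product may have different roots;
  \<open>R = {p}\<close> gives the count of the theorem.\<close>

definition ncomps :: "nat set set \<Rightarrow> nat set \<Rightarrow> nat" where
  "ncomps E R = card {K \<in> edge_comps E. K \<inter> R = {}}"

lemma sym_edge_adj: "sym (edge_adj E)"
  by (auto simp: sym_def edge_adj_def insert_commute)

lemma edge_adj_mono: "E \<subseteq> E' \<Longrightarrow> edge_adj E \<subseteq> edge_adj E'"
  by (auto simp: edge_adj_def)

lemma edge_compsI: "v \<in> \<Union>E \<Longrightarrow> (edge_adj E)\<^sup>* `` {v} \<in> edge_comps E"
  unfolding edge_comps_def by (rule quotientI)

lemma edge_compsE:
  assumes "K \<in> edge_comps E"
  obtains v where "v \<in> \<Union>E" "K = (edge_adj E)\<^sup>* `` {v}"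
  using assms unfolding edge_comps_def by (rule quotientE)

lemma edge_comps_eq:
  assumes "K \<in> edge_comps E" "v \<in> K"
  shows "K = (edge_adj E)\<^sup>* `` {v}"
proof -
  obtain u where u: "K = (edge_adj E)\<^sup>* `` {u}" using assms(1) by (rule edge_compsE)
  then have uv: "(u, v) \<in> (edge_adj E)\<^sup>*" using assms(2) by auto
  then have "(v, u) \<in> (edge_adj E)\<^sup>*" using sym_rtrancl[OF sym_edge_adj] by (auto dest: symD)
  then show ?thesis using u uv by (auto intro: rtrancl_trans)
qed

lemma edge_comps_disjoint:
  "K \<in> edge_comps E \<Longrightarrow> K' \<in> edge_comps E \<Longrightarrow> K \<inter> K' \<noteq> {} \<Longrightarrow> K = K'"
  using edge_comps_eq by blast

lemma edge_comps_closed: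
  "K \<in> edge_comps E \<Longrightarrow> v \<in> K \<Longrightarrow> {v, w} \<in> E \<Longrightarrow> w \<in> K"
  using edge_comps_eq[of K E v] by (auto simp: edge_adj_def intro: rtrancl_into_rtrancl)

context
  fixes N :: nat and E :: "nat set set"
  assumes E: "E \<subseteq> pairs N"
begin

lemma edge_comps_subset:
  assumes "K \<in> edge_comps E"
  shows "K \<subseteq> \<Union>E"
proof
  fix w assume "w \<in> K"
  obtain v where v: "v \<in> \<Union>E" "K = (edge_adj E)\<^sup>* `` {v}" using assms by (rule edge_compsE)
  then have "(v, w) \<in> (edge_adj E)\<^sup>*" using \<open>w \<in> K\<close> by auto
  then show "w \<in> \<Union>E" using v(1) by (cases rule: rtranclE) (auto simp: edge_adj_def)
qed

lemma finite_vertices: "finite (\<Union>E)"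
proof (rule finite_subset)
  show "\<Union>E \<subseteq> {1..N}" using E by (auto simp: pairs_def)
qed simp

lemma finite_edge_comps: "finite (edge_comps E)"
  by (rule finite_subset[of _ "Pow (\<Union>E)"]) (use edge_comps_subset finite_vertices in auto)

lemma ncomps_mono_roots: "R \<subseteq> R' \<Longrightarrow> ncomps E R' \<le> ncomps E R"
  unfolding ncomps_def using finite_edge_comps by (intro card_mono) auto

lemma ncomps_cong_roots:
  assumes "R \<inter> \<Union>E = R' \<inter> \<Union>E"
  shows "ncomps E R = ncomps E R'"
proof -
  have "K \<inter> R = K \<inter> R'" if "K \<in> edge_comps E" for K
    using edge_comps_subset[OF that] assms by (simp add: set_eq_iff subset_iff) metis
  then show ?thesis unfolding ncomps_def by (metis (no_types, lifting))
qed

text \<open>Components are disjoint, so one more root meets at most one of them. With monotonicity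
  in the roots, replacing a root by another lowers the count by at most one.\<close>

lemma ncomps_insert_root_le: "ncomps E R \<le> ncomps E (insert j R) + 1"
proof -
  have "{K \<in> edge_comps E. K \<inter> R = {}} \<subseteq>
      {K \<in> edge_comps E. K \<inter> insert j R = {}} \<union> {(edge_adj E)\<^sup>* `` {j}}"
    by (auto dest: edge_comps_eq)
  then have "ncomps E R \<le> card ({K \<in> edge_comps E. K \<inter> insert j R = {}} \<union> {(edge_adj E)\<^sup>* `` {j}})"
    unfolding ncomps_def using finite_edge_comps by (intro card_mono) auto
  also have "\<dots> \<le> ncomps E (insert j R) + 1"
    unfolding ncomps_def by (rule order_trans[OF card_Un_le]) simp
  finally show ?thesis .
qed

text \<open>The component of \<open>p\<close> is counted without roots but not with root
  \<open>p\<close>. This unit yields a factor \<open>sqrt N\<close> when the root \<open>p\<close>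
  is replaced by a site outside the graph.\<close>

lemma ncomps_root_lt:
  assumes "p \<in> \<Union>E"
  shows "ncomps E {p} + 1 \<le> ncomps E {}"
proof -
  define K where "K = (edge_adj E)\<^sup>* `` {p}"
  have "K \<in> edge_comps E" "p \<in> K" using edge_compsI[OF assms] by (auto simp: K_def)
  then have "{L \<in> edge_comps E. L \<inter> {p} = {}} \<subseteq> edge_comps E - {K}" by auto
  then have "ncomps E {p} \<le> card (edge_comps E - {K})"
    unfolding ncomps_def using finite_edge_comps by (intro card_mono) auto
  moreover have "card (edge_comps E) = card (edge_comps E - {K}) + 1"
    using card.remove[OF finite_edge_comps \<open>K \<in> edge_comps E\<close>] by simp
  moreover have "ncomps E {} = card (edge_comps E)" by (simp add: ncomps_def)
  ultimately show ?thesis by linarith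
qed

end

text \<open>A component that avoids both endpoints is not touched by the new edge and remains a
  component.\<close>

lemma ncomps_insert_edge:
  assumes "insert {p, j} E \<subseteq> pairs N"
  shows "ncomps E {p, j} \<le> ncomps (insert {p, j} E) {p, j}"
proof -
  have "K \<in> edge_comps (insert {p, j} E)" if K: "K \<in> edge_comps E" "K \<inter> {p, j} = {}" for K
  proof -
    obtain v where v: "v \<in> \<Union>E" "K = (edge_adj E)\<^sup>* `` {v}" using K(1) by (rule edge_compsE)
    have "w \<in> K" if "(v, w) \<in> (edge_adj (insert {p, j} E))\<^sup>*" for w
      using that
    proof (induction rule: rtrancl_induct)
      case base
      then show ?case using v by auto
    next
      case (step y z)
      then have "{y, z} \<noteq> {p, j}" using K(2) by (auto simp: doubleton_eq_iff)
      with step show ?case using edge_comps_closed[OF K(1)] by (auto simp: edge_adj_def)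
    qed
    moreover have "K \<subseteq> (edge_adj (insert {p, j} E))\<^sup>* `` {v}"
      using rtrancl_mono[OF edge_adj_mono[of E "insert {p, j} E"]] v(2) by blast
    ultimately have "K = (edge_adj (insert {p, j} E))\<^sup>* `` {v}" by blast
    then show ?thesis using edge_compsI[of v "insert {p, j} E"] v(1) by auto
  qed
  then have "{K \<in> edge_comps E. K \<inter> {p, j} = {}} \<subseteq>
      {K \<in> edge_comps (insert {p, j} E). K \<inter> {p, j} = {}}" by blast
  moreover have "finite (edge_comps (insert {p, j} E))" by (rule finite_edge_comps[OF assms])
  ultimately show ?thesis unfolding ncomps_def by (intro card_mono) auto
qed

lemma ncomps_neighbour:
  assumes "{p, j} \<in> E"
  shows "ncomps E {p, j} = ncomps E {p}"
proof -
  have "{K \<in> edge_comps E. K \<inter> {p, j} = {}} = {K \<in> edge_comps E. K \<inter> {p} = {}}"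
    using edge_comps_closed[of _ E j p] assms by (auto simp: insert_commute)
  then show ?thesis by (simp add: ncomps_def)
qed

text \<open>A component of the union has a vertex in \<open>E1\<close> or \<open>E2\<close> and
  contains the component of that vertex there. Choosing one such component is injective because
  components of the union are disjoint; the disjoint sum separates a vertex set that is a component
  of both graphs.\<close>

lemma ncomps_subadditive:
  assumes "E1 \<subseteq> pairs N" "E2 \<subseteq> pairs N"
  shows "ncomps (E1 \<union> E2) (R1 \<union> R2) \<le> ncomps E1 R1 + ncomps E2 R2"
proof -
  define A where "A = {K \<in> edge_comps (E1 \<union> E2). K \<inter> (R1 \<union> R2) = {}}"
  define S where "S = (\<lambda>E R. {L \<in> edge_comps E. L \<inter> R = {}})"
  define Q where "Q = (\<lambda>K (L :: nat set). L \<subseteq> K \<and> L \<noteq> {})"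
  have component: "(edge_adj E)\<^sup>* `` {v} \<in> S E R \<and> Q K ((edge_adj E)\<^sup>* `` {v})"
    if "K \<in> A" "v \<in> K" "v \<in> \<Union>E" "E = E1 \<and> R = R1 \<or> E = E2 \<and> R = R2" for E R v K
  proof -
    have K: "K = (edge_adj (E1 \<union> E2))\<^sup>* `` {v}" "K \<inter> R = {}"
      using that edge_comps_eq[of K "E1 \<union> E2" v] unfolding A_def by auto
    have "(edge_adj E)\<^sup>* \<subseteq> (edge_adj (E1 \<union> E2))\<^sup>*"
      using that(4) by (intro rtrancl_mono edge_adj_mono) auto
    then have "(edge_adj E)\<^sup>* `` {v} \<subseteq> K" unfolding K(1) by (intro Image_mono subset_refl)
    moreover have "v \<in> (edge_adj E)\<^sup>* `` {v}" by simp
    ultimately show ?thesis using edge_compsI[OF that(3)] K(2) unfolding S_def Q_def by blast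
  qed
  have "\<exists>z \<in> S E1 R1 <+> S E2 R2. Q K (case_sum id id z)" if K: "K \<in> A" for K
  proof -
    have "K \<in> edge_comps (E1 \<union> E2)" using K by (simp add: A_def)
    then obtain u where u: "u \<in> \<Union>(E1 \<union> E2)" "K = (edge_adj (E1 \<union> E2))\<^sup>* `` {u}"
      by (rule edge_compsE)
    then obtain v where v: "v \<in> \<Union>(E1 \<union> E2)" "v \<in> K" by auto
    then consider "v \<in> \<Union>E1" | "v \<in> \<Union>E2" by blast
    then show ?thesis
    proof cases
      case 1
      then show ?thesis using component[OF K v(2) 1]
        by (intro bexI[of _ "Inl ((edge_adj E1)\<^sup>* `` {v})"]) auto
    next
      case 2
      then show ?thesis using component[OF K v(2) 2]
        by (intro bexI[of _ "Inr ((edge_adj E2)\<^sup>* `` {v})"]) auto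
    qed
  qed
  then obtain f where f: "\<And>K. K \<in> A \<Longrightarrow> f K \<in> S E1 R1 <+> S E2 R2 \<and> Q K (case_sum id id (f K))"
    by metis
  have "inj_on f A"
  proof (rule inj_onI)
    fix K K' assume K: "K \<in> A" "K' \<in> A" "f K = f K'"
    then have "K \<inter> K' \<noteq> {}" using f[OF K(1)] f[OF K(2)] unfolding Q_def by auto
    then show "K = K'" using K by (intro edge_comps_disjoint) (auto simp: A_def)
  qed
  moreover have "f ` A \<subseteq> S E1 R1 <+> S E2 R2" using f by blast
  moreover have fin: "finite (S E1 R1)" "finite (S E2 R2)"
    unfolding S_def using finite_edge_comps[OF assms(1)] finite_edge_comps[OF assms(2)] by auto
  ultimately have "card A \<le> card (S E1 R1 <+> S E2 R2)"
    by (intro card_inj_on_le finite_Plus)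
  also have "\<dots> = card (S E1 R1) + card (S E2 R2)"
    using fin by (rule card_Plus)
  finally show ?thesis unfolding ncomps_def A_def S_def .
qed

lemma ncomps_empty [simp]: "ncomps {} R = 0"
  by (simp add: ncomps_def edge_comps_def)

lemma ncomps_single:
  assumes "p \<noteq> j"
  shows "ncomps {{p, j}} {p} = 0"
proof -
  have "p \<in> K" if "K \<in> edge_comps {{p, j}}" for K
  proof -
    have "(j, p) \<in> edge_adj {{p, j}}" by (auto simp: edge_adj_def insert_commute)
    then show ?thesis using that by (auto elim!: edge_compsE)
  qed
  then have "{K \<in> edge_comps {{p, j}}. K \<inter> {p} = {}} = {}" by blast
  then show ?thesis unfolding ncomps_def by (simp only: card.empty)
qed

lemma pairs_distinct: "{p, j} \<in> pairs N \<Longrightarrow> p \<noteq> j"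
  by (auto simp: pairs_def doubleton_eq_iff)

text \<open>For the case in which a derivative hits the coefficient \<open>g {p, j}\<close>: the
  edge leaves the graph and the root passes from \<open>p\<close> to \<open>j\<close>. The edge
  alone has no component avoiding \<open>p\<close>, so subadditivity loses nothing.\<close>

lemma ncomps_insert_edge_root_le:
  assumes "insert {p, j} E \<subseteq> pairs N"
  shows "ncomps (insert {p, j} E) {p} \<le> ncomps E {j}"
proof -
  have "ncomps (insert {p, j} E) {p} = ncomps (insert {p, j} E) {p, j}"
    using ncomps_neighbour[of p j "insert {p, j} E"] by simp
  also have "\<dots> \<le> ncomps {{p, j}} {p} + ncomps E {j}"
    using ncomps_subadditive[of "{{p, j}}" N E "{p}" "{j}"] assms
    by (simp add: insert_commute)
  finally show ?thesis using assms ncomps_single[OF pairs_distinct[of p j N]] by simp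
qed

text \<open>For a derivative by \<open>g {p, j}\<close> of a field rooted at \<open>j\<close>:
  whatever avoids both ends survives the additional edge.\<close>

lemma ncomps_insert_edge_ge:
  assumes "insert {p, j} E \<subseteq> pairs N"
  shows "ncomps E {p, j} \<le> ncomps (insert {p, j} E) {j}"
  using ncomps_insert_edge[OF assms] ncomps_mono_roots[OF assms, of "{j}" "{p, j}"] assms by auto

text \<open>Away from the vertices of \<open>E\<close> the edge \<open>{p, j}\<close> is a component
  of its own, and \<open>l\<close> lies outside it. This unit is the second of the two factors
  \<open>sqrt N\<close> required by the double sum over \<open>j\<close> and
  \<open>l\<close>.\<close>

lemma ncomps_new_component:
  assumes "insert {p, j} E \<subseteq> pairs N" "p \<notin> \<Union>E" "j \<notin> \<Union>E" "l \<notin> \<Union>E" "l \<noteq> p" "l \<noteq> j"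
  shows "ncomps E {} + 1 \<le> ncomps (insert {p, j} E) {l}"
proof -
  have "ncomps E {} = ncomps E {p, j}" using assms by (intro ncomps_cong_roots[of E N]) auto
  also have "\<dots> \<le> ncomps (insert {p, j} E) {p, j}" using ncomps_insert_edge[OF assms(1)] assms(1) by auto
  also have "\<dots> \<le> ncomps (insert {p, j} E) {p}" by (rule ncomps_mono_roots[OF assms(1)]) auto
  also have "ncomps (insert {p, j} E) {p} + 1 \<le> ncomps (insert {p, j} E) {}"
    by (rule ncomps_root_lt[OF assms(1)]) auto
  also have "ncomps (insert {p, j} E) {} = ncomps (insert {p, j} E) {l}"
    using assms by (intro ncomps_cong_roots[OF assms(1)]) auto
  finally show ?thesis by simp
qed

section \<open>Families with uniformly bounded moments\<close>

text \<open>\<open>K\<close> holds all parameters and \<open>n k\<close> is the system size at index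
  \<open>k\<close>; the constant may depend on \<open>t\<close> but not on \<open>k\<close>, which
  is how uniformity is expressed. Even powers keep every integrand elementary.\<close>

definition moment_bounded :: "'k set \<Rightarrow> ('k \<Rightarrow> nat) \<Rightarrow> ('k \<Rightarrow> disorder \<Rightarrow> real) \<Rightarrow> bool" where
  "moment_bounded K n \<Phi> \<longleftrightarrow> (\<forall>k\<in>K. \<Phi> k \<in> elementary (n k)) \<and>
     (\<forall>t. \<exists>C. \<forall>k\<in>K. gexp (n k) (\<lambda>g. \<Phi> k g ^ (2 * t)) \<le> C)"

lemma moment_boundedD: "moment_bounded K n \<Phi> \<Longrightarrow> k \<in> K \<Longrightarrow> \<Phi> k \<in> elementary (n k)"
  unfolding moment_bounded_def by blast

lemma moment_boundedE:
  assumes "moment_bounded K n \<Phi>"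
  obtains C where "C \<ge> 0" "\<And>k. k \<in> K \<Longrightarrow> gexp (n k) (\<lambda>g. \<Phi> k g ^ (2 * t)) \<le> C"
proof -
  obtain C where "\<And>k. k \<in> K \<Longrightarrow> gexp (n k) (\<lambda>g. \<Phi> k g ^ (2 * t)) \<le> C"
    using assms unfolding moment_bounded_def by metis
  then show ?thesis using that[of "max C 0"] by fastforce
qed

lemma gexp_mono:
  assumes "F \<in> elementary N" "G \<in> elementary N" "\<And>g. F g \<le> G g"
  shows "gexp N F \<le> gexp N G"
  using assms by (intro integral_mono integrable_elementary)

lemma gexp_add:
  "F \<in> elementary N \<Longrightarrow> G \<in> elementary N \<Longrightarrow> gexp N (\<lambda>g. F g + G g) = gexp N F + gexp N G"
  by (intro Bochner_Integration.integral_add integrable_elementary)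

lemma gexp_sum:
  "(\<And>j. j \<in> J \<Longrightarrow> F j \<in> elementary N) \<Longrightarrow> gexp N (\<lambda>g. \<Sum>j\<in>J. F j g) = (\<Sum>j\<in>J. gexp N (F j))"
  by (intro Bochner_Integration.integral_sum integrable_elementary)

lemma measure_gauss_space [simp]: "measure (gauss N) (space (gauss N)) = 1"
  by (rule prob_space.prob_space[OF prob_space_gauss])

lemma moment_boundedI:
  assumes "\<And>k. k \<in> K \<Longrightarrow> \<Phi> k \<in> elementary (n k)"
    and "\<And>t. t > 0 \<Longrightarrow> \<exists>C. \<forall>k\<in>K. gexp (n k) (\<lambda>g. \<Phi> k g ^ (2 * t)) \<le> C"
  shows "moment_bounded K n \<Phi>"
  unfolding moment_bounded_def
proof (intro conjI ballI allI)
  show "\<exists>C. \<forall>k\<in>K. gexp (n k) (\<lambda>g. \<Phi> k g ^ (2 * t)) \<le> C" for t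
    using assms(2)[of t] by (cases "t = 0") (auto intro!: exI[of _ 1])
qed (use assms(1) in auto)

lemma moment_bounded_dominated:
  assumes \<Psi>: "moment_bounded K n \<Psi>"
    and \<Phi>: "\<And>k. k \<in> K \<Longrightarrow> \<Phi> k \<in> elementary (n k)"
    and le: "\<And>k g. k \<in> K \<Longrightarrow> \<bar>\<Phi> k g\<bar> \<le> \<bar>\<Psi> k g\<bar>"
  shows "moment_bounded K n \<Phi>"
proof (rule moment_boundedI[OF \<Phi>])
  fix t :: nat
  obtain C where C: "\<And>k. k \<in> K \<Longrightarrow> gexp (n k) (\<lambda>g. \<Psi> k g ^ (2 * t)) \<le> C"
    using moment_boundedE[OF \<Psi>, where t = t] by blast
  have "gexp (n k) (\<lambda>g. \<Phi> k g ^ (2 * t)) \<le> C" if k: "k \<in> K" for k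
  proof (rule order_trans[OF gexp_mono C[OF k]])
    show "\<Phi> k g ^ (2 * t) \<le> \<Psi> k g ^ (2 * t)" for g
      using power_mono[OF le[OF k, of g], of "2 * t"] by (simp add: power_even_abs)
  qed (use k in \<open>auto intro!: elementary_power \<Phi> moment_boundedD[OF \<Psi>]\<close>)
  then show "\<exists>C. \<forall>k\<in>K. gexp (n k) (\<lambda>g. \<Phi> k g ^ (2 * t)) \<le> C" by blast
qed

text \<open>Uniformity over the index set makes it free to pass to any family whose members all
  occur in the given one, with repetitions allowed.\<close>

lemma moment_bounded_reindex:
  assumes "moment_bounded K n \<Phi>" "\<And>k. k \<in> K' \<Longrightarrow> f k \<in> K" "\<And>k. k \<in> K' \<Longrightarrow> n' k = n (f k)"
    "\<And>k. k \<in> K' \<Longrightarrow> \<Phi>' k = \<Phi> (f k)"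
  shows "moment_bounded K' n' \<Phi>'"
proof (rule moment_boundedI)
  show "\<Phi>' k \<in> elementary (n' k)" if "k \<in> K'" for k
    using moment_boundedD[OF assms(1) assms(2)[OF that]] assms(3,4)[OF that] by simp
  fix t :: nat
  obtain C where C: "\<And>k. k \<in> K \<Longrightarrow> gexp (n k) (\<lambda>g. \<Phi> k g ^ (2 * t)) \<le> C"
    using moment_boundedE[OF assms(1), where t = t] by blast
  then show "\<exists>C. \<forall>k\<in>K'. gexp (n' k) (\<lambda>g. \<Phi>' k g ^ (2 * t)) \<le> C"
    using assms(2-4) by (intro exI[of _ C]) auto
qed

lemma moment_bounded_const:
  assumes "\<And>k. k \<in> K \<Longrightarrow> \<bar>c k\<bar> \<le> B"
  shows "moment_bounded K n (\<lambda>k _. c k)"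
proof (rule moment_boundedI)
  fix t :: nat
  have "c k ^ (2 * t) \<le> B ^ (2 * t)" if "k \<in> K" for k
    using power_mono[OF assms[OF that], of "2 * t"] by (simp add: power_even_abs)
  then show "\<exists>C. \<forall>k\<in>K. gexp (n k) (\<lambda>g. c k ^ (2 * t)) \<le> C"
    by (intro exI[of _ "B ^ (2 * t)"]) auto
qed (auto intro!: elementary_intros)

text \<open>Cauchy-Schwarz in the pointwise form \<open>2 x y <= x^2 + y^2\<close>. It doubles the
  exponent, which the quantification over all \<open>t\<close> permits.\<close>

lemma moment_bounded_mult:
  assumes \<Phi>: "moment_bounded K n \<Phi>" and \<Psi>: "moment_bounded K n \<Psi>"
  shows "moment_bounded K n (\<lambda>k g. \<Phi> k g * \<Psi> k g)"
proof (rule moment_boundedI)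
  fix t :: nat
  obtain C D where C: "\<And>k. k \<in> K \<Longrightarrow> gexp (n k) (\<lambda>g. \<Phi> k g ^ (2 * (2 * t))) \<le> C"
    and D: "\<And>k. k \<in> K \<Longrightarrow> gexp (n k) (\<lambda>g. \<Psi> k g ^ (2 * (2 * t))) \<le> D"
    using moment_boundedE[OF \<Phi>, where t = "2 * t"] moment_boundedE[OF \<Psi>, where t = "2 * t"]
    by metis
  have "gexp (n k) (\<lambda>g. (\<Phi> k g * \<Psi> k g) ^ (2 * t)) \<le> C + D" if k: "k \<in> K" for k
  proof -
    note [elementary_intros] = moment_boundedD[OF \<Phi> k] moment_boundedD[OF \<Psi> k]
    have "x ^ (2 * t) * y ^ (2 * t) \<le> x ^ (2 * (2 * t)) + y ^ (2 * (2 * t))" for x y :: real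
    proof -
      have "2 * (x ^ (2 * t) * y ^ (2 * t)) \<le> (x ^ (2 * t))\<^sup>2 + (y ^ (2 * t))\<^sup>2"
        using sum_squares_bound[of "x ^ (2 * t)" "y ^ (2 * t)"] by simp
      moreover have "0 \<le> x ^ (2 * t) * y ^ (2 * t)" by simp
      ultimately show ?thesis by (simp add: power_mult[symmetric] mult.commute mult.left_commute)
    qed
    then have "gexp (n k) (\<lambda>g. (\<Phi> k g * \<Psi> k g) ^ (2 * t)) \<le>
        gexp (n k) (\<lambda>g. \<Phi> k g ^ (2 * (2 * t)) + \<Psi> k g ^ (2 * (2 * t)))"
      by (intro gexp_mono elementary_intros) (simp add: power_mult_distrib)
    also have "\<dots> \<le> C + D"
      using C[OF k] D[OF k] by (subst gexp_add) (auto intro!: elementary_intros)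
    finally show ?thesis .
  qed
  then show "\<exists>C. \<forall>k\<in>K. gexp (n k) (\<lambda>g. (\<Phi> k g * \<Psi> k g) ^ (2 * t)) \<le> C" by blast
qed (auto intro!: elementary_intros moment_boundedD[OF \<Phi>] moment_boundedD[OF \<Psi>])

text \<open>Jensen's inequality for the convex function \<open>x ^ (2 * t)\<close> and the uniform
  average over \<open>J\<close>.\<close>

lemma power_sum_le:
  fixes x :: "'j \<Rightarrow> real"
  assumes "finite J" "t > 0"
  shows "(\<Sum>j\<in>J. x j) ^ (2 * t) \<le> real (card J) ^ (2 * t - 1) * (\<Sum>j\<in>J. x j ^ (2 * t))"
proof (cases "J = {}")
  case False
  define m where "m = real (card J)"
  have m: "m > 0" using False assms(1) by (simp add: m_def card_gt_0_iff)
  have "(\<Sum>j\<in>J. (1 / m) *\<^sub>R x j) ^ (2 * t) \<le> (\<Sum>j\<in>J. (1 / m) * x j ^ (2 * t))"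
    using assms(1) False convex_power_even[of "2 * t"] m
    by (intro convex_on_sum[where C = UNIV and f = "\<lambda>x. x ^ (2 * t)"]) (auto simp: m_def)
  then have "((1 / m) * (\<Sum>j\<in>J. x j)) ^ (2 * t) \<le> (1 / m) * (\<Sum>j\<in>J. x j ^ (2 * t))"
    by (simp add: sum_distrib_left)
  then have "m ^ (2 * t) * ((1 / m) * (\<Sum>j\<in>J. x j)) ^ (2 * t) \<le>
      m ^ (2 * t) * ((1 / m) * (\<Sum>j\<in>J. x j ^ (2 * t)))"
    using m by (intro mult_left_mono) auto
  moreover have "m ^ (2 * t) = m * m ^ (2 * t - 1)" using assms(2) by (cases "2 * t") auto
  ultimately show ?thesis using m by (simp add: power_mult_distrib power_divide m_def)
qed (use assms in \<open>simp add: power_0_left\<close>)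

text \<open>The triangle inequality in \<open>L^(2t)\<close>, with uniformity over the summands
  built into the Sigma index set. It serves both boundedly many terms with \<open>c = 1\<close> and
  averages over up to \<open>N\<close> sites with \<open>c = 1 / N\<close>.\<close>

lemma moment_bounded_sum:
  assumes \<Phi>: "moment_bounded (SIGMA k:K. J k) (\<lambda>(k, j). n k) (\<lambda>(k, j). \<Phi> k j)"
    and J: "\<And>k. k \<in> K \<Longrightarrow> finite (J k)"
    and c: "\<And>k. k \<in> K \<Longrightarrow> \<bar>c k\<bar> * real (card (J k)) \<le> B"
  shows "moment_bounded K n (\<lambda>k g. c k * (\<Sum>j\<in>J k. \<Phi> k j g))"
proof (rule moment_boundedI)
  have [elementary_intros]: "\<Phi> k j \<in> elementary (n k)" if "k \<in> K" "j \<in> J k" for k j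
    using moment_boundedD[OF \<Phi>, of "(k, j)"] that by auto
  show "(\<lambda>g. c k * (\<Sum>j\<in>J k. \<Phi> k j g)) \<in> elementary (n k)" if "k \<in> K" for k
    using that by (intro elementary_intros)
  fix t :: nat assume t: "t > 0"
  obtain C where C0: "C \<ge> 0" and C1: "\<And>q. q \<in> (SIGMA k:K. J k) \<Longrightarrow>
      gexp (case q of (k, j) \<Rightarrow> n k) (\<lambda>g. (case q of (k, j) \<Rightarrow> \<Phi> k j) g ^ (2 * t)) \<le> C"
    using moment_boundedE[OF \<Phi>, where t = t] by blast
  have C: "gexp (n k) (\<lambda>g. \<Phi> k j g ^ (2 * t)) \<le> C" if "k \<in> K" "j \<in> J k" for k j
    using C1[of "(k, j)"] that by simp
  have "gexp (n k) (\<lambda>g. (c k * (\<Sum>j\<in>J k. \<Phi> k j g)) ^ (2 * t)) \<le> \<bar>B\<bar> ^ (2 * t) * C" if k: "k \<in> K" for k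
  proof -
    let ?m = "real (card (J k))"
    have m: "?m ^ (2 * t) = ?m * ?m ^ (2 * t - 1)" using t by (cases "2 * t") auto
    have "gexp (n k) (\<lambda>g. (c k * (\<Sum>j\<in>J k. \<Phi> k j g)) ^ (2 * t)) \<le>
        gexp (n k) (\<lambda>g. \<Sum>j\<in>J k. c k ^ (2 * t) * ?m ^ (2 * t - 1) * \<Phi> k j g ^ (2 * t))"
    proof (intro gexp_mono)
      fix g
      have "(c k * (\<Sum>j\<in>J k. \<Phi> k j g)) ^ (2 * t) = c k ^ (2 * t) * (\<Sum>j\<in>J k. \<Phi> k j g) ^ (2 * t)"
        by (simp add: power_mult_distrib)
      also have "\<dots> \<le> c k ^ (2 * t) * (?m ^ (2 * t - 1) * (\<Sum>j\<in>J k. \<Phi> k j g ^ (2 * t)))"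
        by (intro mult_left_mono power_sum_le J k t) auto
      finally show "(c k * (\<Sum>j\<in>J k. \<Phi> k j g)) ^ (2 * t) \<le>
          (\<Sum>j\<in>J k. c k ^ (2 * t) * ?m ^ (2 * t - 1) * \<Phi> k j g ^ (2 * t))"
        by (simp add: sum_distrib_left mult_ac)
    qed (use k in \<open>auto intro!: elementary_intros\<close>)
    also have "\<dots> = (\<Sum>j\<in>J k. c k ^ (2 * t) * ?m ^ (2 * t - 1) * gexp (n k) (\<lambda>g. \<Phi> k j g ^ (2 * t)))"
      using k by (subst gexp_sum) (auto intro!: elementary_intros)
    also have "\<dots> \<le> (\<Sum>j\<in>J k. c k ^ (2 * t) * ?m ^ (2 * t - 1) * C)"
      by (intro sum_mono mult_left_mono C k) auto
    also have "\<dots> = (\<bar>c k\<bar> * ?m) ^ (2 * t) * C"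
      unfolding power_mult_distrib m by (simp add: power_even_abs)
    also have "\<dots> \<le> \<bar>B\<bar> ^ (2 * t) * C"
      using c[OF k] by (intro mult_right_mono power_mono C0) auto
    finally show ?thesis .
  qed
  then show "\<exists>C. \<forall>k\<in>K. gexp (n k) (\<lambda>g. (c k * (\<Sum>j\<in>J k. \<Phi> k j g)) ^ (2 * t)) \<le> C" by blast
qed

lemma moment_bounded_add:
  assumes \<Phi>: "moment_bounded K n \<Phi>" and \<Psi>: "moment_bounded K n \<Psi>"
  shows "moment_bounded K n (\<lambda>k g. \<Phi> k g + \<Psi> k g)"
proof -
  have "moment_bounded (SIGMA k:K. (UNIV :: bool set)) (\<lambda>(k, j). n k)
      (\<lambda>(k, j). if j then \<Phi> k else \<Psi> k)"
  proof (rule moment_boundedI)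
    fix t :: nat
    obtain C D where C: "\<And>k. k \<in> K \<Longrightarrow> gexp (n k) (\<lambda>g. \<Phi> k g ^ (2 * t)) \<le> C"
      and D: "\<And>k. k \<in> K \<Longrightarrow> gexp (n k) (\<lambda>g. \<Psi> k g ^ (2 * t)) \<le> D"
      using moment_boundedE[OF \<Phi>, where t = t] moment_boundedE[OF \<Psi>, where t = t] by metis
    then show "\<exists>C. \<forall>k\<in>SIGMA k:K. UNIV. gexp (case k of (k, j) \<Rightarrow> n k)
        (\<lambda>g. (case k of (k, j) \<Rightarrow> if j then \<Phi> k else \<Psi> k) g ^ (2 * t)) \<le> C"
      by (intro exI[of _ "max C D"]) (auto simp: max.coboundedI1 max.coboundedI2)
  qed (auto intro: moment_boundedD[OF \<Phi>] moment_boundedD[OF \<Psi>])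
  from moment_bounded_sum[OF this, of "\<lambda>_. 1" 2]
  show ?thesis by (simp add: UNIV_bool add.commute)
qed

lemma moment_bounded_cmult:
  assumes "moment_bounded K n \<Phi>" "\<And>k. k \<in> K \<Longrightarrow> \<bar>c k\<bar> \<le> B"
  shows "moment_bounded K n (\<lambda>k g. c k * \<Phi> k g)"
  by (rule moment_bounded_mult[OF moment_bounded_const[of K c B] assms(1)]) (use assms in auto)

lemma moment_bounded_coord:
  assumes "\<And>k. k \<in> K \<Longrightarrow> x k \<in> pairs (n k)"
  shows "moment_bounded K n (\<lambda>k g. g (x k))"
proof (rule moment_boundedI)
  \<comment> \<open>The product is the double factorial of \<open>2 t - 1\<close>, obtained by
    repeated integration by parts; it is the same for every size and coordinate.\<close>
  have "gexp N (\<lambda>g. g y ^ (2 * t)) = (\<Prod>i<t. real (2 * i + 1))" if y: "y \<in> pairs N" for N y t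
  proof (induction t)
    case (Suc t)
    have "gexp N (\<lambda>g. g y ^ (2 * Suc t)) = gexp N (\<lambda>g. g y * g y ^ (2 * t + 1))" by simp
    also have "\<dots> = gexp N (dpair y (\<lambda>g. g y ^ (2 * t + 1)))"
      by (intro gauss_by_parts elementary_intros y)
    also have "dpair y (\<lambda>g. g y ^ (2 * t + 1)) = (\<lambda>g. real (2 * t + 1) * g y ^ (2 * t))"
      using y by (subst dpair_power[of _ N]) (auto intro!: elementary_intros)
    finally show ?case using Suc by simp
  qed simp
  then show "\<exists>C. \<forall>k\<in>K. gexp (n k) (\<lambda>g. g (x k) ^ (2 * t)) \<le> C" for t
    using assms by (intro exI[of _ "\<Prod>i<t. real (2 * i + 1)"]) auto
qed (use assms in \<open>auto intro!: elementary_intros\<close>)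

lemma moment_bounded_Un:
  assumes "moment_bounded K n \<Phi>" "moment_bounded K' n \<Phi>"
  shows "moment_bounded (K \<union> K') n \<Phi>"
proof (rule moment_boundedI)
  fix t :: nat
  obtain C D where "\<And>k. k \<in> K \<Longrightarrow> gexp (n k) (\<lambda>g. \<Phi> k g ^ (2 * t)) \<le> C"
    "\<And>k. k \<in> K' \<Longrightarrow> gexp (n k) (\<lambda>g. \<Phi> k g ^ (2 * t)) \<le> D"
    using moment_boundedE[OF assms(1), where t = t] moment_boundedE[OF assms(2), where t = t] by metis
  then show "\<exists>C. \<forall>k\<in>K \<union> K'. gexp (n k) (\<lambda>g. \<Phi> k g ^ (2 * t)) \<le> C"
    by (intro exI[of _ "max C D"]) (auto simp: max.coboundedI1 max.coboundedI2)
qed (use assms in \<open>auto intro: moment_boundedD\<close>)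

section \<open>Moments of Gaussian sums\<close>

text \<open>Comparing \<open>4 |a|\<close> with \<open>|s|\<close> puts the product below one of the
  two terms. The coefficient \<open>1/4\<close>, here and in the even case, makes the two absorbed
  parts add up to one half.\<close>

lemma young_odd:
  fixes a s :: real
  assumes "t > 0"
  shows "a * s ^ (2 * t - 1) \<le> s ^ (2 * t) / 4 + 4 ^ (2 * t) * a ^ (2 * t)"
proof -
  have *: "x ^ (2 * t) = x * x ^ (2 * t - 1)" for x :: real
    using assms by (cases "2 * t") auto
  have "a * s ^ (2 * t - 1) \<le> \<bar>a\<bar> * \<bar>s\<bar> ^ (2 * t - 1)"
    by (metis abs_ge_self abs_mult power_abs)
  also have "\<dots> \<le> \<bar>s\<bar> ^ (2 * t) / 4 + (4 * \<bar>a\<bar>) ^ (2 * t)"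
  proof (cases "4 * \<bar>a\<bar> \<le> \<bar>s\<bar>")
    case True
    then have "4 * \<bar>a\<bar> * \<bar>s\<bar> ^ (2 * t - 1) \<le> \<bar>s\<bar> * \<bar>s\<bar> ^ (2 * t - 1)"
      by (intro mult_right_mono) auto
    moreover have "0 \<le> (4 * \<bar>a\<bar>) ^ (2 * t)" by simp
    ultimately show ?thesis unfolding *[of "\<bar>s\<bar>"] by linarith
  next
    case False
    then have "\<bar>a\<bar> * \<bar>s\<bar> ^ (2 * t - 1) \<le> (4 * \<bar>a\<bar>) * (4 * \<bar>a\<bar>) ^ (2 * t - 1)"
      by (intro mult_mono power_mono) auto
    moreover have "0 \<le> \<bar>s\<bar> ^ (2 * t)" by simp
    ultimately show ?thesis unfolding *[of "4 * \<bar>a\<bar>"] by linarith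
  qed
  finally show ?thesis by (simp add: power_mult_distrib power_even_abs)
qed

text \<open>As in the odd case, now comparing \<open>4 |b|\<close> with \<open>s^2\<close>. This
  produces \<open>|b| ^ t\<close>, which is enlarged to \<open>1 + b ^ (2 * t)\<close> so that only
  even powers of \<open>b\<close> have to be integrated.\<close>

lemma young_even:
  fixes b s :: real
  assumes "t > 0"
  shows "b * s ^ (2 * t - 2) \<le> s ^ (2 * t) / 4 + 4 ^ t * (1 + b ^ (2 * t))"
proof -
  obtain r where r: "t = Suc r" using assms by (cases t) auto
  have s: "s ^ (2 * t - 2) = (s\<^sup>2) ^ r" "s ^ (2 * t) = s\<^sup>2 * (s\<^sup>2) ^ r"
    by (simp_all add: r power_mult power2_eq_square)
  have "\<bar>b\<bar> ^ t \<le> 1 + \<bar>b\<bar> ^ (2 * t)"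
  proof (cases "\<bar>b\<bar> \<le> 1")
    case True
    then show ?thesis using power_le_one[of "\<bar>b\<bar>" t] zero_le_power[of "\<bar>b\<bar>" "2 * t"] by linarith
  next
    case False
    then have "\<bar>b\<bar> ^ t \<le> \<bar>b\<bar> ^ (2 * t)" by (intro power_increasing) auto
    then show ?thesis by linarith
  qed
  then have b: "4 ^ t * \<bar>b\<bar> ^ t \<le> 4 ^ t * (1 + b ^ (2 * t))"
    by (simp add: power_even_abs)
  have "b * s ^ (2 * t - 2) \<le> \<bar>b\<bar> * (s\<^sup>2) ^ r"
    unfolding s by (intro mult_right_mono) auto
  also have "\<dots> \<le> s ^ (2 * t) / 4 + 4 ^ t * \<bar>b\<bar> ^ t"
  proof (cases "4 * \<bar>b\<bar> \<le> s\<^sup>2")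
    case True
    then have "4 * \<bar>b\<bar> * (s\<^sup>2) ^ r \<le> s\<^sup>2 * (s\<^sup>2) ^ r"
      by (intro mult_right_mono) auto
    moreover have "0 \<le> 4 ^ t * \<bar>b\<bar> ^ t" by simp
    ultimately show ?thesis unfolding s by linarith
  next
    case False
    then have "\<bar>b\<bar> * (s\<^sup>2) ^ r \<le> (4 * \<bar>b\<bar>) * (4 * \<bar>b\<bar>) ^ r"
      by (intro mult_mono power_mono) auto
    also have "\<dots> = 4 ^ t * \<bar>b\<bar> ^ t" by (simp add: r power_mult_distrib)
    finally have "\<bar>b\<bar> * (s\<^sup>2) ^ r \<le> 4 ^ t * \<bar>b\<bar> ^ t" .
    moreover have "0 \<le> s ^ (2 * t)" by simp
    ultimately show ?thesis by linarith
  qed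
  finally show ?thesis using b by linarith
qed

text \<open>Integration by parts in each coordinate \<open>g (y j)\<close>: the derivative hits
  \<open>G j\<close> or one of the \<open>r\<close> factors \<open>S\<close>, where it meets the
  coefficient \<open>g (y j)\<close> or some \<open>G l\<close>. For \<open>r = 0\<close> the
  truncated exponent \<open>r - 1\<close> is harmless because of the factor
  \<open>real r\<close>.\<close>

lemma moment_by_parts:
  fixes N :: nat and J :: "'j set" and y :: "'j \<Rightarrow> nat set" and c :: real
  assumes G: "\<And>j. j \<in> J \<Longrightarrow> G j \<in> elementary N" and y: "\<And>j. j \<in> J \<Longrightarrow> y j \<in> pairs N"
    and inj: "inj_on y J" and fin: "finite J"
  defines "S \<equiv> \<lambda>g. c * (\<Sum>j\<in>J. g (y j) * G j g)"
  shows "gexp N (\<lambda>g. S g ^ Suc r) = gexp N (\<lambda>g. (c * (\<Sum>j\<in>J. dpair (y j) (G j) g)) * S g ^ r +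
    real r * (c\<^sup>2 * (\<Sum>j\<in>J. G j g * (G j g + (\<Sum>l\<in>J. g (y l) * dpair (y j) (G l) g)))) * S g ^ (r - 1))"
proof -
  note [elementary_intros] = G y
  have S: "S \<in> elementary N" unfolding S_def by (auto intro!: elementary_intros)
  have dS: "dpair (y j) S = (\<lambda>g. c * (G j g + (\<Sum>l\<in>J. g (y l) * dpair (y j) (G l) g)))"
    if j: "j \<in> J" for j
  proof
    fix g
    \<comment> \<open>Injectivity of \<open>y\<close> makes the derivative of \<open>g (y l)\<close>
      by \<open>g (y j)\<close> a Kronecker delta.\<close>
    have "dpair (y j) (\<lambda>g. g (y l) * G l g) =
        (\<lambda>g. (if j = l then G l g else 0) + g (y l) * dpair (y j) (G l) g)" if "l \<in> J" for l
      using that j inj by (subst dpair_mult[of _ N]) (auto intro!: elementary_intros simp: inj_on_eq_iff fun_eq_iff)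
    then have "dpair (y j) S g = c * (\<Sum>l\<in>J. (if j = l then G l g else 0) + g (y l) * dpair (y j) (G l) g)"
      unfolding S_def by (subst dpair_cmult[of _ N] dpair_sum[of _ _ N]; (subst dpair_sum[of _ _ N])?)
        (auto intro!: elementary_intros sum.cong)
    then show "dpair (y j) S g = c * (G j g + (\<Sum>l\<in>J. g (y l) * dpair (y j) (G l) g))"
      using fin j by (simp add: sum.distrib)
  qed
  have dSr: "dpair (y j) (\<lambda>g. G j g * S g ^ r) =
      (\<lambda>g. dpair (y j) (G j) g * S g ^ r + G j g * (real r * S g ^ (r - 1) * dpair (y j) S g))"
    if "j \<in> J" for j
    using that S by (subst dpair_mult[of _ N]) (auto intro!: elementary_intros simp: dpair_power[of _ N])
  have "gexp N (\<lambda>g. S g ^ Suc r) = gexp N (\<lambda>g. \<Sum>j\<in>J. c * (g (y j) * (G j g * S g ^ r)))"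
    by (simp add: S_def sum_distrib_left sum_distrib_right mult_ac)
  also have "\<dots> = (\<Sum>j\<in>J. c * gexp N (\<lambda>g. g (y j) * (G j g * S g ^ r)))"
    using S by (subst gexp_sum) (auto intro!: elementary_intros)
  also have "\<dots> = (\<Sum>j\<in>J. c * gexp N (dpair (y j) (\<lambda>g. G j g * S g ^ r)))"
    using S by (intro sum.cong refl arg_cong2[where f = "(*)"] gauss_by_parts) (auto intro!: elementary_intros)
  also have "\<dots> = gexp N (\<lambda>g. \<Sum>j\<in>J. c * dpair (y j) (\<lambda>g. G j g * S g ^ r) g)"
    using S by (subst gexp_sum) (auto intro!: elementary_intros)
  also have "(\<lambda>g. \<Sum>j\<in>J. c * dpair (y j) (\<lambda>g. G j g * S g ^ r) g) =
     (\<lambda>g. (c * (\<Sum>j\<in>J. dpair (y j) (G j) g)) * S g ^ r +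
    real r * (c\<^sup>2 * (\<Sum>j\<in>J. G j g * (G j g + (\<Sum>l\<in>J. g (y l) * dpair (y j) (G l) g)))) * S g ^ (r - 1))"
  proof
    fix g
    have "(\<Sum>j\<in>J. c * dpair (y j) (\<lambda>g. G j g * S g ^ r) g) =
      (\<Sum>j\<in>J. c * dpair (y j) (G j) g * S g ^ r +
        real r * c\<^sup>2 * (G j g * (G j g + (\<Sum>l\<in>J. g (y l) * dpair (y j) (G l) g))) * S g ^ (r - 1))"
      by (intro sum.cong refl) (simp add: dSr dS power2_eq_square algebra_simps)
    then show "(\<Sum>j\<in>J. c * dpair (y j) (\<lambda>g. G j g * S g ^ r) g) =
      (c * (\<Sum>j\<in>J. dpair (y j) (G j) g)) * S g ^ r +
      real r * (c\<^sup>2 * (\<Sum>j\<in>J. G j g * (G j g + (\<Sum>l\<in>J. g (y l) * dpair (y j) (G l) g)))) * S g ^ (r - 1)"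
      by (simp add: sum.distrib sum_distrib_left sum_distrib_right mult.assoc)
  qed
  finally show ?thesis .
qed

lemma gexp_affine:
  assumes [elementary_intros]: "F \<in> elementary N" "G \<in> elementary N" "H \<in> elementary N"
  shows "gexp N (\<lambda>g. F g / c + (a * G g + b * (1 + d * H g))) =
    gexp N F / c + (a * gexp N G + b * (1 + d * gexp N H))"
proof -
  have "gexp N (\<lambda>g. F g / c + (a * G g + b * (1 + d * H g))) =
      gexp N (\<lambda>g. F g / c) + gexp N (\<lambda>g. a * G g + b * (1 + d * H g))"
    by (rule gexp_add) (intro elementary_intros)+
  also have "gexp N (\<lambda>g. a * G g + b * (1 + d * H g)) =
      gexp N (\<lambda>g. a * G g) + gexp N (\<lambda>g. b * (1 + d * H g))"
    by (rule gexp_add) (intro elementary_intros)+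
  also have "gexp N (\<lambda>g. b * (1 + d * H g)) = b * gexp N (\<lambda>g. 1 + d * H g)" by simp
  also have "gexp N (\<lambda>g. 1 + d * H g) = gexp N (\<lambda>g. 1) + gexp N (\<lambda>g. d * H g)"
    by (rule gexp_add) (intro elementary_intros)+
  finally show ?thesis by simp
qed

text \<open>After integration by parts, \<open>A\<close> is \<open>1 / sqrt N\<close> times a sum of
  up to \<open>N\<close> diagonal derivatives, and \<open>B\<close> is \<open>1 / N\<close> times a
  double sum. Order one is reached if diagonal derivatives gain \<open>sqrt N\<close> and
  off-diagonal ones, up to \<open>N^2\<close> in number, gain \<open>N\<close>: these are the
  hypotheses \<open>G1\<close> and \<open>G2\<close>.\<close>

lemma moment_bounded_gauss_sum:
  assumes n: "\<And>k. k \<in> K \<Longrightarrow> n k \<ge> 1"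
    and J: "\<And>k. k \<in> K \<Longrightarrow> finite (J k)" "\<And>k. k \<in> K \<Longrightarrow> card (J k) \<le> n k"
    and y: "\<And>k j. k \<in> K \<Longrightarrow> j \<in> J k \<Longrightarrow> y k j \<in> pairs (n k)" "\<And>k. k \<in> K \<Longrightarrow> inj_on (y k) (J k)"
    and G: "moment_bounded (SIGMA k:K. J k) (\<lambda>(k, j). n k) (\<lambda>(k, j). G k j)"
    and G1: "moment_bounded (SIGMA k:K. J k) (\<lambda>(k, j). n k)
      (\<lambda>(k, j) g. sqrt (n k) * dpair (y k j) (G k j) g)"
    and G2: "moment_bounded (SIGMA k:K. SIGMA j:J k. J k - {j}) (\<lambda>(k, j, l). n k)
      (\<lambda>(k, j, l) g. real (n k) * dpair (y k j) (G k l) g)"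
  shows "moment_bounded K n (\<lambda>k g. 1 / sqrt (n k) * (\<Sum>j\<in>J k. g (y k j) * G k j g))"
proof -
  define S where "S = (\<lambda>k g. 1 / sqrt (n k) * (\<Sum>j\<in>J k. g (y k j) * G k j g))"
  define A where "A = (\<lambda>k g. 1 / real (n k) * (\<Sum>j\<in>J k. sqrt (n k) * dpair (y k j) (G k j) g))"
  define H where "H = (\<lambda>k j g. G k j g * (G k j g + (g (y k j) * dpair (y k j) (G k j) g +
    1 / real (n k) * (\<Sum>l\<in>J k - {j}. g (y k l) * (real (n k) * dpair (y k j) (G k l) g)))))"
  define B where "B = (\<lambda>k g. 1 / real (n k) * (\<Sum>j\<in>J k. H k j g))"
  have Gel [elementary_intros]: "G k j \<in> elementary (n k)" if "k \<in> K" "j \<in> J k" for k j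
    using moment_boundedD[OF G, of "(k, j)"] that by simp
  have Sel [elementary_intros]: "S k \<in> elementary (n k)" if "k \<in> K" for k
    unfolding S_def using that y by (auto intro!: elementary_intros)
  have card: "\<bar>1 / real (n k)\<bar> * real (card L) \<le> 1" if "k \<in> K" "L \<subseteq> J k" for k L
    using n[OF that(1)] J[OF that(1)] card_mono[OF J(1)[OF that(1)] that(2)] by (simp add: divide_le_eq)
  have A: "moment_bounded K n A"
    unfolding A_def using card by (intro moment_bounded_sum[OF G1] J(1)) auto
  let ?KJ = "SIGMA k:K. J k"
  \<comment> \<open>Since \<open>sqrt N >= 1\<close>, the weighted derivative of \<open>G1\<close>
    dominates this unweighted diagonal term.\<close>
  have H1: "moment_bounded ?KJ (\<lambda>(k, j). n k) (\<lambda>(k, j) g. g (y k j) * dpair (y k j) (G k j) g)"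
  proof (rule moment_bounded_dominated)
    show "moment_bounded ?KJ (\<lambda>(k, j). n k)
        (\<lambda>q g. g (case q of (k, j) \<Rightarrow> y k j) *
          (case q of (k, j) \<Rightarrow> \<lambda>g. sqrt (n k) * dpair (y k j) (G k j) g) g)"
      by (intro moment_bounded_mult moment_bounded_coord G1) (use y in auto)
    show "\<bar>(case q of (k, j) \<Rightarrow> \<lambda>g. g (y k j) * dpair (y k j) (G k j) g) g\<bar> \<le>
      \<bar>g (case q of (k, j) \<Rightarrow> y k j) *
          (case q of (k, j) \<Rightarrow> \<lambda>g. sqrt (n k) * dpair (y k j) (G k j) g) g\<bar>" if "q \<in> ?KJ" for q g
      using that mult_right_mono[of 1 "sqrt (n (fst q))"
          "\<bar>g (y (fst q) (snd q)) * dpair (y (fst q) (snd q)) (G (fst q) (snd q)) g\<bar>"] n[of "fst q"]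
      by (auto simp: abs_mult mult_ac split: prod.splits)
  qed (use y in \<open>auto intro!: elementary_intros\<close>)
  have H2: "moment_bounded ?KJ (\<lambda>(k, j). n k) (\<lambda>q g. 1 / real (n (fst q)) *
      (\<Sum>l\<in>J (fst q) - {snd q}. g (y (fst q) l) * (real (n (fst q)) * dpair (y (fst q) (snd q)) (G (fst q) l) g)))"
  proof (rule moment_bounded_sum)
    have "moment_bounded (SIGMA q:?KJ. J (fst q) - {snd q}) (\<lambda>(q, l). n (fst q))
        (\<lambda>(q, l) g. real (n (fst q)) * dpair (y (fst q) (snd q)) (G (fst q) l) g)"
      by (rule moment_bounded_reindex[OF G2, where f = "\<lambda>((k, j), l). (k, j, l)"]) auto
    then have "moment_bounded (SIGMA q:?KJ. J (fst q) - {snd q}) (\<lambda>(q, l). n (fst q))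
        (\<lambda>z g. g (case z of (q, l) \<Rightarrow> y (fst q) l) *
           (case z of (q, l) \<Rightarrow> \<lambda>g. real (n (fst q)) * dpair (y (fst q) (snd q)) (G (fst q) l) g) g)"
      by (intro moment_bounded_mult moment_bounded_coord) (use y in auto)
    then show "moment_bounded (SIGMA q:?KJ. J (fst q) - {snd q}) (\<lambda>(q, l). case q of (k, j) \<Rightarrow> n k)
        (\<lambda>(q, l) g. g (y (fst q) l) * (real (n (fst q)) * dpair (y (fst q) (snd q)) (G (fst q) l) g))"
      by (simp add: case_prod_unfold)
    show "\<bar>1 / real (n (fst q))\<bar> * real (card (J (fst q) - {snd q})) \<le> 1" if "q \<in> ?KJ" for q
      using that by (intro card) auto
  qed (use J(1) in auto)
  have "moment_bounded ?KJ (\<lambda>(k, j). n k) (\<lambda>q g. (case q of (k, j) \<Rightarrow> G k j) g *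
     ((case q of (k, j) \<Rightarrow> G k j) g +
      ((case q of (k, j) \<Rightarrow> \<lambda>g. g (y k j) * dpair (y k j) (G k j) g) g + 1 / real (n (fst q)) *
      (\<Sum>l\<in>J (fst q) - {snd q}. g (y (fst q) l) * (real (n (fst q)) * dpair (y (fst q) (snd q)) (G (fst q) l) g)))))"
    by (intro moment_bounded_mult moment_bounded_add G H1 H2)
  then have H: "moment_bounded ?KJ (\<lambda>(k, j). n k) (\<lambda>(k, j). H k j)"
    by (simp add: case_prod_unfold H_def)
  have B: "moment_bounded K n B"
    unfolding B_def using card by (intro moment_bounded_sum[OF H] J(1)) auto
  have "moment_bounded K n S"
  proof (rule moment_boundedI[OF Sel])
    fix t :: nat assume t: "t > 0"
    obtain CA where CA: "\<And>k. k \<in> K \<Longrightarrow> gexp (n k) (\<lambda>g. A k g ^ (2 * t)) \<le> CA"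
      using moment_boundedE[OF A, where t = t] by blast
    obtain CB where CB: "\<And>k. k \<in> K \<Longrightarrow> gexp (n k) (\<lambda>g. B k g ^ (2 * t)) \<le> CB"
      using moment_boundedE[OF B, where t = t] by blast
    let ?r = "2 * t - 1"
    let ?C = "4 ^ (2 * t) * CA + 4 ^ t * (1 + real ?r ^ (2 * t) * CB)"
    have "gexp (n k) (\<lambda>g. S k g ^ (2 * t)) \<le> 2 * ?C" if k: "k \<in> K" for k
    proof -
      note [elementary_intros] = moment_boundedD[OF A k] moment_boundedD[OF B k] Sel[OF k]
      have nk: "real (n k) > 0" using n[OF k] by simp
      have halves: "x + y \<le> s / 2 + (x' + y')" if "x \<le> s / 4 + x'" "y \<le> s / 4 + y'"
        for x y s x' y' :: real using that by simp
      have Seq: "1 / sqrt (n k) * (\<Sum>j\<in>J k. g (y k j) * G k j g) = S k g" for g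
        by (simp add: S_def)
      have Aeq: "1 / sqrt (n k) * (\<Sum>j\<in>J k. dpair (y k j) (G k j) g) = A k g" for g
        using nk unfolding A_def by (simp add: sum_distrib_left[symmetric] real_div_sqrt field_simps)
      have Beq: "(1 / sqrt (n k))\<^sup>2 * (\<Sum>j\<in>J k. G k j g * (G k j g +
          (\<Sum>l\<in>J k. g (y k l) * dpair (y k j) (G k l) g))) = B k g" for g
      proof -
        have "(\<Sum>l\<in>J k. g (y k l) * dpair (y k j) (G k l) g) = g (y k j) * dpair (y k j) (G k j) g +
            1 / real (n k) * (\<Sum>l\<in>J k - {j}. g (y k l) * (real (n k) * dpair (y k j) (G k l) g))"
          if "j \<in> J k" for j
          using nk by (subst sum.remove[OF J(1)[OF k] that]) (simp add: sum_distrib_left)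
        then show ?thesis using nk unfolding B_def H_def by (simp add: power_divide)
      qed
      have "gexp (n k) (\<lambda>g. S k g ^ (2 * t)) = gexp (n k) (\<lambda>g. S k g ^ Suc ?r)"
        using t by simp
      also have "\<dots> = gexp (n k) (\<lambda>g. A k g * S k g ^ ?r + real ?r * B k g * S k g ^ (?r - 1))"
        using moment_by_parts[where c = "1 / sqrt (n k)" and r = "?r" and G = "G k" and y = "y k",
            OF Gel[OF k] y(1)[OF k] y(2)[OF k] J(1)[OF k]]
        unfolding Aeq Beq Seq .
      also have "\<dots> \<le> gexp (n k) (\<lambda>g. S k g ^ (2 * t) / 2 +
          (4 ^ (2 * t) * A k g ^ (2 * t) + 4 ^ t * (1 + real ?r ^ (2 * t) * B k g ^ (2 * t))))"
      proof (rule gexp_mono)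
        fix g
        show "A k g * S k g ^ ?r + real ?r * B k g * S k g ^ (?r - 1) \<le> S k g ^ (2 * t) / 2 +
          (4 ^ (2 * t) * A k g ^ (2 * t) + 4 ^ t * (1 + real ?r ^ (2 * t) * B k g ^ (2 * t)))"
        proof (rule halves)
          show "A k g * S k g ^ ?r \<le> S k g ^ (2 * t) / 4 + 4 ^ (2 * t) * A k g ^ (2 * t)"
            by (rule young_odd[OF t])
          show "real ?r * B k g * S k g ^ (?r - 1) \<le>
              S k g ^ (2 * t) / 4 + 4 ^ t * (1 + real ?r ^ (2 * t) * B k g ^ (2 * t))"
            using young_even[OF t, of "real ?r * B k g" "S k g"]
            by (simp only: power_mult_distrib diff_diff_left one_add_one)
        qed
      qed (auto intro!: elementary_intros)
      also have "\<dots> = gexp (n k) (\<lambda>g. S k g ^ (2 * t)) / 2 + (4 ^ (2 * t) * gexp (n k) (\<lambda>g. A k g ^ (2 * t)) +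
          4 ^ t * (1 + real ?r ^ (2 * t) * gexp (n k) (\<lambda>g. B k g ^ (2 * t))))"
        by (rule gexp_affine) (auto intro!: elementary_intros)
      also have "\<dots> \<le> gexp (n k) (\<lambda>g. S k g ^ (2 * t)) / 2 + ?C"
        by (rule add_left_mono, rule add_mono, rule mult_left_mono[OF CA[OF k]], simp,
            rule mult_left_mono, rule add_left_mono, rule mult_left_mono[OF CB[OF k]]) simp_all
      \<comment> \<open>The moment of \<open>S\<close> stands on both sides; subtracting half of it
        leaves the bound \<open>2 * ?C\<close>.\<close>
      finally show ?thesis by simp
    qed
    then show "\<exists>C. \<forall>k\<in>K. gexp (n k) (\<lambda>g. S k g ^ (2 * t)) \<le> C" by blast
  qed
  then show ?thesis unfolding S_def .
qed

section \<open>Moment bounds graded by the number of components\<close>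

text \<open>A list records a multiindex together with an order of application, and its set is the
  edge set of the graph. Bounds are stated for all lists, so prepending or appending a pair stays
  within the family.\<close>

abbreviation derivs :: "nat set list \<Rightarrow> (disorder \<Rightarrow> real) \<Rightarrow> disorder \<Rightarrow> real" where
  "derivs xs \<equiv> foldr dpair xs"

lemma elementary_derivs [elementary_intros]: "F \<in> elementary N \<Longrightarrow> derivs xs F \<in> elementary N"
  by (induction xs) (auto intro: elementary_dpair)

lemma derivs_const: "derivs xs (\<lambda>_. c) = (\<lambda>_. if xs = [] then c else 0)"
  by (induction xs) auto

lemma derivs_add:
  "F \<in> elementary N \<Longrightarrow> G \<in> elementary N \<Longrightarrow>
    derivs xs (\<lambda>g. F g + G g) = (\<lambda>g. derivs xs F g + derivs xs G g)"
  by (induction xs) (simp_all add: dpair_add[of _ N] elementary_derivs)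

lemma derivs_cmult:
  "F \<in> elementary N \<Longrightarrow> derivs xs (\<lambda>g. c * F g) = (\<lambda>g. c * derivs xs F g)"
  by (induction xs) (simp_all add: dpair_cmult[of _ N] elementary_derivs)

lemma derivs_sum:
  "(\<And>j. j \<in> J \<Longrightarrow> F j \<in> elementary N) \<Longrightarrow>
    derivs xs (\<lambda>g. \<Sum>j\<in>J. F j g) = (\<lambda>g. \<Sum>j\<in>J. derivs xs (F j) g)"
  by (induction xs) (simp_all add: dpair_sum[of _ _ N] elementary_derivs)

text \<open>All ways to send each derivative to the first or to the second factor of a product;
  repeated entries take the place of binomial coefficients in the Leibniz rule.\<close>

fun splits :: "'a list \<Rightarrow> ('a list \<times> 'a list) list" where
  "splits [] = [([], [])]"
| "splits (x # xs) = map (map_prod ((#) x) id) (splits xs) @ map (map_prod id ((#) x)) (splits xs)"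

lemma length_splits: "length (splits xs) = 2 ^ length xs"
  by (induction xs) auto

lemma splits_properties:
  "(us, vs) \<in> set (splits xs) \<Longrightarrow> length us + length vs = length xs \<and> set xs = set us \<union> set vs"
  by (induction xs arbitrary: us vs) fastforce+

lemma elementary_sum_list [elementary_intros]:
  "(\<And>z. z \<in> set zs \<Longrightarrow> f z \<in> elementary N) \<Longrightarrow> (\<lambda>g. \<Sum>z\<leftarrow>zs. f z g) \<in> elementary N"
  by (induction zs) (auto intro!: elementary_intros)

lemma dpair_sum_list:
  "(\<And>z. z \<in> set zs \<Longrightarrow> f z \<in> elementary N) \<Longrightarrow>
    dpair x (\<lambda>g. \<Sum>z\<leftarrow>zs. f z g) = (\<lambda>g. \<Sum>z\<leftarrow>zs. dpair x (f z) g)"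
  by (induction zs) (simp_all add: dpair_add[of _ N] elementary_sum_list)

lemma derivs_mult:
  assumes "F \<in> elementary N" "G \<in> elementary N"
  shows "derivs xs (\<lambda>g. F g * G g) =
    (\<lambda>g. \<Sum>z\<leftarrow>splits xs. derivs (fst z) F g * derivs (snd z) G g)"
proof (induction xs)
  case (Cons x xs)
  have "derivs (x # xs) (\<lambda>g. F g * G g) =
      dpair x (\<lambda>g. \<Sum>z\<leftarrow>splits xs. derivs (fst z) F g * derivs (snd z) G g)"
    using Cons by simp
  also have "\<dots> = (\<lambda>g. \<Sum>z\<leftarrow>splits xs. dpair x (\<lambda>g. derivs (fst z) F g * derivs (snd z) G g) g)"
    using assms by (intro dpair_sum_list) (auto intro!: elementary_intros)
  also have "\<dots> = (\<lambda>g. \<Sum>z\<leftarrow>splits xs. derivs (x # fst z) F g * derivs (snd z) G g +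
      derivs (fst z) F g * derivs (x # snd z) G g)"
    using assms by (simp add: dpair_mult[of _ N] elementary_intros)
  finally show ?case by (simp add: sum_list_addf o_def)
qed simp

text \<open>A coordinate is linear, so at most one derivative can hit it; \<open>s\<close> is the
  position of that derivative, which is then deleted from the list.\<close>

lemma derivs_coord_mult:
  assumes F: "F \<in> elementary N" and y: "y \<in> pairs N"
  shows "derivs xs (\<lambda>g. g y * F g) = (\<lambda>g. g y * derivs xs F g +
    (\<Sum>s<length xs. if xs ! s = y then derivs (take s xs @ drop (Suc s) xs) F g else 0))"
proof (induction xs)
  case (Cons x xs)
  note [elementary_intros] = F y
  have el_if: "(\<lambda>g. if b then G g else 0) \<in> elementary N" if "G \<in> elementary N" for b G
    using that by (cases b) (auto intro!: elementary_intros)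
  have dif: "dpair x (\<lambda>g. if b then G g else 0) = (\<lambda>g. if b then dpair x G g else 0)" for b G
    by (cases b) auto
  show ?case
  proof
    fix g
    have "derivs (x # xs) (\<lambda>g. g y * F g) g = dpair x (\<lambda>g. g y * derivs xs F g +
        (\<Sum>s<length xs. if xs ! s = y then derivs (take s xs @ drop (Suc s) xs) F g else 0)) g"
      using Cons by simp
    also have "\<dots> = dpair x (\<lambda>g. g y * derivs xs F g) g +
        (\<Sum>s<length xs. dpair x (\<lambda>g. if xs ! s = y then derivs (take s xs @ drop (Suc s) xs) F g else 0) g)"
      by (subst dpair_add[of _ N], (auto intro!: elementary_intros el_if)[2], subst dpair_sum[of _ _ N])
        (auto intro!: elementary_intros el_if)
    also have "dpair x (\<lambda>g. g y * derivs xs F g) g =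
        (if x = y then 1 else 0) * derivs xs F g + g y * dpair x (derivs xs F) g"
      by (subst dpair_mult[of _ N]) (auto intro!: elementary_intros)
    finally show "derivs (x # xs) (\<lambda>g. g y * F g) g = g y * derivs (x # xs) F g +
      (\<Sum>s<length (x # xs). if (x # xs) ! s = y
        then derivs (take s (x # xs) @ drop (Suc s) (x # xs)) F g else 0)"
      by (simp add: dif sum.lessThan_Suc_shift del: sum.lessThan_Suc cong: if_cong)
  qed
qed simp

text \<open>The weight \<open>w\<close> is a parameter because roots and graphs vary: it becomes a
  component count for one or two roots, possibly of a graph enlarged by a fixed edge. All lengths up
  to \<open>a\<close> occur because the Leibniz rule distributes derivatives over the
  factors.\<close>

definition graded_bounded :: "'i set \<Rightarrow> ('i \<Rightarrow> nat) \<Rightarrow> ('i \<Rightarrow> nat set set \<Rightarrow> nat) \<Rightarrow>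
    ('i \<Rightarrow> disorder \<Rightarrow> real) \<Rightarrow> nat \<Rightarrow> bool" where
  "graded_bounded I n w F a \<longleftrightarrow> (\<forall>i\<in>I. n i \<ge> 1 \<and> F i \<in> elementary (n i)) \<and>
     moment_bounded (SIGMA i:I. {xs. set xs \<subseteq> pairs (n i) \<and> length xs \<le> a}) (\<lambda>(i, xs). n i)
       (\<lambda>(i, xs) g. sqrt (n i) ^ (length xs + w i (set xs)) * derivs xs (F i) g)"

lemma graded_boundedI:
  assumes "\<And>i. i \<in> I \<Longrightarrow> n i \<ge> 1" "\<And>i. i \<in> I \<Longrightarrow> F i \<in> elementary (n i)"
    and "moment_bounded (SIGMA i:I. {xs. set xs \<subseteq> pairs (n i) \<and> length xs \<le> a}) (\<lambda>q. n (fst q))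
       (\<lambda>q g. sqrt (n (fst q)) ^ (length (snd q) + w (fst q) (set (snd q))) * derivs (snd q) (F (fst q)) g)"
  shows "graded_bounded I n w F a"
  using assms unfolding graded_bounded_def by (simp add: case_prod_unfold)

lemma graded_boundedD:
  assumes "graded_bounded I n w F a"
  shows "\<And>i. i \<in> I \<Longrightarrow> n i \<ge> 1" "\<And>i. i \<in> I \<Longrightarrow> F i \<in> elementary (n i)"
    and "moment_bounded (SIGMA i:I. {xs. set xs \<subseteq> pairs (n i) \<and> length xs \<le> a}) (\<lambda>q. n (fst q))
       (\<lambda>q g. sqrt (n (fst q)) ^ (length (snd q) + w (fst q) (set (snd q))) * derivs (snd q) (F (fst q)) g)"
  using assms unfolding graded_bounded_def by (simp_all add: case_prod_unfold)

lemma graded_bounded_term: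
  assumes F: "graded_bounded I n w F a"
    and q: "\<And>q. q \<in> Q \<Longrightarrow> i q \<in> I" "\<And>q. q \<in> Q \<Longrightarrow> set (xs q) \<subseteq> pairs (m q)"
      "\<And>q. q \<in> Q \<Longrightarrow> length (xs q) \<le> a" "\<And>q. q \<in> Q \<Longrightarrow> m q = n (i q)"
  shows "moment_bounded Q m
    (\<lambda>q g. sqrt (m q) ^ (length (xs q) + w (i q) (set (xs q))) * derivs (xs q) (F (i q)) g)"
  by (rule moment_bounded_reindex[OF graded_boundedD(3)[OF F], where f = "\<lambda>q. (i q, xs q)"])
    (use q in auto)

text \<open>Packages the moments, so that later estimates only compare a prefactor with a power of
  \<open>sqrt N\<close>.\<close>

lemma graded_bounded_term_le:
  assumes F: "graded_bounded I n w F a"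
    and q: "\<And>q. q \<in> Q \<Longrightarrow> i q \<in> I" "\<And>q. q \<in> Q \<Longrightarrow> set (xs q) \<subseteq> pairs (m q)"
      "\<And>q. q \<in> Q \<Longrightarrow> length (xs q) \<le> a" "\<And>q. q \<in> Q \<Longrightarrow> m q = n (i q)"
    and c: "\<And>q. q \<in> Q \<Longrightarrow> \<bar>c q\<bar> \<le> sqrt (m q) ^ (length (xs q) + w (i q) (set (xs q)))"
  shows "moment_bounded Q m (\<lambda>q g. c q * derivs (xs q) (F (i q)) g)"
proof (rule moment_bounded_dominated[OF graded_bounded_term[OF F q]])
  show "(\<lambda>g. c q * derivs (xs q) (F (i q)) g) \<in> elementary (m q)" if "q \<in> Q" for q
    using graded_boundedD(2)[OF F q(1)[OF that]] q(4)[OF that] by (auto intro!: elementary_intros)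
  show "\<bar>c q * derivs (xs q) (F (i q)) g\<bar> \<le>
      \<bar>sqrt (m q) ^ (length (xs q) + w (i q) (set (xs q))) * derivs (xs q) (F (i q)) g\<bar>"
    if "q \<in> Q" for q g
    using c[OF that] by (auto simp: abs_mult intro!: mult_right_mono)
qed

lemma sqrt_power_mono: "N \<ge> (1::nat) \<Longrightarrow> k \<le> l \<Longrightarrow> sqrt N ^ k \<le> sqrt N ^ l"
  by (intro power_increasing) auto

lemma graded_bounded_reindex:
  assumes "graded_bounded I n w F a" "\<And>i. i \<in> I' \<Longrightarrow> f i \<in> I" "\<And>i. i \<in> I' \<Longrightarrow> n' i = n (f i)"
    "\<And>i. i \<in> I' \<Longrightarrow> w' i = w (f i)" "\<And>i. i \<in> I' \<Longrightarrow> F' i = F (f i)"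
  shows "graded_bounded I' n' w' F' a"
proof (rule graded_boundedI)
  show "moment_bounded (SIGMA i:I'. {xs. set xs \<subseteq> pairs (n' i) \<and> length xs \<le> a}) (\<lambda>q. n' (fst q))
     (\<lambda>q g. sqrt (n' (fst q)) ^ (length (snd q) + w' (fst q) (set (snd q))) * derivs (snd q) (F' (fst q)) g)"
    by (rule moment_bounded_reindex[OF graded_boundedD(3)[OF assms(1)], where f = "map_prod f id"])
      (use assms(2-5) in auto)
qed (use graded_boundedD(1,2)[OF assms(1)] assms(2-5) in auto)

lemma graded_bounded_const:
  assumes "\<And>i. i \<in> I \<Longrightarrow> n i \<ge> 1" "\<And>i. i \<in> I \<Longrightarrow> \<bar>c i\<bar> \<le> B" "\<And>i. i \<in> I \<Longrightarrow> w i {} = 0"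
  shows "graded_bounded I n w (\<lambda>i _. c i) a"
proof (rule graded_boundedI)
  show "moment_bounded (SIGMA i:I. {xs. set xs \<subseteq> pairs (n i) \<and> length xs \<le> a}) (\<lambda>q. n (fst q))
       (\<lambda>q g. sqrt (n (fst q)) ^ (length (snd q) + w (fst q) (set (snd q))) *
          derivs (snd q) (\<lambda>_. c (fst q)) g)"
    unfolding derivs_const using assms
    by (intro moment_bounded_const[where B = "max B 0"]) (auto simp: le_max_iff_disj)
qed (use assms in \<open>auto intro!: elementary_intros\<close>)

lemma graded_bounded_add:
  assumes F: "graded_bounded I n w F a" and G: "graded_bounded I n w G a"
  shows "graded_bounded I n w (\<lambda>i g. F i g + G i g) a"
proof (rule graded_boundedI)
  show "moment_bounded (SIGMA i:I. {xs. set xs \<subseteq> pairs (n i) \<and> length xs \<le> a}) (\<lambda>q. n (fst q))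
       (\<lambda>q g. sqrt (n (fst q)) ^ (length (snd q) + w (fst q) (set (snd q))) *
          derivs (snd q) (\<lambda>g. F (fst q) g + G (fst q) g) g)"
    by (rule moment_bounded_reindex[OF moment_bounded_add[OF graded_boundedD(3)[OF F]
          graded_boundedD(3)[OF G]], where f = id])
      (auto simp: derivs_add[OF graded_boundedD(2)[OF F] graded_boundedD(2)[OF G]]
        algebra_simps fun_eq_iff)
qed (use graded_boundedD(1,2)[OF F] graded_boundedD(2)[OF G] in \<open>auto intro!: elementary_intros\<close>)

lemma graded_bounded_cmult:
  assumes F: "graded_bounded I n w F a" and c: "\<And>i. i \<in> I \<Longrightarrow> \<bar>c i\<bar> \<le> B"
  shows "graded_bounded I n w (\<lambda>i g. c i * F i g) a"
proof (rule graded_boundedI)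
  show "moment_bounded (SIGMA i:I. {xs. set xs \<subseteq> pairs (n i) \<and> length xs \<le> a}) (\<lambda>q. n (fst q))
       (\<lambda>q g. sqrt (n (fst q)) ^ (length (snd q) + w (fst q) (set (snd q))) *
          derivs (snd q) (\<lambda>g. c (fst q) * F (fst q) g) g)"
    by (rule moment_bounded_reindex[OF moment_bounded_cmult[OF graded_boundedD(3)[OF F],
          of "\<lambda>q. c (fst q)" B], where f = id])
      (use c in \<open>auto simp: derivs_cmult[OF graded_boundedD(2)[OF F]] algebra_simps fun_eq_iff\<close>)
qed (use graded_boundedD(1,2)[OF F] in \<open>auto intro!: elementary_intros\<close>)

text \<open>Leibniz gives at most \<open>2 ^ a\<close> products; in each, subadditivity of the
  weights distributes the power of \<open>sqrt N\<close> over the two factors.\<close>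

lemma graded_bounded_mult:
  assumes F: "graded_bounded I n w1 F a" and G: "graded_bounded I n w2 G a"
    and w: "\<And>i E1 E2. i \<in> I \<Longrightarrow> E1 \<subseteq> pairs (n i) \<Longrightarrow> E2 \<subseteq> pairs (n i) \<Longrightarrow>
      w i (E1 \<union> E2) \<le> w1 i E1 + w2 i E2"
  shows "graded_bounded I n w (\<lambda>i g. F i g * G i g) a"
proof (rule graded_boundedI)
  let ?K = "SIGMA i:I. {xs. set xs \<subseteq> pairs (n i) \<and> length xs \<le> a}"
  let ?J = "\<lambda>q. {..<length (splits (snd q))}"
  let ?W = "\<lambda>q. sqrt (n (fst q)) ^ (length (snd q) + w (fst q) (set (snd q)))"
  let ?u = "\<lambda>r. fst (splits (snd (fst r)) ! snd r)"
  let ?v = "\<lambda>r. snd (splits (snd (fst r)) ! snd r)"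
  have uv: "length (?u r) + length (?v r) = length (snd (fst r))"
    "set (snd (fst r)) = set (?u r) \<union> set (?v r)" if "r \<in> (SIGMA q:?K. ?J q)" for r
    using that splits_properties[of "?u r" "?v r" "snd (fst r)"] by auto
  have len: "length (snd (fst r)) \<le> a" "set (snd (fst r)) \<subseteq> pairs (n (fst (fst r)))"
    "fst (fst r) \<in> I" if "r \<in> (SIGMA q:?K. ?J q)" for r
    using that by auto
  have bounds: "length (?u r) \<le> a" "length (?v r) \<le> a"
    "set (?u r) \<subseteq> pairs (n (fst (fst r)))" "set (?v r) \<subseteq> pairs (n (fst (fst r)))"
    if "r \<in> (SIGMA q:?K. ?J q)" for r
    using uv[OF that] len[OF that] by simp_all
  have "moment_bounded (SIGMA q:?K. ?J q) (\<lambda>r. n (fst (fst r)))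
      (\<lambda>r g. (sqrt (n (fst (fst r))) ^ (length (?u r) + w1 (fst (fst r)) (set (?u r))) *
          derivs (?u r) (F (fst (fst r))) g) *
        (sqrt (n (fst (fst r))) ^ (length (?v r) + w2 (fst (fst r)) (set (?v r))) *
          derivs (?v r) (G (fst (fst r))) g))"
    by (intro moment_bounded_mult graded_bounded_term[OF F] graded_bounded_term[OF G] len(3) bounds refl)
  then have "moment_bounded (SIGMA q:?K. ?J q) (\<lambda>r. n (fst (fst r)))
      (\<lambda>r g. ?W (fst r) * (derivs (?u r) (F (fst (fst r))) g * derivs (?v r) (G (fst (fst r))) g))"
  proof (rule moment_bounded_dominated)
    fix r g assume r: "r \<in> (SIGMA q:?K. ?J q)"
    let ?i = "fst (fst r)"
    have "w ?i (set (snd (fst r))) \<le> w1 ?i (set (?u r)) + w2 ?i (set (?v r))"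
      using uv[OF r] len[OF r] w[of ?i "set (?u r)" "set (?v r)"] by auto
    then have "?W (fst r) \<le> sqrt (n ?i) ^ ((length (?u r) + w1 ?i (set (?u r))) +
        (length (?v r) + w2 ?i (set (?v r))))"
      using uv(1)[OF r] by (intro sqrt_power_mono graded_boundedD(1)[OF F] len(3)[OF r]) auto
    then have "?W (fst r) * \<bar>derivs (?u r) (F ?i) g * derivs (?v r) (G ?i) g\<bar> \<le>
        sqrt (n ?i) ^ ((length (?u r) + w1 ?i (set (?u r))) + (length (?v r) + w2 ?i (set (?v r)))) *
        \<bar>derivs (?u r) (F ?i) g * derivs (?v r) (G ?i) g\<bar>"
      by (intro mult_right_mono) auto
    then show "\<bar>?W (fst r) * (derivs (?u r) (F ?i) g * derivs (?v r) (G ?i) g)\<bar> \<le>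
      \<bar>(sqrt (n ?i) ^ (length (?u r) + w1 ?i (set (?u r))) * derivs (?u r) (F ?i) g) *
        (sqrt (n ?i) ^ (length (?v r) + w2 ?i (set (?v r))) * derivs (?v r) (G ?i) g)\<bar>"
      by (simp add: abs_mult power_add mult_ac)
  next
    fix r assume "r \<in> (SIGMA q:?K. ?J q)"
    then show "(\<lambda>g. ?W (fst r) * (derivs (?u r) (F (fst (fst r))) g * derivs (?v r) (G (fst (fst r))) g))
        \<in> elementary (n (fst (fst r)))"
      by (intro elementary.mult elementary.const elementary_derivs graded_boundedD(2)[OF F]
          graded_boundedD(2)[OF G] len(3))
  qed
  then have *: "moment_bounded (SIGMA q:?K. ?J q) (\<lambda>(q, s). n (fst q))
      (\<lambda>(q, s) g. ?W q * (derivs (fst (splits (snd q) ! s)) (F (fst q)) g *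
        derivs (snd (splits (snd q) ! s)) (G (fst q)) g))"
    by (simp add: case_prod_unfold)
  have "moment_bounded ?K (\<lambda>q. n (fst q)) (\<lambda>q g. 1 * (\<Sum>s\<in>?J q.
      ?W q * (derivs (fst (splits (snd q) ! s)) (F (fst q)) g *
        derivs (snd (splits (snd q) ! s)) (G (fst q)) g)))"
    by (rule moment_bounded_sum[OF *, where B = "2 ^ a"])
      (auto simp: length_splits intro!: power_increasing)
  then show "moment_bounded ?K (\<lambda>q. n (fst q)) (\<lambda>q g. ?W q * derivs (snd q) (\<lambda>g. F (fst q) g * G (fst q) g) g)"
    by (rule moment_bounded_reindex[where f = id])
      (auto simp: derivs_mult[OF graded_boundedD(2)[OF F] graded_boundedD(2)[OF G]]
        sum_list_sum_nth atLeast0LessThan sum_distrib_left fun_eq_iff)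
qed (use graded_boundedD(1,2)[OF F] graded_boundedD(2)[OF G] in \<open>auto intro!: elementary_intros\<close>)

text \<open>Trades one order for a larger index set: \<open>x\<close> joins the index, while
  \<open>sqrt N\<close> and \<open>insert\<close> account for its share of the power. It is appended
  to the list because \<open>derivs\<close> applies the last entry first.\<close>

lemma graded_bounded_dpair:
  assumes F: "graded_bounded I n w F (Suc a)"
  shows "graded_bounded (SIGMA i:I. pairs (n i)) (\<lambda>q. n (fst q)) (\<lambda>q E. w (fst q) (insert (snd q) E))
    (\<lambda>q g. sqrt (n (fst q)) * dpair (snd q) (F (fst q)) g) a"
proof (rule graded_boundedI)
  show "moment_bounded (SIGMA q:(SIGMA i:I. pairs (n i)). {xs. set xs \<subseteq> pairs (n (fst q)) \<and> length xs \<le> a})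
     (\<lambda>q. n (fst (fst q)))
     (\<lambda>q g. sqrt (n (fst (fst q))) ^ (length (snd q) + w (fst (fst q)) (insert (snd (fst q)) (set (snd q)))) *
         derivs (snd q) (\<lambda>g. sqrt (n (fst (fst q))) * dpair (snd (fst q)) (F (fst (fst q))) g) g)"
    by (rule moment_bounded_reindex[OF graded_boundedD(3)[OF F],
          where f = "\<lambda>((i, x), ys). (i, ys @ [x])"])
      (auto simp: derivs_cmult[OF elementary_dpair[OF graded_boundedD(2)[OF F]]] fun_eq_iff)
qed (use graded_boundedD(1,2)[OF F] in \<open>auto intro!: elementary_intros\<close>)

text \<open>The converse trade, which permits induction on the order: a nonempty list is split at
  its last entry, the operator applied first.\<close>

lemma graded_bounded_Suc:
  assumes F0: "graded_bounded I n w F 0"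
    and F1: "graded_bounded (SIGMA i:I. pairs (n i)) (\<lambda>q. n (fst q)) (\<lambda>q E. w (fst q) (insert (snd q) E))
    (\<lambda>q g. sqrt (n (fst q)) * dpair (snd q) (F (fst q)) g) a"
  shows "graded_bounded I n w F (Suc a)"
proof (rule graded_boundedI)
  let ?K = "\<lambda>P. SIGMA i:I. {xs. set xs \<subseteq> pairs (n i) \<and> length xs \<le> Suc a \<and> P xs}"
  let ?f = "\<lambda>q g. sqrt (n (fst q)) ^ (length (snd q) + w (fst q) (set (snd q))) * derivs (snd q) (F (fst q)) g"
  have "moment_bounded (?K (\<lambda>xs. xs = [])) (\<lambda>q. n (fst q)) ?f"
    by (rule moment_bounded_reindex[OF graded_boundedD(3)[OF F0], where f = id]) auto
  moreover have "moment_bounded (?K (\<lambda>xs. xs \<noteq> [])) (\<lambda>q. n (fst q)) ?f"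
  proof (rule moment_bounded_reindex[OF graded_boundedD(3)[OF F1],
        where f = "\<lambda>q. ((fst q, last (snd q)), butlast (snd q))"])
    fix q assume q: "q \<in> ?K (\<lambda>xs. xs \<noteq> [])"
    obtain i xs where iq: "q = (i, xs)" by (cases q)
    then have xs: "xs \<noteq> []" using q by auto
    then obtain ys x where "xs = ys @ [x]" by (metis append_butlast_last_id)
    then have qe: "q = (i, ys @ [x])" using iq by simp
    have i: "i \<in> I" "set (ys @ [x]) \<subseteq> pairs (n i)" "length ys \<le> a" using q unfolding qe by auto
    show "((fst q, last (snd q)), butlast (snd q)) \<in>
      (SIGMA q:SIGMA i:I. pairs (n i). {xs. set xs \<subseteq> pairs (n (fst q)) \<and> length xs \<le> a})"
      using i unfolding qe by simp
    have "derivs ys (\<lambda>g. sqrt (n i) * dpair x (F i) g) = (\<lambda>g. sqrt (n i) * derivs ys (dpair x (F i)) g)"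
      by (rule derivs_cmult[OF elementary_dpair[OF graded_boundedD(2)[OF F0 i(1)]]])
    then show "?f q = (\<lambda>g. sqrt (n (fst (fst ((fst q, last (snd q)), butlast (snd q))))) ^
      (length (snd ((fst q, last (snd q)), butlast (snd q))) +
       w (fst (fst ((fst q, last (snd q)), butlast (snd q))))
        (insert (snd (fst ((fst q, last (snd q)), butlast (snd q))))
          (set (snd ((fst q, last (snd q)), butlast (snd q)))))) *
      derivs (snd ((fst q, last (snd q)), butlast (snd q)))
       (\<lambda>g. sqrt (n (fst (fst ((fst q, last (snd q)), butlast (snd q))))) *
         dpair (snd (fst ((fst q, last (snd q)), butlast (snd q))))
           (F (fst (fst ((fst q, last (snd q)), butlast (snd q))))) g) g)"
      unfolding qe by (simp add: mult_ac)
  qed auto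
  ultimately have "moment_bounded (?K (\<lambda>xs. xs = []) \<union> ?K (\<lambda>xs. xs \<noteq> [])) (\<lambda>q. n (fst q)) ?f"
    by (rule moment_bounded_Un)
  then show "moment_bounded (SIGMA i:I. {xs. set xs \<subseteq> pairs (n i) \<and> length xs \<le> Suc a}) (\<lambda>q. n (fst q)) ?f"
    by (rule moment_bounded_reindex[where f = id]) auto
qed (use graded_boundedD(1,2)[OF F0] in auto)

lemma graded_bounded_order_mono:
  assumes F: "graded_bounded I n w F a" and "b \<le> a"
  shows "graded_bounded I n w F b"
  by (intro graded_boundedI graded_boundedD(1,2)[OF F]
      moment_bounded_reindex[OF graded_boundedD(3)[OF F], where f = id]) (use assms(2) in auto)

text \<open>The chain rule reduces to Leibniz: \<open>tanh' = 1 - tanh\<^sup>2\<close> is controlled by the induction on the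
  order. The shifts \<open>h i\<close> need not be bounded since only derivatives of the argument enter.\<close>

lemma graded_bounded_tanh:
  assumes F: "graded_bounded I n w F a"
    and w0: "\<And>i. i \<in> I \<Longrightarrow> w i {} = 0"
    and w: "\<And>i E1 E2. i \<in> I \<Longrightarrow> E1 \<subseteq> pairs (n i) \<Longrightarrow> E2 \<subseteq> pairs (n i) \<Longrightarrow>
      w i (E1 \<union> E2) \<le> w i E1 + w i E2"
  shows "graded_bounded I n w (\<lambda>i g. tanh (h i + F i g)) a"
  using F
proof (induction a)
  case 0
  have "moment_bounded (SIGMA i:I. {xs. set xs \<subseteq> pairs (n i) \<and> length xs \<le> 0}) (\<lambda>q. n (fst q))
       (\<lambda>q g. sqrt (n (fst q)) ^ (length (snd q) + w (fst q) (set (snd q))) *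
         derivs (snd q) (\<lambda>g. tanh (h (fst q) + F (fst q) g)) g)"
    by (rule moment_bounded_dominated[OF moment_bounded_const[of _ "\<lambda>_. 1" 1]])
      (use graded_boundedD(2)[OF 0] w0 in \<open>auto intro!: elementary_intros simp: abs_le_iff less_imp_le[OF tanh_real_lt_1]
        less_imp_le[OF tanh_real_gt_neg1] minus_le_iff\<close>)
  then show ?case
    by (intro graded_boundedI) (use graded_boundedD(1,2)[OF 0] in \<open>auto intro!: elementary_intros\<close>)
next
  case (Suc a)
  have Fa: "graded_bounded I n w F a" by (rule graded_bounded_order_mono[OF Suc.prems]) simp
  let ?u = "\<lambda>i g. tanh (h i + F i g)"
  have u: "graded_bounded I n w ?u a" using Suc.IH[OF Fa] .
  have "graded_bounded I n w (\<lambda>i g. ?u i g * ?u i g) a"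
    by (rule graded_bounded_mult[OF u u w])
  then have "graded_bounded I n w (\<lambda>i g. 1 + (- 1) * (?u i g * ?u i g)) a"
    by (intro graded_bounded_add graded_bounded_const[where B = 1] graded_bounded_cmult[where B = 1])
      (use w0 graded_boundedD(1)[OF Fa] in auto)
  then have u2: "graded_bounded (SIGMA i:I. pairs (n i)) (\<lambda>q. n (fst q)) (\<lambda>q. w (fst q))
      (\<lambda>q g. 1 - ?u (fst q) g * ?u (fst q) g) a"
    by (rule graded_bounded_reindex[where f = fst]) auto
  \<comment> \<open>The new edge is charged entirely to the derivative of \<open>F\<close>; the
    other factor keeps the weight \<open>w\<close>.\<close>
  have "graded_bounded (SIGMA i:I. pairs (n i)) (\<lambda>q. n (fst q)) (\<lambda>q E. w (fst q) (insert (snd q) E))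
    (\<lambda>q g. (1 - ?u (fst q) g * ?u (fst q) g) * (sqrt (n (fst q)) * dpair (snd q) (F (fst q)) g)) a"
  proof (rule graded_bounded_mult[OF u2 graded_bounded_dpair[OF Suc.prems]])
    fix q E1 E2 assume "q \<in> (SIGMA i:I. pairs (n i))" "E1 \<subseteq> pairs (n (fst q))" "E2 \<subseteq> pairs (n (fst q))"
    then show "w (fst q) (insert (snd q) (E1 \<union> E2)) \<le> w (fst q) E1 + w (fst q) (insert (snd q) E2)"
      using w[of "fst q" E1 "insert (snd q) E2"] by auto
  qed
  then have "graded_bounded (SIGMA i:I. pairs (n i)) (\<lambda>q. n (fst q)) (\<lambda>q E. w (fst q) (insert (snd q) E))
    (\<lambda>q g. sqrt (n (fst q)) * dpair (snd q) (?u (fst q)) g) a"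
    by (rule graded_bounded_reindex[where f = id])
      (auto simp: dpair_tanh[OF elementary.add[OF elementary.const graded_boundedD(2)[OF Fa]]]
        dpair_add[OF elementary.const graded_boundedD(2)[OF Fa]] fun_eq_iff)
  then show ?case by (intro graded_bounded_Suc graded_bounded_order_mono[OF u]) auto
qed

text \<open>Bounds the number of exceptional sites, those that are vertices of the graph,
  independently of \<open>N\<close>.\<close>

lemma card_Union_edges_le:
  assumes "set xs \<subseteq> pairs N"
  shows "card (\<Union>(set xs)) \<le> 2 * length xs"
  using assms
proof (induction xs)
  case (Cons x xs)
  have "card x \<le> 2" using Cons.prems by (auto simp: pairs_def card_insert_if)
  then show ?case using Cons card_Un_le[of x "\<Union>(set xs)"] by simp
qed simp

text \<open>Sites outside the graph lose no weight and form an average. At most \<open>2 * a\<close>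
  sites are vertices; each loses at most two units, that is a factor \<open>N\<close>, which the
  prefactor \<open>1 / N\<close> pays for.\<close>

lemma graded_bounded_average:
  assumes F: "graded_bounded (SIGMA i:I. J i) (\<lambda>(i, j). n i) (\<lambda>(i, j). w' i j) (\<lambda>(i, j). F i j) a"
    and J: "\<And>i. i \<in> I \<Longrightarrow> J i \<subseteq> {1..n i}" and n: "\<And>i. i \<in> I \<Longrightarrow> n i \<ge> 1"
    and w: "\<And>i j E. i \<in> I \<Longrightarrow> j \<in> J i \<Longrightarrow> E \<subseteq> pairs (n i) \<Longrightarrow> j \<notin> \<Union>E \<Longrightarrow> w i E \<le> w' i j E"
    and w2: "\<And>i j E. i \<in> I \<Longrightarrow> j \<in> J i \<Longrightarrow> E \<subseteq> pairs (n i) \<Longrightarrow> w i E \<le> w' i j E + 2"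
  shows "graded_bounded I n w (\<lambda>i g. 1 / real (n i) * (\<Sum>j\<in>J i. F i j g)) a"
proof (rule graded_boundedI)
  have Fel: "F i j \<in> elementary (n i)" if "i \<in> I" "j \<in> J i" for i j
    using graded_boundedD(2)[OF F, of "(i, j)"] that by simp
  have fin: "finite (J i)" if "i \<in> I" for i using J[OF that] finite_subset by blast
  show "(\<lambda>g. 1 / real (n i) * (\<Sum>j\<in>J i. F i j g)) \<in> elementary (n i)" if "i \<in> I" for i
    using that Fel by (intro elementary_intros)
  let ?K = "SIGMA i:I. {xs. set xs \<subseteq> pairs (n i) \<and> length xs \<le> a}"
  let ?W = "\<lambda>q. sqrt (n (fst q)) ^ (length (snd q) + w (fst q) (set (snd q)))"
  let ?A = "\<lambda>q. J (fst q) \<inter> \<Union>(set (snd q))" and ?B = "\<lambda>q. J (fst q) - \<Union>(set (snd q))"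
  have "moment_bounded (SIGMA q:?K. ?A q) (\<lambda>r. n (fst (fst r)))
      (\<lambda>r g. (1 / real (n (fst (fst r))) * ?W (fst r)) *
        derivs (snd (fst r)) (case (fst (fst r), snd r) of (i, j) \<Rightarrow> F i j) g)"
  proof (rule graded_bounded_term_le[OF F])
    fix r assume r: "r \<in> (SIGMA q:?K. ?A q)"
    let ?i = "fst (fst r)" and ?xs = "snd (fst r)"
    have N: "n ?i \<ge> 1" using r n by auto
    have "?W (fst r) \<le> sqrt (n ?i) ^ ((length ?xs + w' ?i (snd r) (set ?xs)) + 2)"
      using r w2[of ?i "snd r" "set ?xs"] by (intro sqrt_power_mono N) auto
    also have "\<dots> = real (n ?i) * sqrt (n ?i) ^ (length ?xs + w' ?i (snd r) (set ?xs))"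
      by (subst power_add) (simp add: mult.commute)
    finally show "\<bar>1 / real (n ?i) * ?W (fst r)\<bar> \<le> sqrt (n ?i) ^ (length ?xs +
        (case (?i, snd r) of (i, j) \<Rightarrow> w' i j) (set ?xs))"
      using N by (simp add: divide_le_eq mult.commute)
  qed auto
  then have A: "moment_bounded (SIGMA q:?K. ?A q) (\<lambda>(q, j). n (fst q))
      (\<lambda>(q, j) g. (1 / real (n (fst q)) * ?W q) * derivs (snd q) (F (fst q) j) g)"
    by (simp add: case_prod_unfold)
  have "moment_bounded (SIGMA q:?K. ?B q) (\<lambda>r. n (fst (fst r)))
      (\<lambda>r g. ?W (fst r) * derivs (snd (fst r)) (case (fst (fst r), snd r) of (i, j) \<Rightarrow> F i j) g)"
  proof (rule graded_bounded_term_le[OF F])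
    fix r assume r: "r \<in> (SIGMA q:?K. ?B q)"
    let ?i = "fst (fst r)" and ?xs = "snd (fst r)"
    have N: "n ?i \<ge> 1" using r n by auto
    show "\<bar>?W (fst r)\<bar> \<le> sqrt (n ?i) ^ (length ?xs +
        (case (?i, snd r) of (i, j) \<Rightarrow> w' i j) (set ?xs))"
      using r w[of ?i "snd r" "set ?xs"] sqrt_power_mono[OF N] by auto
  qed auto
  then have B: "moment_bounded (SIGMA q:?K. ?B q) (\<lambda>(q, j). n (fst q))
      (\<lambda>(q, j) g. ?W q * derivs (snd q) (F (fst q) j) g)"
    by (simp add: case_prod_unfold)
  have "moment_bounded ?K (\<lambda>q. n (fst q)) (\<lambda>q g.
      1 * (\<Sum>j\<in>?A q. (1 / real (n (fst q)) * ?W q) * derivs (snd q) (F (fst q) j) g) +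
      1 / real (n (fst q)) * (\<Sum>j\<in>?B q. ?W q * derivs (snd q) (F (fst q) j) g))"
  proof (intro moment_bounded_add moment_bounded_sum[OF A] moment_bounded_sum[OF B])
    fix q assume q: "q \<in> ?K"
    then show "finite (?A q)" "finite (?B q)" using fin[of "fst q"] by auto
    have "card (?A q) \<le> card (\<Union>(set (snd q)))"
      using q finite_vertices[of "set (snd q)" "n (fst q)"] by (intro card_mono) auto
    also have "\<dots> \<le> 2 * a" using q card_Union_edges_le[of "snd q" "n (fst q)"] by auto
    finally show "\<bar>1\<bar> * real (card (?A q)) \<le> real (2 * a)" by linarith
    have "?B q \<subseteq> {1..n (fst q)}" using q by (intro order_trans[OF Diff_subset J]) auto
    then have "card (?B q) \<le> card {1..n (fst q)}" by (rule card_mono[OF finite_atLeastAtMost])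
    then show "\<bar>1 / real (n (fst q))\<bar> * real (card (?B q)) \<le> 1"
      using q n[of "fst q"] by (auto simp: divide_le_eq)
  qed
  then show "moment_bounded ?K (\<lambda>q. n (fst q))
      (\<lambda>q g. ?W q * derivs (snd q) (\<lambda>g. 1 / real (n (fst q)) * (\<Sum>j\<in>J (fst q). F (fst q) j g)) g)"
  proof (rule moment_bounded_reindex[where f = id])
    fix q assume q: "q \<in> ?K"
    then have i: "fst q \<in> I" by auto
    have "(\<Sum>j\<in>J (fst q). f j) = (\<Sum>j\<in>?A q. f j) + (\<Sum>j\<in>?B q. f j)" for f :: "nat \<Rightarrow> real"
      using sum.Int_Diff[OF fin[OF i]] by blast
    moreover have "derivs (snd q) (\<lambda>g. 1 / real (n (fst q)) * (\<Sum>j\<in>J (fst q). F (fst q) j g)) =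
        (\<lambda>g. 1 / real (n (fst q)) * (\<Sum>j\<in>J (fst q). derivs (snd q) (F (fst q) j) g))"
      using Fel[OF i] by (subst derivs_cmult[of _ "n (fst q)"], intro elementary_intros)
        (auto simp: derivs_sum[of _ _ "n (fst q)"])
    ultimately show "(\<lambda>g. ?W q * derivs (snd q) (\<lambda>g. 1 / real (n (fst q)) * (\<Sum>j\<in>J (fst q). F (fst q) j g)) g) =
      (\<lambda>g. 1 * (\<Sum>j\<in>?A (id q). (1 / real (n (fst (id q))) * ?W (id q)) * derivs (snd (id q)) (F (fst (id q)) j) g) +
      1 / real (n (fst (id q))) * (\<Sum>j\<in>?B (id q). ?W (id q) * derivs (snd (id q)) (F (fst (id q)) j) g))"
      by (simp add: sum_distrib_left algebra_simps)
  qed auto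
qed (use n in auto)

section \<open>Fields indexed by sites\<close>

text \<open>All orders at once, since the coupling step consumes one order more than it yields. The
  index in \<open>\<Theta>\<close> will hold size, field and starting value.\<close>

definition field_bounded :: "'t set \<Rightarrow> ('t \<Rightarrow> nat) \<Rightarrow> ('t \<Rightarrow> nat \<Rightarrow> disorder \<Rightarrow> real) \<Rightarrow> bool" where
  "field_bounded \<Theta> n m \<longleftrightarrow> (\<forall>a. graded_bounded (SIGMA \<theta>:\<Theta>. {1..n \<theta>}) (\<lambda>z. n (fst z))
     (\<lambda>z E. ncomps E {snd z}) (\<lambda>z. m (fst z) (snd z)) a)"

lemma field_boundedD:
  assumes "field_bounded \<Theta> n m"
  shows "graded_bounded (SIGMA \<theta>:\<Theta>. {1..n \<theta>}) (\<lambda>z. n (fst z)) (\<lambda>z E. ncomps E {snd z})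
      (\<lambda>z. m (fst z) (snd z)) a"
    and "\<theta> \<in> \<Theta> \<Longrightarrow> p \<in> {1..n \<theta>} \<Longrightarrow> m \<theta> p \<in> elementary (n \<theta>)"
proof -
  show *: "graded_bounded (SIGMA \<theta>:\<Theta>. {1..n \<theta>}) (\<lambda>z. n (fst z)) (\<lambda>z E. ncomps E {snd z})
      (\<lambda>z. m (fst z) (snd z)) a" for a
    using assms unfolding field_bounded_def by blast
  show "\<theta> \<in> \<Theta> \<Longrightarrow> p \<in> {1..n \<theta>} \<Longrightarrow> m \<theta> p \<in> elementary (n \<theta>)"
    using graded_boundedD(2)[OF *, of "(\<theta>, p)"] by simp
qed

lemma field_bounded_cong:
  assumes "field_bounded \<Theta> n m" "\<And>\<theta> p. \<theta> \<in> \<Theta> \<Longrightarrow> p \<in> {1..n \<theta>} \<Longrightarrow> m' \<theta> p = m \<theta> p"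
  shows "field_bounded \<Theta> n m'"
  unfolding field_bounded_def
  by (intro allI graded_bounded_reindex[OF field_boundedD(1)[OF assms(1)], where f = id])
    (use assms(2) in auto)

lemma field_bounded_const:
  assumes "\<And>\<theta>. \<theta> \<in> \<Theta> \<Longrightarrow> n \<theta> \<ge> 1"
    and "\<And>\<theta> p. \<theta> \<in> \<Theta> \<Longrightarrow> p \<in> {1..n \<theta>} \<Longrightarrow> \<bar>c \<theta> p\<bar> \<le> B"
  shows "field_bounded \<Theta> n (\<lambda>\<theta> p _. c \<theta> p)"
  unfolding field_bounded_def using assms by (intro allI graded_bounded_const[where B = B]) auto

lemma field_bounded_add:
  "field_bounded \<Theta> n m \<Longrightarrow> field_bounded \<Theta> n m' \<Longrightarrow>
    field_bounded \<Theta> n (\<lambda>\<theta> p g. m \<theta> p g + m' \<theta> p g)"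
  unfolding field_bounded_def by (intro allI graded_bounded_add) auto

lemma field_bounded_cmult:
  "field_bounded \<Theta> n m \<Longrightarrow> field_bounded \<Theta> n (\<lambda>\<theta> p g. c * m \<theta> p g)"
  unfolding field_bounded_def by (intro allI graded_bounded_cmult[where B = "\<bar>c\<bar>"]) auto

lemma field_bounded_tanh:
  assumes "field_bounded \<Theta> n m"
  shows "field_bounded \<Theta> n (\<lambda>\<theta> p g. tanh (h \<theta> + m \<theta> p g))"
  unfolding field_bounded_def
proof (intro allI graded_bounded_tanh field_boundedD(1)[OF assms])
  fix z :: "_ \<times> nat" and E1 E2
  assume "E1 \<subseteq> pairs (n (fst z))" "E2 \<subseteq> pairs (n (fst z))"
  then show "ncomps (E1 \<union> E2) {snd z} \<le> ncomps E1 {snd z} + ncomps E2 {snd z}"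
    using ncomps_subadditive[of E1 "n (fst z)" E2 "{snd z}" "{snd z}"] by simp
qed simp

text \<open>With \<open>m'\<close> under the sum, the factors of a summand are rooted at
  \<open>j\<close>, \<open>j\<close> and \<open>p\<close>, so subadditivity gives the root set
  \<open>{j, p}\<close>. Averaging then discards \<open>j\<close>: it has no effect outside the
  graph and costs one unit on it.\<close>

lemma field_bounded_memory:
  assumes m: "field_bounded \<Theta> n m" and m': "field_bounded \<Theta> n m'"
  shows "field_bounded \<Theta> n (\<lambda>\<theta> p g. 1 / real (n \<theta>) * (\<Sum>j\<in>{1..n \<theta>}. m \<theta> j g * m \<theta> j g * m' \<theta> p g))"
  unfolding field_bounded_def
proof
  fix a
  let ?I = "SIGMA \<theta>:\<Theta>. {1..n \<theta>}"
  let ?IJ = "SIGMA z:?I. {1..n (fst z)}"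
  have mj: "graded_bounded ?IJ (\<lambda>r. n (fst (fst r))) (\<lambda>r E. ncomps E {snd r})
      (\<lambda>r. m (fst (fst r)) (snd r)) a"
    by (rule graded_bounded_reindex[OF field_boundedD(1)[OF m], where f = "\<lambda>r. (fst (fst r), snd r)"])
      auto
  have mp: "graded_bounded ?IJ (\<lambda>r. n (fst (fst r))) (\<lambda>r E. ncomps E {snd (fst r)})
      (\<lambda>r. m' (fst (fst r)) (snd (fst r))) a"
    by (rule graded_bounded_reindex[OF field_boundedD(1)[OF m'], where f = fst]) auto
  have "graded_bounded ?IJ (\<lambda>r. n (fst (fst r))) (\<lambda>r E. ncomps E {snd r})
      (\<lambda>r g. m (fst (fst r)) (snd r) g * m (fst (fst r)) (snd r) g) a"
  proof (rule graded_bounded_mult[OF mj mj])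
    fix r :: "(_ \<times> nat) \<times> nat" and E1 E2 assume "E1 \<subseteq> pairs (n (fst (fst r)))" "E2 \<subseteq> pairs (n (fst (fst r)))"
    then show "ncomps (E1 \<union> E2) {snd r} \<le> ncomps E1 {snd r} + ncomps E2 {snd r}"
      using ncomps_subadditive[of E1 _ E2 "{snd r}" "{snd r}"] by simp
  qed
  then have "graded_bounded ?IJ (\<lambda>r. n (fst (fst r))) (\<lambda>r E. ncomps E {snd r, snd (fst r)})
      (\<lambda>r g. m (fst (fst r)) (snd r) g * m (fst (fst r)) (snd r) g * m' (fst (fst r)) (snd (fst r)) g) a"
  proof (rule graded_bounded_mult[OF _ mp])
    fix r :: "(_ \<times> nat) \<times> nat" and E1 E2 assume "E1 \<subseteq> pairs (n (fst (fst r)))" "E2 \<subseteq> pairs (n (fst (fst r)))"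
    then show "ncomps (E1 \<union> E2) {snd r, snd (fst r)} \<le> ncomps E1 {snd r} + ncomps E2 {snd (fst r)}"
      using ncomps_subadditive[of E1 _ E2 "{snd r}" "{snd (fst r)}"]
      by (simp add: insert_commute)
  qed
  then have F: "graded_bounded ?IJ (\<lambda>(z, j). n (fst z)) (\<lambda>(z, j) E. ncomps E {j, snd z})
      (\<lambda>(z, j) g. m (fst z) j g * m (fst z) j g * m' (fst z) (snd z) g) a"
    by (simp add: case_prod_unfold)
  show "graded_bounded ?I (\<lambda>z. n (fst z)) (\<lambda>z E. ncomps E {snd z}) (\<lambda>z g. 1 / real (n (fst z)) *
      (\<Sum>j\<in>{1..n (fst z)}. m (fst z) j g * m (fst z) j g * m' (fst z) (snd z) g)) a"
  proof (rule graded_bounded_average[OF F])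
    fix z :: "_ \<times> nat" and j E assume E: "E \<subseteq> pairs (n (fst z))"
    show "ncomps E {snd z} \<le> ncomps E {j, snd z}" if "j \<notin> \<Union>E"
      using that by (intro eq_imp_le ncomps_cong_roots[OF E]) auto
    show "ncomps E {snd z} \<le> ncomps E {j, snd z} + 2"
      using ncomps_insert_root_le[OF E, of "{snd z}" j] by simp
  qed (use graded_boundedD(1)[OF field_boundedD(1)[OF m]] in auto)
qed

lemma pairsI: "p \<in> {1..N} \<Longrightarrow> j \<in> {1..N} - {p} \<Longrightarrow> {p, j} \<in> pairs N"
  unfolding pairs_def mem_Collect_eq
  by (cases "p < j") (intro exI[of _ "min p j"] exI[of _ "max p j"], force)+

text \<open>The Onsager prefactor \<open>1 / sqrt N\<close> is read as \<open>1 / N\<close> times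
  \<open>sqrt N\<close>: each weighted derivative is of order one and the sum is an average.
  Components avoiding \<open>p\<close> and \<open>j\<close> survive the new edge, so only the root
  \<open>j\<close> has to be discarded.\<close>

lemma field_bounded_derivative:
  assumes m: "field_bounded \<Theta> n m"
  shows "field_bounded \<Theta> n (\<lambda>\<theta> p g. 1 / real (n \<theta>) *
    (\<Sum>j\<in>{1..n \<theta>} - {p}. sqrt (n \<theta>) * dpair {p, j} (m \<theta> j) g))"
  unfolding field_bounded_def
proof
  fix a
  let ?I = "SIGMA \<theta>:\<Theta>. {1..n \<theta>}"
  let ?IJ = "SIGMA z:?I. {1..n (fst z)} - {snd z}"
  have "graded_bounded ?IJ (\<lambda>r. n (fst (fst r))) (\<lambda>r E. ncomps (insert {snd (fst r), snd r} E) {snd r})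
      (\<lambda>r g. sqrt (n (fst (fst r))) * dpair {snd (fst r), snd r} (m (fst (fst r)) (snd r)) g) a"
    by (rule graded_bounded_reindex[OF graded_bounded_dpair[OF field_boundedD(1)[OF m]],
          where f = "\<lambda>r. ((fst (fst r), snd r), {snd (fst r), snd r})"]) (auto intro!: pairsI)
  then have F: "graded_bounded ?IJ (\<lambda>(z, j). n (fst z)) (\<lambda>(z, j) E. ncomps (insert {snd z, j} E) {j})
      (\<lambda>(z, j) g. sqrt (n (fst z)) * dpair {snd z, j} (m (fst z) j) g) a"
    by (simp add: case_prod_unfold)
  show "graded_bounded ?I (\<lambda>z. n (fst z)) (\<lambda>z E. ncomps E {snd z}) (\<lambda>z g. 1 / real (n (fst z)) *
      (\<Sum>j\<in>{1..n (fst z)} - {snd z}. sqrt (n (fst z)) * dpair {snd z, j} (m (fst z) j) g)) a"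
  proof (rule graded_bounded_average[OF F])
    fix z :: "_ \<times> nat" and j E assume z: "z \<in> ?I" "j \<in> {1..n (fst z)} - {snd z}" and E: "E \<subseteq> pairs (n (fst z))"
    have "{snd z, j} \<in> pairs (n (fst z))" using z by (intro pairsI) auto
    then have 1: "ncomps E {snd z, j} \<le> ncomps (insert {snd z, j} E) {j}"
      using E by (intro ncomps_insert_edge_ge) auto
    show "ncomps E {snd z} \<le> ncomps (insert {snd z, j} E) {j}" if "j \<notin> \<Union>E"
      using that by (intro order_trans[OF eq_imp_le 1] ncomps_cong_roots[OF E]) auto
    show "ncomps E {snd z} \<le> ncomps (insert {snd z, j} E) {j} + 2"
      using ncomps_insert_root_le[OF E, of "{snd z}" j] 1 by (simp add: insert_commute)
  qed (use graded_boundedD(1)[OF field_boundedD(1)[OF m]] in auto)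
qed

lemma field_bounded_term:
  assumes m: "field_bounded \<Theta> n m"
    and "\<And>r. r \<in> Q \<Longrightarrow> \<theta> r \<in> \<Theta>" "\<And>r. r \<in> Q \<Longrightarrow> j r \<in> {1..n (\<theta> r)}"
      "\<And>r. r \<in> Q \<Longrightarrow> set (xs r) \<subseteq> pairs (n (\<theta> r))" "\<And>r. r \<in> Q \<Longrightarrow> length (xs r) \<le> a"
      "\<And>r. r \<in> Q \<Longrightarrow> \<bar>c r\<bar> \<le> sqrt (n (\<theta> r)) ^ (length (xs r) + ncomps (set (xs r)) {j r})"
  shows "moment_bounded Q (\<lambda>r. n (\<theta> r)) (\<lambda>r g. c r * derivs (xs r) (m (\<theta> r) (j r)) g)"
proof -
  have "moment_bounded Q (\<lambda>r. n (\<theta> r))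
      (\<lambda>r g. c r * derivs (xs r) (m (fst (\<theta> r, j r)) (snd (\<theta> r, j r))) g)"
    by (rule graded_bounded_term_le[OF field_boundedD(1)[OF m, of a]]) (simp_all add: assms(2-) del: atLeastAtMost_iff One_nat_def)
  then show ?thesis by simp
qed

definition delete_nth :: "nat \<Rightarrow> 'a list \<Rightarrow> 'a list" where
  "delete_nth s xs = take s xs @ drop (Suc s) xs"

lemma delete_nth:
  assumes "s < length xs"
  shows "length (delete_nth s xs) = length xs - 1" "set xs = insert (xs ! s) (set (delete_nth s xs))"
proof -
  have "set xs = set (take s xs @ xs ! s # drop (Suc s) xs)" using id_take_nth_drop[OF assms] by simp
  then show "set xs = insert (xs ! s) (set (delete_nth s xs))" by (auto simp: delete_nth_def)
qed (use assms in \<open>auto simp: delete_nth_def\<close>)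

text \<open>The last sum collects the terms in which the derivative at position \<open>s\<close>
  hits the coefficient \<open>g (y j)\<close>; the pair \<open>(s, j)\<close> is the index.\<close>

lemma derivs_coupling_sum:
  assumes F: "\<And>j. j \<in> J \<Longrightarrow> F j \<in> elementary N" and y: "\<And>j. j \<in> J \<Longrightarrow> y j \<in> pairs N"
    and J: "finite J"
  shows "derivs xs (\<lambda>g. c * (\<Sum>j\<in>J. g (y j) * F j g)) g = c * (\<Sum>j\<in>J. g (y j) * derivs xs (F j) g) +
    (\<Sum>r\<in>{r \<in> {..<length xs} \<times> J. xs ! fst r = y (snd r)}. c * derivs (delete_nth (fst r) xs) (F (snd r)) g)"
proof -
  have el': "(\<lambda>g. g (y j) * F j g) \<in> elementary N" if "j \<in> J" for j
    using that by (intro elementary_intros F y)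
  have "derivs xs (\<lambda>g. c * (\<Sum>j\<in>J. g (y j) * F j g)) g = c * (\<Sum>j\<in>J. derivs xs (\<lambda>g. g (y j) * F j g) g)"
    by (simp only: derivs_cmult[OF elementary_sum[OF el']] derivs_sum[OF el'])
  also have "(\<Sum>j\<in>J. derivs xs (\<lambda>g. g (y j) * F j g) g) = (\<Sum>j\<in>J. g (y j) * derivs xs (F j) g) +
     (\<Sum>j\<in>J. \<Sum>s<length xs. if xs ! s = y j then derivs (delete_nth s xs) (F j) g else 0)"
    unfolding sum.distrib[symmetric]
    by (intro sum.cong refl) (simp add: derivs_coord_mult[OF F y] delete_nth_def cong: if_cong)
  also have "(\<Sum>j\<in>J. \<Sum>s<length xs. if xs ! s = y j then derivs (delete_nth s xs) (F j) g else 0) =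
    (\<Sum>r\<in>{..<length xs} \<times> J. if xs ! fst r = y (snd r) then derivs (delete_nth (fst r) xs) (F (snd r)) g else 0)"
    by (subst sum.swap) (simp add: sum.cartesian_product case_prod_unfold)
  also have "\<dots> = (\<Sum>r\<in>{r \<in> {..<length xs} \<times> J. xs ! fst r = y (snd r)}. derivs (delete_nth (fst r) xs) (F (snd r)) g)"
    using J by (intro sum.inter_filter[symmetric]) auto
  finally show ?thesis by (simp add: distrib_left sum_distrib_left)
qed

text \<open>If \<open>p\<close> or \<open>j\<close> is a vertex of \<open>xs\<close>, the triangle inequality suffices for the sum over \<open>j\<close>.
  Otherwise all components of \<open>xs\<close> avoid \<open>p\<close>, and the triangle inequality would lose a factor
  \<open>sqrt N\<close>; this is where integration by parts enters: differentiating by \<open>g {p, j}\<close> gains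
  \<open>sqrt N\<close>, and \<open>N\<close> for the sites \<open>l \<noteq> j\<close> since \<open>{p, j}\<close> is then a new component avoiding \<open>l\<close>.\<close>

lemma field_bounded_coupling:
  fixes \<Theta> :: "'t set"
  assumes m: "field_bounded \<Theta> n m"
  shows "field_bounded \<Theta> n (\<lambda>\<theta> p g. 1 / sqrt (n \<theta>) * (\<Sum>j\<in>{1..n \<theta>} - {p}. g {p, j} * m \<theta> j g))"
  unfolding field_bounded_def
proof (intro allI graded_boundedI)
  fix a
  let ?I = "SIGMA \<theta>:\<Theta>. {1..n \<theta>}"
  have n: "n (fst z) \<ge> 1" if "z \<in> ?I" for z :: "'t \<times> nat" using that by auto
  show "1 \<le> n (fst z)" if "z \<in> ?I" for z :: "'t \<times> nat" using n[OF that] .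
  have mel: "m (fst z) j \<in> elementary (n (fst z))"
    if "z \<in> ?I" "j \<in> {1..n (fst z)} - {snd z}" for z :: "'t \<times> nat" and j
    using field_boundedD(2)[OF m, of "fst z" j] that by auto
  have ypairs: "{snd z, j} \<in> pairs (n (fst z))"
    if "z \<in> ?I" "j \<in> {1..n (fst z)} - {snd z}" for z :: "'t \<times> nat" and j
    using that by (intro pairsI) auto
  show "(\<lambda>g. 1 / sqrt (n (fst z)) * (\<Sum>j\<in>{1..n (fst z)} - {snd z}. g {snd z, j} * m (fst z) j g))
      \<in> elementary (n (fst z))" if "z \<in> ?I" for z :: "'t \<times> nat"
    by (intro elementary.mult elementary.const elementary_sum elementary.coord mel ypairs that)
  define K where "K = (SIGMA z:?I. {xs. set xs \<subseteq> pairs (n (fst z)) \<and> length xs \<le> a})"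
  define N where "N = (\<lambda>q :: ('t \<times> nat) \<times> nat set list. n (fst (fst q)))"
  define p where "p = (\<lambda>q :: ('t \<times> nat) \<times> nat set list. snd (fst q))"
  define V where "V = (\<lambda>q :: ('t \<times> nat) \<times> nat set list. \<Union>(set (snd q)))"
  define J where "J = (\<lambda>q. {1..N q} - {p q})"
  define W where "W = (\<lambda>q. sqrt (N q) ^ (length (snd q) + ncomps (set (snd q)) {p q}))"
  define f where "f = (\<lambda>q :: ('t \<times> nat) \<times> nat set list. m (fst (fst q)))"
  have q: "N q \<ge> 1" "fst (fst q) \<in> \<Theta>" "N q = n (fst (fst q))" "p q \<in> {1..N q}"
      "set (snd q) \<subseteq> pairs (N q)" "length (snd q) \<le> a" if "q \<in> K" for q
    using that n[of "fst q"] by (auto simp: K_def N_def p_def)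
  have W: "W q \<ge> 0" for q by (simp add: W_def)
  have y: "{p q, j} \<in> pairs (N q)" if "q \<in> K" "j \<in> J q" for q j
    using that q[OF that(1)] unfolding J_def by (intro pairsI) auto
  have Jfin: "finite (J q)" for q by (simp add: J_def)
  have Jsub: "J q \<subseteq> {1..N q}" for q by (auto simp: J_def)
  have Jcard: "card L \<le> N q" if "L \<subseteq> J q" for L q
    using card_mono[OF Jfin that] card_mono[OF finite_atLeastAtMost Jsub[of q]] by simp
  have fel: "f q j \<in> elementary (N q)" if "q \<in> K" "j \<in> J q" for q j
    using field_boundedD(2)[OF m q(2)[OF that(1)], of j] that Jsub[of q] by (auto simp: f_def N_def)
  have sqrtN: "sqrt (N q) ^ 2 = N q" for q by simp

  \<comment> \<open>Terms in which a derivative hits \<open>g {p, j}\<close>. The position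
    determines \<open>j\<close>, so there are at most \<open>a\<close> of them; the lost derivative
    is compensated by \<open>1 / sqrt N\<close>.\<close>
  define D where "D = (\<lambda>q. {r \<in> {..<length (snd q)} \<times> J q. snd q ! fst r = {p q, snd r}})"
  have D: "moment_bounded (SIGMA q:K. D q) (\<lambda>r. n (fst (fst (fst r))))
    (\<lambda>r g. (W (fst r) / sqrt (N (fst r))) * derivs (delete_nth (fst (snd r)) (snd (fst r)))
      (m (fst (fst (fst r))) (snd (snd r))) g)"
  proof (rule field_bounded_term[OF m, where a = a])
    fix r assume r: "r \<in> (SIGMA q:K. D q)"
    obtain q s j where qsj: "r = (q, s, j)" by (cases r) auto
    then have *: "q \<in> K" "s < length (snd q)" "j \<in> J q" "snd q ! s = {p q, j}"
      using r by (auto simp: D_def)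
    note q = q[OF *(1)]
    show "fst (fst (fst r)) \<in> \<Theta>" using q qsj by simp
    show "snd (snd r) \<in> {1..n (fst (fst (fst r)))}" using * Jsub[of q] q(3) qsj by auto
    let ?d = "delete_nth s (snd q)"
    have E: "set (snd q) = insert {p q, j} (set ?d)" and len: "length ?d = length (snd q) - 1"
      using delete_nth[OF *(2)] *(4) by auto
    show "set (delete_nth (fst (snd r)) (snd (fst r))) \<subseteq> pairs (n (fst (fst (fst r))))"
      using q E qsj by auto
    show "length (delete_nth (fst (snd r)) (snd (fst r))) \<le> a" using q len qsj by simp
    have "ncomps (set (snd q)) {p q} \<le> ncomps (set ?d) {j}"
      unfolding E using q(5) E by (intro ncomps_insert_edge_root_le[where N = "N q"]) auto
    then have "W q \<le> sqrt (N q) ^ Suc (length ?d + ncomps (set ?d) {j})"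
      unfolding W_def using *(2) by (intro sqrt_power_mono q(1)) (auto simp: len)
    then show "\<bar>W (fst r) / sqrt (N (fst r))\<bar> \<le> sqrt (n (fst (fst (fst r)))) ^
        (length (delete_nth (fst (snd r)) (snd (fst r))) +
         ncomps (set (delete_nth (fst (snd r)) (snd (fst r)))) {snd (snd r)})"
      using q(1,3) W[of q] qsj by (simp add: divide_le_eq mult.commute)
  qed
  have Dcard: "finite (D q)" "card (D q) \<le> length (snd q)" for q
  proof -
    have "inj_on fst (D q)" by (auto simp: inj_on_def D_def doubleton_eq_iff)
    moreover have "fst ` D q \<subseteq> {..<length (snd q)}" by (auto simp: D_def)
    ultimately show "card (D q) \<le> length (snd q)" using card_inj_on_le[of fst "D q" "{..<length (snd q)}"] by simp
    show "finite (D q)" using Jfin unfolding D_def by simp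
  qed

  \<comment> \<open>Sites that are vertices: at most \<open>2 * a\<close> terms. Replacing the root
    \<open>p\<close> by \<open>j\<close> costs at most one unit, paid by
    \<open>1 / sqrt N\<close>.\<close>
  have A: "moment_bounded (SIGMA q:K. J q \<inter> V q) (\<lambda>r. n (fst (fst (fst r))))
    (\<lambda>r g. (W (fst r) / sqrt (N (fst r))) * derivs (snd (fst r)) (m (fst (fst (fst r))) (snd r)) g)"
  proof (rule field_bounded_term[OF m, where a = a])
    fix r assume r: "r \<in> (SIGMA q:K. J q \<inter> V q)"
    obtain z j where zj: "r = (z, j)" by (cases r)
    then have *: "z \<in> K" "j \<in> J z" using r by auto
    note q = q[OF *(1)]
    show "fst (fst (fst r)) \<in> \<Theta>" "set (snd (fst r)) \<subseteq> pairs (n (fst (fst (fst r))))"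
      "length (snd (fst r)) \<le> a" using q zj by auto
    show "snd r \<in> {1..n (fst (fst (fst r)))}" using * Jsub[of z] q(3) zj by auto
    have "ncomps (set (snd z)) {p z} \<le> ncomps (set (snd z)) {j} + 1"
      using ncomps_insert_root_le[OF q(5), of "{p z}" j] ncomps_mono_roots[OF q(5), of "{j}" "{j, p z}"] by simp
    then have "W z \<le> sqrt (N z) ^ Suc (length (snd z) + ncomps (set (snd z)) {j})"
      unfolding W_def by (intro sqrt_power_mono q(1)) auto
    then show "\<bar>W (fst r) / sqrt (N (fst r))\<bar> \<le> sqrt (n (fst (fst (fst r)))) ^
        (length (snd (fst r)) + ncomps (set (snd (fst r))) {snd r})"
      using q(1,3) W[of z] zj by (simp add: divide_le_eq mult.commute)
  qed

  \<comment> \<open>The root is a vertex and \<open>j\<close> is not: with root \<open>j\<close> the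
    component of \<open>p\<close> is counted too. The spare \<open>sqrt N\<close> turns the
    normalised sum into an average.\<close>
  define JB where "JB = (\<lambda>q. if p q \<in> V q then J q - V q else {})"
  have B: "moment_bounded (SIGMA q:K. JB q) (\<lambda>r. n (fst (fst (fst r))))
    (\<lambda>r g. (sqrt (N (fst r)) * W (fst r)) * derivs (snd (fst r)) (m (fst (fst (fst r))) (snd r)) g)"
  proof (rule field_bounded_term[OF m, where a = a])
    fix r assume r: "r \<in> (SIGMA q:K. JB q)"
    obtain z j where zj: "r = (z, j)" by (cases r)
    then have *: "z \<in> K" "j \<in> J z" "p z \<in> V z" "j \<notin> V z"
      using r by (auto simp: JB_def split: if_splits)
    note q = q[OF *(1)]
    show "fst (fst (fst r)) \<in> \<Theta>" "set (snd (fst r)) \<subseteq> pairs (n (fst (fst (fst r))))"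
      "length (snd (fst r)) \<le> a" using q zj by auto
    show "snd r \<in> {1..n (fst (fst (fst r)))}" using * Jsub[of z] q(3) zj by auto
    have "ncomps (set (snd z)) {p z} + 1 \<le> ncomps (set (snd z)) {}"
      using *(3) by (intro ncomps_root_lt[OF q(5)]) (simp add: V_def)
    also have "\<dots> = ncomps (set (snd z)) {j}" using *(4) by (intro ncomps_cong_roots[OF q(5)]) (auto simp: V_def)
    finally have "sqrt (N z) ^ Suc (length (snd z) + ncomps (set (snd z)) {p z}) \<le>
        sqrt (N z) ^ (length (snd z) + ncomps (set (snd z)) {j})"
      by (intro sqrt_power_mono q(1)) auto
    then show "\<bar>sqrt (N (fst r)) * W (fst r)\<bar> \<le> sqrt (n (fst (fst (fst r)))) ^
        (length (snd (fst r)) + ncomps (set (snd (fst r))) {snd r})"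
      using q(3) W[of z] zj by (simp add: W_def abs_mult)
  qed

  \<comment> \<open>The critical sites: neither end is a vertex, so changing the root gains nothing.
    For each \<open>q\<close>, one of \<open>JB q\<close> and \<open>JC q\<close> is empty.\<close>
  define JC where "JC = (\<lambda>q. if p q \<in> V q then {} else J q - V q)"
  have JC: "j \<in> J z" "p z \<notin> V z" "j \<notin> V z" if "j \<in> JC z" for z j
    using that by (auto simp: JC_def split: if_splits)
  have C: "moment_bounded K N (\<lambda>q g. 1 / sqrt (N q) * (\<Sum>j\<in>JC q. g {p q, j} * (W q * derivs (snd q) (f q j) g)))"
  proof (rule moment_bounded_gauss_sum)
    fix q j assume "q \<in> K"
    show "1 \<le> N q" using q \<open>q \<in> K\<close> by blast
    show "finite (JC q)" "card (JC q) \<le> N q" using Jfin by (auto simp: JC_def intro!: Jcard)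
    show "j \<in> JC q \<Longrightarrow> {p q, j} \<in> pairs (N q)" using y[OF \<open>q \<in> K\<close>] JC(1) by blast
    show "inj_on (\<lambda>j. {p q, j}) (JC q)" by (auto simp: inj_on_def doubleton_eq_iff)
  next
    \<comment> \<open>Size of the summands: the counts for the roots \<open>p\<close> and
      \<open>j\<close> agree.\<close>
    have "moment_bounded (SIGMA q:K. JC q) (\<lambda>r. n (fst (fst (fst r))))
      (\<lambda>r g. W (fst r) * derivs (snd (fst r)) (m (fst (fst (fst r))) (snd r)) g)"
    proof (rule field_bounded_term[OF m, where a = a])
      fix r assume r: "r \<in> (SIGMA q:K. JC q)"
      obtain z j where zj: "r = (z, j)" by (cases r)
      then have *: "z \<in> K" "j \<in> J z" "p z \<notin> V z" "j \<notin> V z" using r JC[of j z] by auto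
      note q = q[OF *(1)]
      show "fst (fst (fst r)) \<in> \<Theta>" "set (snd (fst r)) \<subseteq> pairs (n (fst (fst (fst r))))"
        "length (snd (fst r)) \<le> a" using q zj by auto
      show "snd r \<in> {1..n (fst (fst (fst r)))}" using * Jsub[of z] q(3) zj by auto
      have "ncomps (set (snd z)) {p z} = ncomps (set (snd z)) {j}"
        using *(3,4) by (intro ncomps_cong_roots[OF q(5)]) (auto simp: V_def)
      then show "\<bar>W (fst r)\<bar> \<le> sqrt (n (fst (fst (fst r)))) ^
          (length (snd (fst r)) + ncomps (set (snd (fst r))) {snd r})"
        using q(3) W[of z] zj by (simp add: W_def)
    qed
    then show "moment_bounded (SIGMA q:K. JC q) (\<lambda>(q, j). N q) (\<lambda>(q, j) g. W q * derivs (snd q) (f q j) g)"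
      by (simp add: case_prod_unfold f_def N_def)
  next
    \<comment> \<open>Diagonal derivatives: the additional list entry supplies
      \<open>sqrt N\<close>, at the price of order \<open>a + 1\<close>.\<close>
    have "moment_bounded (SIGMA q:K. JC q) (\<lambda>r. n (fst (fst (fst r))))
      (\<lambda>r g. (sqrt (N (fst r)) * W (fst r)) *
        derivs ({p (fst r), snd r} # snd (fst r)) (m (fst (fst (fst r))) (snd r)) g)"
    proof (rule field_bounded_term[OF m, where a = "Suc a"])
      fix r assume r: "r \<in> (SIGMA q:K. JC q)"
      obtain z j where zj: "r = (z, j)" by (cases r)
      then have *: "z \<in> K" "j \<in> J z" "p z \<notin> V z" "j \<notin> V z" using r JC[of j z] by auto
      note q = q[OF *(1)]
      show "fst (fst (fst r)) \<in> \<Theta>" "length ({p (fst r), snd r} # snd (fst r)) \<le> Suc a"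
        "set ({p (fst r), snd r} # snd (fst r)) \<subseteq> pairs (n (fst (fst (fst r))))"
        using q y[OF *(1,2)] zj by auto
      show "snd r \<in> {1..n (fst (fst (fst r)))}" using * Jsub[of z] q(3) zj by auto
      have "ncomps (set (snd z)) {p z} = ncomps (set (snd z)) {p z, j}"
        using *(3,4) by (intro ncomps_cong_roots[OF q(5)]) (auto simp: V_def)
      also have "\<dots> \<le> ncomps (insert {p z, j} (set (snd z))) {j}"
        using y[OF *(1,2)] q(5) by (intro ncomps_insert_edge_ge) auto
      finally have "sqrt (N z) ^ Suc (length (snd z) + ncomps (set (snd z)) {p z}) \<le>
        sqrt (N z) ^ (Suc (length (snd z)) + ncomps (insert {p z, j} (set (snd z))) {j})"
        by (intro sqrt_power_mono q(1)) auto
      then show "\<bar>sqrt (N (fst r)) * W (fst r)\<bar> \<le> sqrt (n (fst (fst (fst r)))) ^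
          (length ({p (fst r), snd r} # snd (fst r)) + ncomps (set ({p (fst r), snd r} # snd (fst r))) {snd r})"
        using q(3) W[of z] zj by (simp add: W_def abs_mult)
    qed
    then have "moment_bounded (SIGMA q:K. JC q) (\<lambda>(q, j). N q)
      (\<lambda>(q, j) g. sqrt (N q) * W q * derivs ({p q, j} # snd q) (f q j) g)"
      by (simp add: case_prod_unfold f_def N_def)
    then show "moment_bounded (SIGMA q:K. JC q) (\<lambda>(q, j). N q)
      (\<lambda>(q, j) g. sqrt (N q) * dpair {p q, j} (\<lambda>g. W q * derivs (snd q) (f q j) g) g)"
    proof (rule moment_bounded_reindex[where f = id])
      fix r assume "r \<in> (SIGMA q:K. JC q)"
      then obtain z j where zj: "r = (z, j)" "z \<in> K" "j \<in> J z" using JC(1) by auto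
      show "(case r of (q, j) \<Rightarrow> \<lambda>g. sqrt (N q) * dpair {p q, j} (\<lambda>g. W q * derivs (snd q) (f q j) g) g) =
        (case id r of (q, j) \<Rightarrow> \<lambda>g. sqrt (N q) * W q * derivs ({p q, j} # snd q) (f q j) g)"
        unfolding zj(1) using dpair_cmult[OF elementary_derivs[OF fel[OF zj(2,3)]]] by (simp add: mult.assoc)
    qed auto
  next
    let ?Q = "SIGMA q:K. SIGMA j:JC q. JC q - {j}"
    \<comment> \<open>Off-diagonal derivatives: one \<open>sqrt N\<close> comes from the additional
      entry, the other from the new component \<open>{p, j}\<close>, which avoids the root
      \<open>l\<close>.\<close>
    have "moment_bounded ?Q (\<lambda>r. n (fst (fst (fst r))))
      (\<lambda>r g. (N (fst r) * W (fst r)) *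
        derivs ({p (fst r), fst (snd r)} # snd (fst r)) (m (fst (fst (fst r))) (snd (snd r))) g)"
    proof (rule field_bounded_term[OF m, where a = "Suc a"])
      fix r assume r: "r \<in> ?Q"
      obtain z j l where zj: "r = (z, j, l)" by (cases r)
      then have *: "z \<in> K" "j \<in> J z" "l \<in> J z" "p z \<notin> V z" "j \<notin> V z" "l \<notin> V z" "l \<noteq> j"
        using r JC[of j z] JC[of l z] by auto
      note q = q[OF *(1)]
      show "fst (fst (fst r)) \<in> \<Theta>" "length ({p (fst r), fst (snd r)} # snd (fst r)) \<le> Suc a"
        "set ({p (fst r), fst (snd r)} # snd (fst r)) \<subseteq> pairs (n (fst (fst (fst r))))"
        using q y[OF *(1,2)] zj by auto
      show "snd (snd r) \<in> {1..n (fst (fst (fst r)))}" using * Jsub[of z] q(3) zj by auto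
      have "ncomps (set (snd z)) {p z} \<le> ncomps (set (snd z)) {}" by (rule ncomps_mono_roots[OF q(5)]) simp
      moreover have "l \<noteq> p z" using *(3) by (simp add: J_def)
      then have "ncomps (set (snd z)) {} + 1 \<le> ncomps (insert {p z, j} (set (snd z))) {l}"
        using * y[OF *(1,2)] q(5) by (intro ncomps_new_component[where N = "N z"]) (auto simp: V_def)
      ultimately have "sqrt (N z) ^ (2 + (length (snd z) + ncomps (set (snd z)) {p z})) \<le>
        sqrt (N z) ^ (Suc (length (snd z)) + ncomps (insert {p z, j} (set (snd z))) {l})"
        by (intro sqrt_power_mono q(1)) auto
      then have "N z * W z \<le> sqrt (N z) ^ (Suc (length (snd z)) + ncomps (insert {p z, j} (set (snd z))) {l})"
        unfolding power_add[of _ 2] sqrtN W_def .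
      then show "\<bar>N (fst r) * W (fst r)\<bar> \<le> sqrt (n (fst (fst (fst r)))) ^
          (length ({p (fst r), fst (snd r)} # snd (fst r)) +
           ncomps (set ({p (fst r), fst (snd r)} # snd (fst r))) {snd (snd r)})"
        using q(3) W[of z] zj by (simp add: abs_mult)
    qed
    then have "moment_bounded ?Q (\<lambda>(q, j, l). N q)
      (\<lambda>(q, j, l) g. N q * W q * derivs ({p q, j} # snd q) (f q l) g)"
      by (simp add: case_prod_unfold f_def N_def)
    then show "moment_bounded ?Q (\<lambda>(q, j, l). N q)
      (\<lambda>(q, j, l) g. N q * dpair {p q, j} (\<lambda>g. W q * derivs (snd q) (f q l) g) g)"
    proof (rule moment_bounded_reindex[where f = id])
      fix r assume "r \<in> ?Q"
      then obtain z j l where zj: "r = (z, j, l)" "z \<in> K" "l \<in> J z" using JC(1) by auto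
      show "(case r of (q, j, l) \<Rightarrow> \<lambda>g. N q * dpair {p q, j} (\<lambda>g. W q * derivs (snd q) (f q l) g) g) =
        (case id r of (q, j, l) \<Rightarrow> \<lambda>g. N q * W q * derivs ({p q, j} # snd q) (f q l) g)"
        unfolding zj(1) using dpair_cmult[OF elementary_derivs[OF fel[OF zj(2,3)]]] by (simp add: mult.assoc)
    qed auto
  qed

  have D': "moment_bounded (SIGMA q:K. D q) (\<lambda>(q, r). N q)
      (\<lambda>(q, r) g. W q / sqrt (N q) * derivs (delete_nth (fst r) (snd q)) (f q (snd r)) g)"
    using D by (simp add: case_prod_unfold f_def N_def)
  have "moment_bounded (SIGMA q:K. J q \<inter> V q) (\<lambda>r. N (fst r))
      (\<lambda>r g. W (fst r) / sqrt (N (fst r)) * derivs (snd (fst r)) (f (fst r) (snd r)) g)"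
    using A unfolding f_def N_def .
  then have "moment_bounded (SIGMA q:K. J q \<inter> V q) (\<lambda>r. N (fst r))
      (\<lambda>r g. g {p (fst r), snd r} * (W (fst r) / sqrt (N (fst r)) * derivs (snd (fst r)) (f (fst r) (snd r)) g))"
    by (rule moment_bounded_mult[rotated]) (use y in \<open>auto intro!: moment_bounded_coord\<close>)
  then have A': "moment_bounded (SIGMA q:K. J q \<inter> V q) (\<lambda>(q, j). N q)
      (\<lambda>(q, j) g. g {p q, j} * (W q / sqrt (N q) * derivs (snd q) (f q j) g))"
    by (simp add: case_prod_unfold)
  have "moment_bounded (SIGMA q:K. JB q) (\<lambda>r. N (fst r))
      (\<lambda>r g. sqrt (N (fst r)) * W (fst r) * derivs (snd (fst r)) (f (fst r) (snd r)) g)"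
    using B unfolding f_def N_def .
  then have "moment_bounded (SIGMA q:K. JB q) (\<lambda>r. N (fst r))
      (\<lambda>r g. g {p (fst r), snd r} * (sqrt (N (fst r)) * W (fst r) * derivs (snd (fst r)) (f (fst r) (snd r)) g))"
    by (rule moment_bounded_mult[rotated])
      (use y in \<open>auto simp: JB_def intro!: moment_bounded_coord split: if_splits\<close>)
  then have B': "moment_bounded (SIGMA q:K. JB q) (\<lambda>(q, j). N q)
      (\<lambda>(q, j) g. g {p q, j} * (sqrt (N q) * W q * derivs (snd q) (f q j) g))"
    by (simp add: case_prod_unfold)
  \<comment> \<open>The prefactors are \<open>1\<close> for the boundedly many terms over vertices
    and over \<open>D\<close>, \<open>1 / N\<close> for the average over \<open>JB\<close>, and
    \<open>1 / sqrt N\<close> for the critical sum.\<close>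
  have "moment_bounded K N (\<lambda>q g.
      ((1 * (\<Sum>j\<in>J q \<inter> V q. g {p q, j} * (W q / sqrt (N q) * derivs (snd q) (f q j) g)) +
        1 / real (N q) * (\<Sum>j\<in>JB q. g {p q, j} * (sqrt (N q) * W q * derivs (snd q) (f q j) g))) +
       1 / sqrt (N q) * (\<Sum>j\<in>JC q. g {p q, j} * (W q * derivs (snd q) (f q j) g))) +
      1 * (\<Sum>r\<in>D q. W q / sqrt (N q) * derivs (delete_nth (fst r) (snd q)) (f q (snd r)) g))"
  proof (intro moment_bounded_add C moment_bounded_sum[OF A'] moment_bounded_sum[OF B'] moment_bounded_sum[OF D'] Dcard)
    fix z assume z: "z \<in> K"
    note q = q[OF z]
    show "finite (J z \<inter> V z)" "finite (JB z)" using Jfin by (auto simp: JB_def)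
    have "card (J z \<inter> V z) \<le> card (V z)"
      using finite_vertices[OF q(5)] by (intro card_mono) (auto simp: V_def)
    also have "\<dots> \<le> 2 * a" using card_Union_edges_le[OF q(5)] q(6) by (simp add: V_def)
    finally show "\<bar>1\<bar> * real (card (J z \<inter> V z)) \<le> real (2 * a)" by linarith
    have "card (JB z) \<le> N z" by (intro Jcard) (auto simp: JB_def)
    then show "\<bar>1 / real (N z)\<bar> * real (card (JB z)) \<le> 1" using q(1) by (simp add: divide_le_eq)
    show "\<bar>1\<bar> * real (card (D z)) \<le> real a" using Dcard(2)[of z] q(6) by simp
  qed
  then have "moment_bounded K N (\<lambda>q g. W q * derivs (snd q)
      (\<lambda>g. 1 / sqrt (N q) * (\<Sum>j\<in>J q. g {p q, j} * f q j g)) g)"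
  proof (rule moment_bounded_reindex[where f = id])
    fix z assume z: "z \<in> K"
    \<comment> \<open>Undoes the factor \<open>sqrt N\<close> that was moved from the prefactor into
      the summands over \<open>JB\<close>.\<close>
    have N: "1 / real (N z) * sqrt (N z) = 1 / sqrt (N z)"
      using q(1)[OF z] by (simp add: field_simps)
    have "(\<Sum>j\<in>J z. u j) = (\<Sum>j\<in>J z \<inter> V z. u j) + ((\<Sum>j\<in>JB z. u j) + (\<Sum>j\<in>JC z. u j))" for u :: "nat \<Rightarrow> real"
      using sum.Int_Diff[OF Jfin, of u z "V z"] by (auto simp: JB_def JC_def)
    note split = this
    show "(\<lambda>g. W z * derivs (snd z) (\<lambda>g. 1 / sqrt (N z) * (\<Sum>j\<in>J z. g {p z, j} * f z j g)) g) = (\<lambda>g.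
      ((1 * (\<Sum>j\<in>J (id z) \<inter> V (id z). g {p (id z), j} * (W (id z) / sqrt (N (id z)) * derivs (snd (id z)) (f (id z) j) g)) +
        1 / real (N (id z)) * (\<Sum>j\<in>JB (id z). g {p (id z), j} * (sqrt (N (id z)) * W (id z) * derivs (snd (id z)) (f (id z) j) g))) +
       1 / sqrt (N (id z)) * (\<Sum>j\<in>JC (id z). g {p (id z), j} * (W (id z) * derivs (snd (id z)) (f (id z) j) g))) +
      1 * (\<Sum>r\<in>D (id z). W (id z) / sqrt (N (id z)) * derivs (delete_nth (fst r) (snd (id z))) (f (id z) (snd r)) g))"
    proof
      fix g
      let ?u = "\<lambda>j. g {p z, j} * derivs (snd z) (f z j) g"
      have 1: "(\<Sum>j\<in>J z \<inter> V z. g {p z, j} * (W z / sqrt (N z) * derivs (snd z) (f z j) g)) =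
          W z / sqrt (N z) * (\<Sum>j\<in>J z \<inter> V z. ?u j)"
        by (simp add: sum_distrib_left mult_ac)
      have "1 / real (N z) * (\<Sum>j\<in>JB z. g {p z, j} * (sqrt (N z) * W z * derivs (snd z) (f z j) g)) =
          (1 / real (N z) * sqrt (N z)) * W z * (\<Sum>j\<in>JB z. ?u j)"
        by (simp add: sum_distrib_left mult_ac)
      then have 2: "1 / real (N z) * (\<Sum>j\<in>JB z. g {p z, j} * (sqrt (N z) * W z * derivs (snd z) (f z j) g)) =
          W z / sqrt (N z) * (\<Sum>j\<in>JB z. ?u j)" unfolding N by simp
      have 3: "1 / sqrt (N z) * (\<Sum>j\<in>JC z. g {p z, j} * (W z * derivs (snd z) (f z j) g)) =
          W z / sqrt (N z) * (\<Sum>j\<in>JC z. ?u j)"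
        by (simp add: sum_distrib_left mult_ac)
      have 4: "(\<Sum>r\<in>D z. W z / sqrt (N z) * derivs (delete_nth (fst r) (snd z)) (f z (snd r)) g) =
          W z * (\<Sum>r\<in>D z. 1 / sqrt (N z) * derivs (delete_nth (fst r) (snd z)) (f z (snd r)) g)"
        by (simp add: sum_distrib_left)
      have "derivs (snd z) (\<lambda>g. 1 / sqrt (N z) * (\<Sum>j\<in>J z. g {p z, j} * f z j g)) g =
          1 / sqrt (N z) * (\<Sum>j\<in>J z. ?u j) +
          (\<Sum>r\<in>D z. 1 / sqrt (N z) * derivs (delete_nth (fst r) (snd z)) (f z (snd r)) g)"
        unfolding D_def by (rule derivs_coupling_sum[OF fel[OF z] y[OF z] Jfin])
      then show "W z * derivs (snd z) (\<lambda>g. 1 / sqrt (N z) * (\<Sum>j\<in>J z. g {p z, j} * f z j g)) g =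
        ((1 * (\<Sum>j\<in>J (id z) \<inter> V (id z). g {p (id z), j} * (W (id z) / sqrt (N (id z)) * derivs (snd (id z)) (f (id z) j) g)) +
        1 / real (N (id z)) * (\<Sum>j\<in>JB (id z). g {p (id z), j} * (sqrt (N (id z)) * W (id z) * derivs (snd (id z)) (f (id z) j) g))) +
       1 / sqrt (N (id z)) * (\<Sum>j\<in>JC (id z). g {p (id z), j} * (W (id z) * derivs (snd (id z)) (f (id z) j) g))) +
      1 * (\<Sum>r\<in>D (id z). W (id z) / sqrt (N (id z)) * derivs (delete_nth (fst r) (snd (id z))) (f (id z) (snd r)) g)"
        unfolding id_apply 1 2 3 4 split[of ?u] by (simp add: algebra_simps)
    qed
  qed auto
  then show "moment_bounded (SIGMA z:?I. {xs. set xs \<subseteq> pairs (n (fst z)) \<and> length xs \<le> a}) (\<lambda>q. n (fst (fst q)))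
    (\<lambda>q g. sqrt (n (fst (fst q))) ^ (length (snd q) + ncomps (set (snd q)) {snd (fst q)}) *
      derivs (snd q) (\<lambda>g. 1 / sqrt (n (fst (fst q))) * (\<Sum>j\<in>{1..n (fst (fst q))} - {snd (fst q)}.
        g {snd (fst q), j} * m (fst (fst q)) j g)) g)"
    unfolding K_def N_def W_def p_def J_def f_def .
qed

section \<open>The iteration\<close>

text \<open>Induction over two steps, since the term \<open>Memory\<close> refers to the previous
  iterate. \<open>h\<close> may range over all reals because it enters only as a shift inside
  \<open>tanh\<close>; the starting value enters as a constant field bounded by one.\<close>

lemma field_bounded_mag:
  fixes \<beta> :: real
  defines "\<Theta> \<equiv> {(N, h :: real, m1). N \<ge> 1 \<and> (\<forall>i\<in>{1..N}. m1 i \<in> {-1..1})}"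
  shows "field_bounded \<Theta> fst (\<lambda>(N, h, m1). mag v N \<beta> h m1 k)"
proof -
  have \<Theta>: "fst \<theta> \<ge> 1" if "\<theta> \<in> \<Theta>" for \<theta> using that by (auto simp: \<Theta>_def)
  show ?thesis
  proof (induction k rule: induct_nat_012)
    case 0
    show ?case
      by (rule field_bounded_cong[OF field_bounded_const[where c = "\<lambda>_ _. 0" and B = 0]]) (use \<Theta> in auto)
    case 1
    show ?case
    proof (rule field_bounded_cong[OF field_bounded_const[where c = "\<lambda>\<theta>. snd (snd \<theta>)" and B = 1]])
      fix \<theta> p assume "\<theta> \<in> \<Theta>" "p \<in> {1..fst \<theta>}"
      then have "snd (snd \<theta>) p \<in> {-1..1}" unfolding \<Theta>_def by force
      then show "\<bar>snd (snd \<theta>) p\<bar> \<le> 1" by auto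
    qed (use \<Theta> in auto)
  next
    case (ge2 k)
    define \<mu> where "\<mu> = (\<lambda>k (N, h :: real, m1). mag v N \<beta> h m1 k)"
    have \<mu>: "field_bounded \<Theta> fst (\<mu> k)" "field_bounded \<Theta> fst (\<mu> (Suc k))"
      using ge2 unfolding \<mu>_def .
    define L where "L = (\<lambda>\<theta> p g. 1 / sqrt (real (fst \<theta>)) * (\<Sum>j\<in>{1..fst \<theta>} - {p}. g {p, j} * \<mu> (Suc k) \<theta> j g))"
    have L: "field_bounded \<Theta> fst L"
      unfolding L_def by (rule field_bounded_coupling[OF \<mu>(2)])
    define O' where "O' = (\<lambda>\<theta> p g. onsager_term v (fst \<theta>) \<beta> (\<mu> (Suc k) \<theta>) (\<mu> k \<theta>) p g)"
    have O: "field_bounded \<Theta> fst O'"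
    proof (cases v)
      case Memory
      \<comment> \<open>Expanding \<open>1 - q\<close> leaves a multiple of the previous iterate and
        a term covered by \<open>field_bounded_memory\<close>.\<close>
      have "field_bounded \<Theta> fst (\<lambda>\<theta> p g. \<beta>\<^sup>2 * \<mu> k \<theta> p g + (- \<beta>\<^sup>2) * (1 / real (fst \<theta>) *
          (\<Sum>j\<in>{1..fst \<theta>}. \<mu> (Suc k) \<theta> j g * \<mu> (Suc k) \<theta> j g * \<mu> k \<theta> p g)))"
        by (intro field_bounded_add field_bounded_cmult field_bounded_memory \<mu>)
      then show ?thesis
      proof (rule field_bounded_cong)
        show "O' \<theta> p = (\<lambda>g. \<beta>\<^sup>2 * \<mu> k \<theta> p g + (- \<beta>\<^sup>2) * (1 / real (fst \<theta>) *
          (\<Sum>j\<in>{1..fst \<theta>}. \<mu> (Suc k) \<theta> j g * \<mu> (Suc k) \<theta> j g * \<mu> k \<theta> p g)))" for \<theta> p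
          unfolding sum_distrib_right[symmetric]
          by (simp add: O'_def Memory power2_eq_square algebra_simps)
      qed
    next
      case Derivative
      have "field_bounded \<Theta> fst (\<lambda>\<theta> p g. \<beta> * (1 / real (fst \<theta>) *
          (\<Sum>j\<in>{1..fst \<theta>} - {p}. sqrt (real (fst \<theta>)) * dpair {p, j} (\<mu> (Suc k) \<theta> j) g)))"
        by (intro field_bounded_cmult field_bounded_derivative \<mu>)
      then show ?thesis
      proof (rule field_bounded_cong)
        fix \<theta> p assume \<theta>: "\<theta> \<in> \<Theta>" and p: "p \<in> {1..fst \<theta>}"
        show "O' \<theta> p = (\<lambda>g. \<beta> * (1 / real (fst \<theta>) *
          (\<Sum>j\<in>{1..fst \<theta>} - {p}. sqrt (real (fst \<theta>)) * dpair {p, j} (\<mu> (Suc k) \<theta> j) g)))"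
        proof
          fix g
          have "(\<Sum>j\<in>{1..fst \<theta>}. dd p j (\<mu> (Suc k) \<theta> j) g) =
              (\<Sum>j\<in>{1..fst \<theta>} - {p}. dpair {p, j} (\<mu> (Suc k) \<theta> j) g)"
            using p by (subst sum.remove[of _ p]) (auto simp: dd_def intro!: sum.cong)
          then have "O' \<theta> p g = \<beta> * (1 / sqrt (real (fst \<theta>))) *
              (\<Sum>j\<in>{1..fst \<theta>} - {p}. dpair {p, j} (\<mu> (Suc k) \<theta> j) g)"
            by (simp add: O'_def Derivative)
          also have "1 / sqrt (real (fst \<theta>)) = 1 / real (fst \<theta>) * sqrt (real (fst \<theta>))"
            using \<Theta>[OF \<theta>] by (simp add: field_simps)
          finally show "O' \<theta> p g = \<beta> * (1 / real (fst \<theta>) *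
            (\<Sum>j\<in>{1..fst \<theta>} - {p}. sqrt (real (fst \<theta>)) * dpair {p, j} (\<mu> (Suc k) \<theta> j) g))"
            by (simp add: sum_distrib_left mult_ac)
        qed
      qed
    qed
    have "field_bounded \<Theta> fst (\<lambda>\<theta> p g. tanh (fst (snd \<theta>) + (\<beta> * L \<theta> p g + (- 1) * O' \<theta> p g)))"
      by (intro field_bounded_tanh field_bounded_add field_bounded_cmult L O)
    then show ?case
    proof (rule field_bounded_cong)
      fix \<theta> :: "nat \<times> real \<times> (nat \<Rightarrow> real)" and p
      assume p: "p \<in> {1..fst \<theta>}"
      obtain N h m1 where \<theta>: "\<theta> = (N, h, m1)" by (cases \<theta>) auto
      show "(case \<theta> of (N, h, m1) \<Rightarrow> mag v N \<beta> h m1 (Suc (Suc k))) p =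
        (\<lambda>g. tanh (fst (snd \<theta>) + (\<beta> * L \<theta> p g + (- 1) * O' \<theta> p g)))"
      proof
        fix g
        have "(\<Sum>j\<in>{1..N}. coupling g p j * mag v N \<beta> h m1 (Suc k) j g) =
            (\<Sum>j\<in>{1..N} - {p}. g {p, j} * mag v N \<beta> h m1 (Suc k) j g)"
          using p \<theta> by (subst sum.remove[of _ p]) (auto simp: coupling_def intro!: sum.cong)
        then show "(case \<theta> of (N, h, m1) \<Rightarrow> mag v N \<beta> h m1 (Suc (Suc k))) p g =
          tanh (fst (snd \<theta>) + (\<beta> * L \<theta> p g + (- 1) * O' \<theta> p g))"
          by (simp add: \<theta> L_def O'_def \<mu>_def)
      qed
    qed
  qed
qed

section \<open>Transfer to arbitrary Gaussian disorder and to multiindices\<close>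

text \<open>By independence the restriction of \<open>X\<close> to \<open>pairs N\<close> has law
  \<open>gauss N\<close>, and elementary functions see only that restriction.\<close>

lemma gaussian_disorder_transfer:
  assumes X: "gaussian_disorder N M X" and F: "F \<in> elementary N"
  shows "integrable M (\<lambda>\<omega>. F (\<lambda>x. X x \<omega>))" "(\<integral>\<omega>. F (\<lambda>x. X x \<omega>) \<partial>M) = gexp N F"
proof -
  interpret prob_space M using X by (simp add: gaussian_disorder_def)
  have "integrable M (\<lambda>\<omega>. F (\<lambda>x. X x \<omega>)) \<and> (\<integral>\<omega>. F (\<lambda>x. X x \<omega>) \<partial>M) = gexp N F"
  proof (cases "pairs N = {}")
    case True
    \<comment> \<open>Here \<open>N <= 1\<close> and \<open>F\<close> is constant. The
      characterisation of independence by the joint law is then applied to a nonempty index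
      set.\<close>
    define c where "c = F (\<lambda>_. 0)"
    have "F = (\<lambda>_. c)"
      unfolding c_def by (rule ext, rule elementary_local[OF F]) (simp add: True)
    then show ?thesis by (simp add: prob_space)
  next
    case False
    have rv: "random_variable borel (X x)" and law: "distr M borel (X x) = std_gauss"
      if "x \<in> pairs N" for x
    proof -
      have d: "distributed M lborel (X x) std_normal_density"
        using X that by (simp add: gaussian_disorder_def)
      show "random_variable borel (X x)"
        using distributed_measurable[OF d] by simp
      have "distr M borel (X x) = distr M lborel (X x)" by (rule distr_cong) auto
      also have "\<dots> = std_gauss" unfolding std_gauss_def
        by (rule distributed_distr_eq_density[OF d])
      finally show "distr M borel (X x) = std_gauss" .
    qed
    define R where "R = (\<lambda>\<omega>. \<lambda>x\<in>pairs N. X x \<omega>)"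
    have "distr M (Pi\<^sub>M (pairs N) (\<lambda>_. borel)) R = Pi\<^sub>M (pairs N) (\<lambda>x. distr M borel (X x))"
      using X unfolding R_def gaussian_disorder_def
      by (subst indep_vars_iff_distr_eq_PiM'[symmetric]) (use False rv in auto)
    also have "\<dots> = gauss N" unfolding gauss_def by (rule PiM_cong) (use law in auto)
    finally have distr: "distr M (Pi\<^sub>M (pairs N) (\<lambda>_. borel)) R = gauss N" .
    have R: "R \<in> measurable M (Pi\<^sub>M (pairs N) (\<lambda>_. borel))"
      unfolding R_def by (rule measurable_restrict) (use rv in auto)
    have eq: "F (\<lambda>x. X x \<omega>) = F (R \<omega>)" for \<omega>
      by (rule elementary_local[OF F]) (simp add: R_def)
    note Fm = elementary_measurable[OF F]
    show ?thesis
      using integrable_elementary[OF F] unfolding eq distr[symmetric]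
      by (simp add: integrable_distr_eq[OF R Fm] integral_distr[OF R Fm])
  qed
  then show "integrable M (\<lambda>\<omega>. F (\<lambda>x. X x \<omega>))" "(\<integral>\<omega>. F (\<lambda>x. X x \<omega>) \<partial>M) = gexp N F"
    by auto
qed

text \<open>Repeating each pair \<open>x\<close> exactly \<open>\<alpha> x\<close> times along
  \<open>pair_list\<close> reproduces \<open>mi_deriv\<close>. The set of this list is the support
  of \<open>\<alpha>\<close>, so vertices, adjacency and components agree in the two
  encodings.\<close>

lemma multiindex_list:
  assumes "multiindex N \<alpha>"
  obtains xs where "mi_deriv N \<alpha> = derivs xs" "length xs = mi_order N \<alpha>" "set xs \<subseteq> pairs N"
    "\<And>p. comps_avoiding \<alpha> p = ncomps (set xs) {p}"
proof
  let ?xs = "concat (map (\<lambda>x. replicate (\<alpha> x) x) (pair_list N))"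
  show "mi_deriv N \<alpha> = derivs ?xs"
  proof -
    have "foldr (\<lambda>x. dpair x ^^ \<alpha> x) ys F = derivs (concat (map (\<lambda>x. replicate (\<alpha> x) x) ys)) F" for ys F
      by (induction ys) (simp_all add: foldr_replicate)
    then show ?thesis by (simp add: mi_deriv_def fun_eq_iff)
  qed
  show "length ?xs = mi_order N \<alpha>"
    using sum_list_distinct_conv_sum_set[OF distinct_pair_list[of N], of \<alpha>]
    by (simp add: length_concat o_def mi_order_def set_pair_list)
  have set: "set ?xs = {x. \<alpha> x > 0}"
    using assms by (auto simp: set_pair_list multiindex_def)
  then show "set ?xs \<subseteq> pairs N" using assms by (force simp: multiindex_def)
  then have pairs: "x \<in> pairs N" if "x \<in> set ?xs" for x using that by blast
  have doubleton: "\<exists>j. x = {i, j}" if x: "x \<in> set ?xs" "i \<in> x" for x i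
  proof -
    obtain i' j' where "x = {i', j'}" using pairs[OF x(1)] unfolding pairs_def by blast
    then show ?thesis using x(2) by (auto simp: insert_commute)
  qed
  have "\<Union>(set ?xs) = mg_verts \<alpha>"
  proof (intro equalityI subsetI)
    fix i assume "i \<in> \<Union>(set ?xs)"
    then obtain x where x: "x \<in> set ?xs" "i \<in> x" by blast
    then obtain j where "x = {i, j}" using doubleton by blast
    then show "i \<in> mg_verts \<alpha>" using x(1) unfolding set mg_verts_def by auto
  next
    fix i assume "i \<in> mg_verts \<alpha>"
    then show "i \<in> \<Union>(set ?xs)" unfolding set mg_verts_def by auto
  qed
  moreover have "edge_adj (set ?xs) = mg_adj \<alpha>" unfolding edge_adj_def mg_adj_def set by simp
  ultimately show "comps_avoiding \<alpha> p = ncomps (set ?xs) {p}" for p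
    by (simp add: comps_avoiding_def ncomps_def mg_components_def edge_comps_def)
qed

theorem theorem9:
  fixes v :: onsager and \<beta> :: real and t k a :: nat
  assumes "t \<ge> 1" and "k \<ge> 1"
  shows "\<exists>C>0. \<forall>(N::nat) (m1 :: nat \<Rightarrow> real) (M :: 'w measure) (X :: nat set \<Rightarrow> 'w \<Rightarrow> real)
           (\<alpha> :: nat set \<Rightarrow> nat) (p::nat) (h::real).
      N \<ge> 1 \<longrightarrow> (\<forall>i\<in>{1..N}. m1 i \<in> {-1..1}) \<longrightarrow> gaussian_disorder N M X \<longrightarrow>
      multiindex N \<alpha> \<longrightarrow> mi_order N \<alpha> = a \<longrightarrow> p \<in> {1..N} \<longrightarrow>
      (let Z = (\<lambda>\<omega>. (sqrt (real N) ^ (mi_order N \<alpha> + comps_avoiding \<alpha> p) *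
                 mi_deriv N \<alpha> (mag v N \<beta> h m1 k p) (\<lambda>x. X x \<omega>)) ^ (2 * t))
       in integrable M Z \<and> prob_space.expectation M Z \<le> C)"
proof -
  let ?\<Theta> = "{(N, h :: real, m1 :: nat \<Rightarrow> real). N \<ge> 1 \<and> (\<forall>i\<in>{1..N}. m1 i \<in> {-1..1})}"
  let ?I = "SIGMA \<theta>:?\<Theta>. {1..fst \<theta>}"
  let ?K = "SIGMA z:?I. {xs. set xs \<subseteq> pairs (fst (fst z)) \<and> length xs \<le> a}"
  let ?f = "\<lambda>q g. sqrt (real (fst (fst (fst q)))) ^ (length (snd q) + ncomps (set (snd q)) {snd (fst q)}) *
    derivs (snd q) ((case fst (fst q) of (N, h, m1) \<Rightarrow> mag v N \<beta> h m1 k) (snd (fst q))) g"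
  \<comment> \<open>\<open>v\<close>, \<beta>, \<open>k\<close> and \<open>a\<close> are fixed;
    size, field, starting value, site and derivatives all lie in \<open>?K\<close>, so for each
    \<open>t\<close> one constant serves every choice.\<close>
  have bounded: "moment_bounded ?K (\<lambda>q. fst (fst (fst q))) ?f"
    by (rule graded_boundedD(3)[OF field_boundedD(1)[OF field_bounded_mag]])
  obtain C where C: "C \<ge> 0" "\<And>q. q \<in> ?K \<Longrightarrow> gexp (fst (fst (fst q))) (\<lambda>g. ?f q g ^ (2 * t)) \<le> C"
    using moment_boundedE[OF bounded, where t = t] by blast
  show ?thesis
  proof (rule exI[of _ "C + 1"], intro conjI allI impI)
    \<comment> \<open>\<open>C\<close> is only known to be nonnegative; adding one makes it
      positive.\<close>
    show "0 < C + 1" using C(1) by simp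
    fix N :: nat and m1 :: "nat \<Rightarrow> real" and M :: "'w measure" and X :: "nat set \<Rightarrow> 'w \<Rightarrow> real"
      and \<alpha> :: "nat set \<Rightarrow> nat" and p :: nat and h :: real
    assume N: "1 \<le> N" and m1: "\<forall>i\<in>{1..N}. m1 i \<in> {-1..1}" and X: "gaussian_disorder N M X"
      and \<alpha>: "multiindex N \<alpha>" "mi_order N \<alpha> = a" and p: "p \<in> {1..N}"
    obtain xs where xs: "mi_deriv N \<alpha> = derivs xs" "length xs = a" "set xs \<subseteq> pairs N"
      "\<And>p. comps_avoiding \<alpha> p = ncomps (set xs) {p}"
      using multiindex_list[OF \<alpha>(1)] \<alpha>(2) by metis
    let ?q = "(((N, h, m1), p), xs)"
    have q: "?q \<in> ?K" using N m1 p xs(2,3) by simp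
    have el: "(\<lambda>g. ?f ?q g ^ (2 * t)) \<in> elementary N"
      using moment_boundedD[OF bounded q] by (simp add: elementary_power)
    show "let Z = (\<lambda>\<omega>. (sqrt (real N) ^ (mi_order N \<alpha> + comps_avoiding \<alpha> p) *
                 mi_deriv N \<alpha> (mag v N \<beta> h m1 k p) (\<lambda>x. X x \<omega>)) ^ (2 * t))
       in integrable M Z \<and> prob_space.expectation M Z \<le> C + 1"
      using gaussian_disorder_transfer[OF X el] C(2)[OF q] by (simp add: xs \<alpha>(2))
  qed
qed

end
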